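(* Metric compatible affine connections exist on any super-null Riemannian manifold: if $(M,g,Q,P)$ is a super-null Riemannian manifold, then there exists an affine connection $\nabla$ on $M$ such that $$X\langle Y|Z\rangle = \langle \nabla_X Y|Z\rangle + (-1)^{\widetilde{X}\,\widetilde{Y}}\langle Y|\nabla_X Z\rangle$$ for all (homogeneous) $X,Y,Z\in\mathrm{Vect}(M)$.
   Context: Supermanifolds are real, finite-dimensional, in the Berezin–Leites (locally ringed space) sense, $M=(|M|,\mathcal{O}_M)$; $C^\infty(M)$ is the superalgebra of global functions, $\mathrm{Vect}(M)$ the $C^\infty(M)$-module of vector fields, $\widetilde{\cdot}$ denotes $\mathbb{Z}_2$-parity, and $[X,Y]=XY-(-1)^{\widetilde X\widetilde Y}YX$ is the graded commutator. A metric $g$ on $M$ is an even, graded-symmetric, rank 2 covariant tensor, possibly degenerate; it determines a pairing $\langle X|Y\rangle$ with $\widetilde{\langle X|Y\rangle}=\widetilde X+\widetilde Y$, $\langle X|Y\rangle=(-1)^{\widetilde X\widetilde Y}\langle Y|X\rangle$, $\langle fX+Y|Z\rangle=f\langle X|Z\rangle+\langle Y|Z\rangle$. Its kernel is $\ker(g)=\{X\in\mathrm{Vect}(M) : \langle X|Y\rangle=0\ \text{for all } Y\in\mathrm{Vect}(M)\}$; $g$ is degenerate if $\ker(g)\neq\{0\}$. A super-null Riemannian manifold is a quadruple $(M,g,Q,P)$ where $M$ is a supermanifold of dimension $n|1$ ($n\ge 1$), $g$ is a degenerate (even) metric on $M$, $Q\in\mathrm{Vect}(M)$ is a non-singular odd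 vector field (i.e. its value in $T_mM$ is nonzero at every point $m\in|M|$) with $[Q,Q]=2P$ for an even vector field $P$, and $\ker(g)=\mathrm{Span}\{Q\}$ (the $C^\infty(M)$-span). It is part of the setting that the rank of the kernel is constant, equal to $0|1$ (at every point $m\in |M|$ the bilinear form induced by $g$ on $T_mM$ has kernel of dimension $0|1$), and that around every point of $|M|$ there are Shander coordinates $(x^a,t,\tau)$, with $x^a,t$ even and $\tau$ odd, in which $Q=\partial_\tau+\tau\partial_t$ and $P=\partial_t$. An affine connection on $M$ is a parity-preserving map $\nabla:\mathrm{Vect}(M)\times\mathrm{Vect}(M)\to\mathrm{Vect}(M)$, $(X,Y)\mapsto\nabla_XY$, that is biadditive, satisfies $\nabla_{fX}Y=f\nabla_XY$ and $\nabla_X(fY)=X(f)Y+(-1)^{\widetilde X\widetilde f}f\nabla_XY$ for $f\in C^\infty(M)$. *)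

theory Defs
  imports "HOL-Analysis.Analysis" "HOL-Algebra.Module" "HOL-Library.Z2"
begin

section \<open>Real superalgebras\<close>

text \<open>
  Parities are elements of the two-element field \<^typ>\<open>bit\<close>;
  \<open>koszul i j\<close> is the sign $(-1)^{ij}$.
\<close>

definition koszul :: "bit \<Rightarrow> bit \<Rightarrow> real"
  where "koszul i j = (if i * j = 1 then - 1 else 1)"

definition real_ring :: "real ring"
  where "real_ring = \<lparr>carrier = UNIV, mult = (*), one = 1, zero = 0, add = (+)\<rparr>"

record 'f superalg = "(real, 'f) module" +
  homog :: "bit \<Rightarrow> 'f set"

definition superalgebra :: "'f superalg \<Rightarrow> bool"
  where "superalgebra A \<longleftrightarrow>
    Ring.ring A \<and> Module.module real_ring A \<and>
    (\<forall>r. \<forall>x\<in>carrier A. \<forall>y\<in>carrier A.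
        (r \<odot>\<^bsub>A\<^esub> x) \<otimes>\<^bsub>A\<^esub> y = r \<odot>\<^bsub>A\<^esub> (x \<otimes>\<^bsub>A\<^esub> y) \<and> x \<otimes>\<^bsub>A\<^esub> (r \<odot>\<^bsub>A\<^esub> y) = r \<odot>\<^bsub>A\<^esub> (x \<otimes>\<^bsub>A\<^esub> y)) \<and>
    (\<forall>i. submodule (homog A i) real_ring A) \<and>
    homog A 0 \<inter> homog A 1 = {\<zero>\<^bsub>A\<^esub>} \<and>
    (\<forall>x\<in>carrier A. \<exists>x0\<in>homog A 0. \<exists>x1\<in>homog A 1. x = x0 \<oplus>\<^bsub>A\<^esub> x1) \<and>
    (\<forall>i j. \<forall>x\<in>homog A i. \<forall>y\<in>homog A j.
        x \<otimes>\<^bsub>A\<^esub> y \<in> homog A (i + j) \<and> x \<otimes>\<^bsub>A\<^esub> y = koszul i j \<odot>\<^bsub>A\<^esub> (y \<otimes>\<^bsub>A\<^esub> x))"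

definition superalg_hom :: "'f superalg \<Rightarrow> 'g superalg \<Rightarrow> ('f \<Rightarrow> 'g) set"
  where "superalg_hom A B = {h \<in> ring_hom A B.
    (\<forall>r. \<forall>x\<in>carrier A. h (r \<odot>\<^bsub>A\<^esub> x) = r \<odot>\<^bsub>B\<^esub> h x) \<and> (\<forall>i. h ` homog A i \<subseteq> homog B i)}"

definition superalg_iso :: "'f superalg \<Rightarrow> 'g superalg \<Rightarrow> ('f \<Rightarrow> 'g) set"
  where "superalg_iso A B = {h \<in> superalg_hom A B. bij_betw h (carrier A) (carrier B)}"


section \<open>The local model\<close>

text \<open>\<open>Ck_on k V f\<close> is meant for open \<open>V\<close>: \<open>f\<close> is $k$ times continuously differentiable on \<open>V\<close>.\<close>

primrec Ck_on :: "nat \<Rightarrow> (real ^ 'n::finite) set \<Rightarrow> (real ^ 'n \<Rightarrow> real) \<Rightarrow> bool"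
  where
    "Ck_on 0 V f \<longleftrightarrow> continuous_on V f"
  | "Ck_on (Suc k) V f \<longleftrightarrow> f differentiable_on V \<and>
       (\<forall>a. Ck_on k V (\<lambda>x. frechet_derivative f (at x) (axis a 1)))"

definition smooth_on :: "(real ^ 'n::finite) set \<Rightarrow> (real ^ 'n \<Rightarrow> real) \<Rightarrow> bool"
  where "smooth_on V f \<longleftrightarrow> (\<forall>k. Ck_on k V f)"

text \<open>
  A superfunction $h(x,\theta) = \sum_I h_I(x)\,\theta_I$ on \<open>V\<close> with odd coordinates
  $\theta_0,\dots,\theta_{q-1}$ is represented by the map \<open>x \<mapsto> I \<mapsto> h\<^sub>I(x)\<close>, extended by zero
  outside \<open>V\<close> and outside the subsets of \<open>{..<q}\<close>; here $\theta_I = \theta_{i_1}\cdots\theta_{i_k}$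
  with $I = \{i_1 < \dots < i_k\}$.
\<close>

type_synonym 'n superfun = "(real ^ 'n) \<Rightarrow> nat set \<Rightarrow> real"

text \<open>The sign in $\theta_I\theta_J = \pm\,\theta_{I\cup J}$ for disjoint \<open>I\<close>, \<open>J\<close>.\<close>

definition wedge_sign :: "nat set \<Rightarrow> nat set \<Rightarrow> real"
  where "wedge_sign I J = (- 1) ^ card {(i, j). i \<in> I \<and> j \<in> J \<and> j < i}"

definition superdomain :: "nat \<Rightarrow> (real ^ 'n::finite) set \<Rightarrow> 'n superfun superalg"
  where "superdomain q V = \<lparr>
    carrier = {h. (\<forall>x I. h x I \<noteq> 0 \<longrightarrow> x \<in> V \<and> I \<subseteq> {..<q}) \<and> (\<forall>I. smooth_on V (\<lambda>x. h x I))},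
    mult = (\<lambda>h k x K. \<Sum>I\<in>Pow K. wedge_sign I (K - I) * h x I * k x (K - I)),
    one = (\<lambda>x I. if x \<in> V \<and> I = {} then 1 else 0),
    zero = (\<lambda>x I. 0),
    add = (\<lambda>h k x I. h x I + k x I),
    smult = (\<lambda>r h x I. r * h x I),
    homog = (\<lambda>i. {h. (\<forall>x I. h x I \<noteq> 0 \<longrightarrow> x \<in> V \<and> I \<subseteq> {..<q} \<and> of_nat (card I) = i) \<and>
                     (\<forall>I. smooth_on V (\<lambda>x. h x I))})\<rparr>"

definition sf_restrict :: "(real ^ 'n) set \<Rightarrow> 'n superfun \<Rightarrow> 'n superfun"
  where "sf_restrict V h = (\<lambda>x I. if x \<in> V then h x I else 0)"

definition d_even :: "(real ^ 'n::finite) set \<Rightarrow> 'n \<Rightarrow> 'n superfun \<Rightarrow> 'n superfun"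
  where "d_even V a h =
    (\<lambda>x I. if x \<in> V then frechet_derivative (\<lambda>y. h y I) (at x) (axis a 1) else 0)"

text \<open>The left derivative $\partial/\partial\theta_j$ and left multiplication by $\theta_j$.\<close>

definition d_odd :: "nat \<Rightarrow> 'n superfun \<Rightarrow> 'n superfun"
  where "d_odd j h = (\<lambda>x I. if j \<in> I then 0 else wedge_sign {j} I * h x (insert j I))"

definition theta_mult :: "nat \<Rightarrow> 'n superfun \<Rightarrow> 'n superfun"
  where "theta_mult j h = (\<lambda>x I. if j \<in> I then wedge_sign {j} (I - {j}) * h x (I - {j}) else 0)"


section \<open>Supermanifolds\<close>

record ('p, 'f) superspace =
  body :: "'p topology"
  sections :: "'p set \<Rightarrow> 'f superalg"
  restr :: "'p set \<Rightarrow> 'p set \<Rightarrow> 'f \<Rightarrow> 'f"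

text \<open>\<open>restr M U V\<close> is the restriction from \<open>U\<close> to \<open>V \<subseteq> U\<close>.\<close>

definition superalgebra_sheaf :: "('p, 'f) superspace \<Rightarrow> bool"
  where "superalgebra_sheaf M \<longleftrightarrow>
    (\<forall>U. openin (body M) U \<longrightarrow> superalgebra (sections M U)) \<and>
    (\<forall>U V. openin (body M) U \<and> openin (body M) V \<and> V \<subseteq> U \<longrightarrow>
        restr M U V \<in> superalg_hom (sections M U) (sections M V)) \<and>
    (\<forall>U. openin (body M) U \<longrightarrow> (\<forall>f\<in>carrier (sections M U). restr M U U f = f)) \<and>
    (\<forall>U V W. openin (body M) U \<and> openin (body M) V \<and> openin (body M) W \<and> W \<subseteq> V \<and> V \<subseteq> U \<longrightarrow>
        (\<forall>f\<in>carrier (sections M U). restr M V W (restr M U V f) = restr M U W f)) \<and>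
    (\<forall>\<U> s. (\<forall>U\<in>\<U>. openin (body M) U \<and> s U \<in> carrier (sections M U)) \<and>
        (\<forall>U\<in>\<U>. \<forall>V\<in>\<U>. restr M U (U \<inter> V) (s U) = restr M V (U \<inter> V) (s V)) \<longrightarrow>
        (\<exists>!f. f \<in> carrier (sections M (\<Union>\<U>)) \<and> (\<forall>U\<in>\<U>. restr M (\<Union>\<U>) U f = s U)))"

text \<open>
  A chart of dimension \<open>CARD('n)|q\<close> on an open set \<open>U\<close>: an isomorphism of superalgebra-valued
  ringed spaces from the restriction of \<open>M\<close> to \<open>U\<close> onto the superdomain over \<open>V\<close>, i.e. a
  homeomorphism \<open>\<phi>\<close> and compatible isomorphisms \<open>\<Phi> W\<close> for all open \<open>W \<subseteq> U\<close>. The existence of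
  charts makes the stalks local, so locality need not be imposed separately.
\<close>

definition super_chart ::
  "('p, 'f) superspace \<Rightarrow> nat \<Rightarrow> 'p set \<Rightarrow> (real ^ 'n::finite) set \<Rightarrow> ('p \<Rightarrow> real ^ 'n)
     \<Rightarrow> ('p set \<Rightarrow> 'f \<Rightarrow> 'n superfun) \<Rightarrow> bool"
  where "super_chart M q U V \<phi> \<Phi> \<longleftrightarrow>
    openin (body M) U \<and> open V \<and>
    homeomorphic_map (subtopology (body M) U) (top_of_set V) \<phi> \<and>
    (\<forall>W. openin (body M) W \<and> W \<subseteq> U \<longrightarrow>
        \<Phi> W \<in> superalg_iso (sections M W) (superdomain q (\<phi> ` W))) \<and>
    (\<forall>W W'. openin (body M) W \<and> openin (body M) W' \<and> W' \<subseteq> W \<and> W \<subseteq> U \<longrightarrow>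
        (\<forall>f\<in>carrier (sections M W). \<Phi> W' (restr M W W' f) = sf_restrict (\<phi> ` W') (\<Phi> W f)))"

text \<open>Supermanifolds of dimension \<open>CARD('n)|q\<close>; note that \<open>CARD('n) \<ge> 1\<close> always holds.\<close>

definition supermanifold :: "'n::finite itself \<Rightarrow> nat \<Rightarrow> ('p, 'f) superspace \<Rightarrow> bool"
  where "supermanifold N q M \<longleftrightarrow>
    Hausdorff_space (body M) \<and> second_countable (body M) \<and> superalgebra_sheaf M \<and>
    (\<forall>m\<in>topspace (body M). \<exists>U (V :: (real ^ 'n) set) \<phi> \<Phi>. m \<in> U \<and> super_chart M q U V \<phi> \<Phi>)"

definition Cinf :: "('p, 'f) superspace \<Rightarrow> 'f superalg"
  where "Cinf M = sections M (topspace (body M))"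

text \<open>
  The value $f(m)$ of a global function: the unique real number \<open>r\<close> such that \<open>f - r\<close> is not
  invertible in any neighbourhood of \<open>m\<close>, i.e. the class of \<open>f\<close> in the residue field at \<open>m\<close>.
\<close>

definition fun_value :: "('p, 'f) superspace \<Rightarrow> 'p \<Rightarrow> 'f \<Rightarrow> real"
  where "fun_value M m f = (THE r. \<forall>U. openin (body M) U \<and> m \<in> U \<longrightarrow>
    restr M (topspace (body M)) U (f \<ominus>\<^bsub>Cinf M\<^esub> (r \<odot>\<^bsub>Cinf M\<^esub> \<one>\<^bsub>Cinf M\<^esub>)) \<notin> Units (sections M U))"


section \<open>Vector fields and tangent vectors\<close>

text \<open>
  Vector fields are the graded derivations of the superalgebra of global functions. They are taken
  to be extensional so that equality of vector fields is equality in HOL.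
\<close>

definition Vect_homog :: "('p, 'f) superspace \<Rightarrow> bit \<Rightarrow> ('f \<Rightarrow> 'f) set"
  where "Vect_homog M i = {X \<in> carrier (Cinf M) \<rightarrow>\<^sub>E carrier (Cinf M).
    (\<forall>f\<in>carrier (Cinf M). \<forall>h\<in>carrier (Cinf M). X (f \<oplus>\<^bsub>Cinf M\<^esub> h) = X f \<oplus>\<^bsub>Cinf M\<^esub> X h) \<and>
    (\<forall>r. \<forall>f\<in>carrier (Cinf M). X (r \<odot>\<^bsub>Cinf M\<^esub> f) = r \<odot>\<^bsub>Cinf M\<^esub> X f) \<and>
    (\<forall>j. \<forall>f\<in>homog (Cinf M) j. X f \<in> homog (Cinf M) (i + j)) \<and>
    (\<forall>j. \<forall>f\<in>homog (Cinf M) j. \<forall>h\<in>carrier (Cinf M).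
        X (f \<otimes>\<^bsub>Cinf M\<^esub> h) =
        (X f \<otimes>\<^bsub>Cinf M\<^esub> h) \<oplus>\<^bsub>Cinf M\<^esub> (koszul i j \<odot>\<^bsub>Cinf M\<^esub> (f \<otimes>\<^bsub>Cinf M\<^esub> X h)))}"

definition vf_zero :: "('p, 'f) superspace \<Rightarrow> 'f \<Rightarrow> 'f"
  where "vf_zero M = (\<lambda>f\<in>carrier (Cinf M). \<zero>\<^bsub>Cinf M\<^esub>)"

definition vf_add :: "('p, 'f) superspace \<Rightarrow> ('f \<Rightarrow> 'f) \<Rightarrow> ('f \<Rightarrow> 'f) \<Rightarrow> 'f \<Rightarrow> 'f"
  where "vf_add M X Y = (\<lambda>f\<in>carrier (Cinf M). X f \<oplus>\<^bsub>Cinf M\<^esub> Y f)"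

definition vf_mult :: "('p, 'f) superspace \<Rightarrow> 'f \<Rightarrow> ('f \<Rightarrow> 'f) \<Rightarrow> 'f \<Rightarrow> 'f"
  where "vf_mult M h X = (\<lambda>f\<in>carrier (Cinf M). h \<otimes>\<^bsub>Cinf M\<^esub> X f)"

definition vf_scale :: "('p, 'f) superspace \<Rightarrow> real \<Rightarrow> ('f \<Rightarrow> 'f) \<Rightarrow> 'f \<Rightarrow> 'f"
  where "vf_scale M r X = (\<lambda>f\<in>carrier (Cinf M). r \<odot>\<^bsub>Cinf M\<^esub> X f)"

definition Vect :: "('p, 'f) superspace \<Rightarrow> ('f \<Rightarrow> 'f) set"
  where "Vect M = {vf_add M X0 X1 | X0 X1. X0 \<in> Vect_homog M 0 \<and> X1 \<in> Vect_homog M 1}"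

text \<open>The graded commutator of homogeneous vector fields of parities \<open>i\<close> and \<open>j\<close>.\<close>

definition vf_bracket ::
  "('p, 'f) superspace \<Rightarrow> bit \<Rightarrow> bit \<Rightarrow> ('f \<Rightarrow> 'f) \<Rightarrow> ('f \<Rightarrow> 'f) \<Rightarrow> 'f \<Rightarrow> 'f"
  where "vf_bracket M i j X Y =
    (\<lambda>f\<in>carrier (Cinf M). X (Y f) \<ominus>\<^bsub>Cinf M\<^esub> (koszul i j \<odot>\<^bsub>Cinf M\<^esub> Y (X f)))"

text \<open>
  Tangent vectors at \<open>m\<close> are point derivations. No sign is needed in the Leibniz rule: the sign
  would multiply \<open>f(m)\<close>, which vanishes for odd \<open>f\<close>.
\<close>

definition tangent_space :: "('p, 'f) superspace \<Rightarrow> 'p \<Rightarrow> ('f \<Rightarrow> real) set"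
  where "tangent_space M m = {v \<in> extensional (carrier (Cinf M)).
    (\<forall>f\<in>carrier (Cinf M). \<forall>h\<in>carrier (Cinf M). v (f \<oplus>\<^bsub>Cinf M\<^esub> h) = v f + v h) \<and>
    (\<forall>r. \<forall>f\<in>carrier (Cinf M). v (r \<odot>\<^bsub>Cinf M\<^esub> f) = r * v f) \<and>
    (\<forall>f\<in>carrier (Cinf M). \<forall>h\<in>carrier (Cinf M).
        v (f \<otimes>\<^bsub>Cinf M\<^esub> h) = v f * fun_value M m h + fun_value M m f * v h)}"

definition tangent_homog :: "('p, 'f) superspace \<Rightarrow> 'p \<Rightarrow> bit \<Rightarrow> ('f \<Rightarrow> real) set"
  where "tangent_homog M m i = {v \<in> tangent_space M m. \<forall>f\<in>homog (Cinf M) (i + 1). v f = 0}"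

definition tv_zero :: "('p, 'f) superspace \<Rightarrow> 'f \<Rightarrow> real"
  where "tv_zero M = (\<lambda>f\<in>carrier (Cinf M). 0)"

definition tv_scale :: "('p, 'f) superspace \<Rightarrow> real \<Rightarrow> ('f \<Rightarrow> real) \<Rightarrow> 'f \<Rightarrow> real"
  where "tv_scale M r v = (\<lambda>f\<in>carrier (Cinf M). r * v f)"

definition vf_value :: "('p, 'f) superspace \<Rightarrow> 'p \<Rightarrow> ('f \<Rightarrow> 'f) \<Rightarrow> 'f \<Rightarrow> real"
  where "vf_value M m X = (\<lambda>f\<in>carrier (Cinf M). fun_value M m (X f))"

definition nonsingular :: "('p, 'f) superspace \<Rightarrow> ('f \<Rightarrow> 'f) \<Rightarrow> bool"
  where "nonsingular M X \<longleftrightarrow> (\<forall>m\<in>topspace (body M). vf_value M m X \<noteq> tv_zero M)"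

text \<open>
  In the chart \<open>\<Phi>\<close> on \<open>U\<close> the vector field \<open>X\<close> is the operator \<open>D\<close> on superfunctions. Only
  restrictions of global functions occur, but these determine the derivation induced by \<open>X\<close> on
  the sections over \<open>U\<close>.
\<close>

definition vf_in_chart ::
  "('p, 'f) superspace \<Rightarrow> 'p set \<Rightarrow> ('p set \<Rightarrow> 'f \<Rightarrow> 'n superfun) \<Rightarrow> ('f \<Rightarrow> 'f)
     \<Rightarrow> ('n superfun \<Rightarrow> 'n superfun) \<Rightarrow> bool"
  where "vf_in_chart M U \<Phi> X D \<longleftrightarrow> (\<forall>f\<in>carrier (Cinf M).
    \<Phi> U (restr M (topspace (body M)) U (X f)) = D (\<Phi> U (restr M (topspace (body M)) U f)))"


section \<open>Metrics, connections and super-null Riemannian manifolds\<close>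

text \<open>
  A (possibly degenerate) even metric, given by its pairing on vector fields. Additivity in the
  second argument has to be listed: graded symmetry only yields it for homogeneous arguments.
\<close>

definition metric :: "('p, 'f) superspace \<Rightarrow> (('f \<Rightarrow> 'f) \<Rightarrow> ('f \<Rightarrow> 'f) \<Rightarrow> 'f) \<Rightarrow> bool"
  where "metric M g \<longleftrightarrow>
    (\<forall>X\<in>Vect M. \<forall>Y\<in>Vect M. g X Y \<in> carrier (Cinf M)) \<and>
    (\<forall>i j. \<forall>X\<in>Vect_homog M i. \<forall>Y\<in>Vect_homog M j.
        g X Y \<in> homog (Cinf M) (i + j) \<and> g X Y = koszul i j \<odot>\<^bsub>Cinf M\<^esub> g Y X) \<and>
    (\<forall>f\<in>carrier (Cinf M). \<forall>X\<in>Vect M. \<forall>Y\<in>Vect M. \<forall>Z\<in>Vect M.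
        g (vf_add M (vf_mult M f X) Y) Z = (f \<otimes>\<^bsub>Cinf M\<^esub> g X Z) \<oplus>\<^bsub>Cinf M\<^esub> g Y Z) \<and>
    (\<forall>X\<in>Vect M. \<forall>Y\<in>Vect M. \<forall>Z\<in>Vect M.
        g X (vf_add M Y Z) = g X Y \<oplus>\<^bsub>Cinf M\<^esub> g X Z)"

definition metric_ker ::
  "('p, 'f) superspace \<Rightarrow> (('f \<Rightarrow> 'f) \<Rightarrow> ('f \<Rightarrow> 'f) \<Rightarrow> 'f) \<Rightarrow> ('f \<Rightarrow> 'f) set"
  where "metric_ker M g = {X \<in> Vect M. \<forall>Y\<in>Vect M. g X Y = \<zero>\<^bsub>Cinf M\<^esub>}"

definition degenerate :: "('p, 'f) superspace \<Rightarrow> (('f \<Rightarrow> 'f) \<Rightarrow> ('f \<Rightarrow> 'f) \<Rightarrow> 'f) \<Rightarrow> bool"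
  where "degenerate M g \<longleftrightarrow> metric_ker M g \<noteq> {vf_zero M}"

text \<open>
  The bilinear form induced on the tangent space at \<open>m\<close>, determined by
  $g_m(X_m, Y_m) = \langle X|Y\rangle(m)$.
\<close>

definition metric_at ::
  "('p, 'f) superspace \<Rightarrow> (('f \<Rightarrow> 'f) \<Rightarrow> ('f \<Rightarrow> 'f) \<Rightarrow> 'f) \<Rightarrow> 'p \<Rightarrow> ('f \<Rightarrow> real) \<Rightarrow> ('f \<Rightarrow> real) \<Rightarrow> real"
  where "metric_at M g m u v = (THE r. \<exists>X\<in>Vect M. \<exists>Y\<in>Vect M.
    vf_value M m X = u \<and> vf_value M m Y = v \<and> r = fun_value M m (g X Y))"

definition metric_ker_at ::
  "('p, 'f) superspace \<Rightarrow> (('f \<Rightarrow> 'f) \<Rightarrow> ('f \<Rightarrow> 'f) \<Rightarrow> 'f) \<Rightarrow> 'p \<Rightarrow> ('f \<Rightarrow> real) set"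
  where "metric_ker_at M g m =
    {u \<in> tangent_space M m. \<forall>v\<in>tangent_space M m. metric_at M g m u v = 0}"

definition affine_connection ::
  "('p, 'f) superspace \<Rightarrow> (('f \<Rightarrow> 'f) \<Rightarrow> ('f \<Rightarrow> 'f) \<Rightarrow> ('f \<Rightarrow> 'f)) \<Rightarrow> bool"
  where "affine_connection M conn \<longleftrightarrow>
    (\<forall>X\<in>Vect M. \<forall>Y\<in>Vect M. conn X Y \<in> Vect M) \<and>
    (\<forall>i j. \<forall>X\<in>Vect_homog M i. \<forall>Y\<in>Vect_homog M j. conn X Y \<in> Vect_homog M (i + j)) \<and>
    (\<forall>X\<in>Vect M. \<forall>Y\<in>Vect M. \<forall>Z\<in>Vect M.
        conn (vf_add M X Y) Z = vf_add M (conn X Z) (conn Y Z) \<and>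
        conn X (vf_add M Y Z) = vf_add M (conn X Y) (conn X Z)) \<and>
    (\<forall>f\<in>carrier (Cinf M). \<forall>X\<in>Vect M. \<forall>Y\<in>Vect M.
        conn (vf_mult M f X) Y = vf_mult M f (conn X Y)) \<and>
    (\<forall>i j. \<forall>X\<in>Vect_homog M i. \<forall>f\<in>homog (Cinf M) j. \<forall>Y\<in>Vect M.
        conn X (vf_mult M f Y) =
        vf_add M (vf_mult M (X f) Y) (vf_scale M (koszul i j) (vf_mult M f (conn X Y))))"

text \<open>
  The last two conditions: the kernel of $g_m$ has dimension $0|1$, i.e. is spanned by a nonzero odd
  tangent vector; and around every point there is a chart, with some even coordinate $t = x^a$ and
  odd coordinate $\tau = \theta_0$, in which $Q = \partial_\tau + \tau\partial_t$ and
  $P = \partial_t$.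
\<close>

definition super_null_riemannian ::
  "'n::finite itself \<Rightarrow> ('p, 'f) superspace \<Rightarrow> (('f \<Rightarrow> 'f) \<Rightarrow> ('f \<Rightarrow> 'f) \<Rightarrow> 'f)
     \<Rightarrow> ('f \<Rightarrow> 'f) \<Rightarrow> ('f \<Rightarrow> 'f) \<Rightarrow> bool"
  where "super_null_riemannian N M g Q P \<longleftrightarrow>
    supermanifold N 1 M \<and> metric M g \<and> degenerate M g \<and>
    Q \<in> Vect_homog M 1 \<and> nonsingular M Q \<and>
    P \<in> Vect_homog M 0 \<and> vf_bracket M 1 1 Q Q = vf_scale M 2 P \<and>
    metric_ker M g = {vf_mult M f Q | f. f \<in> carrier (Cinf M)} \<and>
    (\<forall>m\<in>topspace (body M). \<exists>w\<in>tangent_homog M m 1.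
        w \<noteq> tv_zero M \<and> metric_ker_at M g m = {tv_scale M r w | r. True}) \<and>
    (\<forall>m\<in>topspace (body M). \<exists>U (V :: (real ^ 'n) set) \<phi> \<Phi> a.
        m \<in> U \<and> super_chart M 1 U V \<phi> \<Phi> \<and>
        vf_in_chart M U \<Phi> Q (\<lambda>h x I. d_odd 0 h x I + theta_mult 0 (d_even V a h) x I) \<and>
        vf_in_chart M U \<Phi> P (d_even V a))"

end

theory Submission
  imports Defs
begin

text \<open>
  Since $Q$ is odd and $M$ has a single odd direction, $Q$ restricts to an isomorphism from odd to even
  functions; hence there is a global odd function $\tau$ with $Q\tau = 1$, and every function is
  uniquely $f + h\tau$ with $f$, $h$ in the algebra $F$ of even functions, a smooth function algebra on
  $|M|$. A vector field is then a pair of derivations of $F$ (its even and odd part on $F$) together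
  with its value on $\tau$. The closed odd form $d\tau$ splits off the kernel: modulo
  $\mathrm{Span}\{Q\}$ the metric is given by a nondegenerate symmetric bilinear form $\gamma$ on the
  derivations of $F$, a pseudo-Riemannian metric on $|M|$. Its Levi-Civita connection, extended by
  $\nabla_X \tau v = X(\tau) v \pm \tau \nabla_X v$ and $\nabla_X (hQ) = X(h) Q$, is the required
  connection. As $\gamma$ is nondegenerate, Koszul's formula determines the Levi-Civita connection
  pointwise, so that bump functions suffice and no partition of unity is needed.
\<close>

section \<open>Smooth functions on open subsets of Euclidean space\<close>

definition partial :: "'n::finite \<Rightarrow> (real ^ 'n \<Rightarrow> real) \<Rightarrow> real ^ 'n \<Rightarrow> real"
  where "partial a f x = frechet_derivative f (at x) (axis a 1)"

lemma Ck_on_Suc: "Ck_on (Suc k) V f \<longleftrightarrow> f differentiable_on V \<and> (\<forall>a. Ck_on k V (partial a f))"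
  by (simp add: partial_def[abs_def])

declare Ck_on.simps(2) [simp del]

lemma partial_eqI:
  assumes "(f has_derivative f') (at x)"
  shows "partial a f x = f' (axis a 1)"
  using frechet_derivative_at[OF assms] by (simp add: partial_def)

lemma partial_cong:
  assumes "open V" "x \<in> V" "\<And>y. y \<in> V \<Longrightarrow> f y = g y"
  shows "partial a f x = partial a g x"
proof (cases "f differentiable at x")
  case True
  then show ?thesis
    unfolding partial_def
    using frechet_derivative_transform_within_open[of f x V g] assms by auto
next
  case False
  \<comment> \<open>No derivative need exist here. Both functions have the same derivatives at x, so
    the choice operator inside \<open>frechet_derivative\<close> picks the same value for
    both.\<close>
  have "(f has_derivative D) (at x) \<longleftrightarrow> (g has_derivative D) (at x)" for D
    using has_derivative_transform_within_open[OF _ assms(1,2), of f D UNIV g]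
      has_derivative_transform_within_open[OF _ assms(1,2), of g D UNIV f] assms(3) by auto
  then show ?thesis by (simp add: partial_def frechet_derivative_def)
qed

lemma has_derivative_partial:
  fixes f :: "real ^ 'n::finite \<Rightarrow> real"
  assumes "f differentiable at x"
  shows "(f has_derivative (\<lambda>y. \<Sum>a\<in>UNIV. y $ a * partial a f x)) (at x)"
proof -
  let ?D = "frechet_derivative f (at x)"
  have D: "(f has_derivative ?D) (at x)" using assms frechet_derivative_works by blast
  have "?D y = (\<Sum>a\<in>UNIV. y $ a * partial a f x)" for y
  proof -
    have "linear ?D" using D has_derivative_linear by blast
    then have "?D (\<Sum>a\<in>UNIV. y $ a *s axis a 1) = (\<Sum>a\<in>UNIV. y $ a * ?D (axis a 1))"
      by (simp add: linear_sum scalar_mult_eq_scaleR linear_scale)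
    then show ?thesis by (simp add: basis_expansion partial_def)
  qed
  then show ?thesis using D by presburger
qed

lemma Ck_on_cong:
  assumes "open V" "\<And>x. x \<in> V \<Longrightarrow> f x = g x"
  shows "Ck_on k V f \<longleftrightarrow> Ck_on k V g"
  using assms(2)
proof (induction k arbitrary: f g)
  case 0
  then show ?case by (simp cong: continuous_on_cong)
next
  case (Suc k)
  have "partial a f x = partial a g x" if "x \<in> V" for a x
    using partial_cong[OF assms(1) that] Suc.prems by blast
  then have "Ck_on k V (partial a f) \<longleftrightarrow> Ck_on k V (partial a g)" for a
    by (rule Suc.IH)
  moreover have "f differentiable_on V \<longleftrightarrow> g differentiable_on V"
    using Suc.prems differentiable_transform_within[of _ _ V]
    unfolding differentiable_on_def by (metis zero_less_one)
  ultimately show ?case by (simp add: Ck_on_Suc)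
qed

lemma Ck_on_subset: "Ck_on k V f \<Longrightarrow> W \<subseteq> V \<Longrightarrow> Ck_on k W f"
  by (induction k arbitrary: f)
    (auto simp: Ck_on_Suc intro: continuous_on_subset differentiable_on_subset)

lemma Ck_on_local:
  assumes "open V" "\<And>x. x \<in> V \<Longrightarrow> \<exists>W. open W \<and> x \<in> W \<and> Ck_on k W f"
  shows "Ck_on k V f"
  using assms(2)
proof (induction k arbitrary: f)
  case 0
  then show ?case
    by (metis Ck_on.simps(1) assms(1) continuous_on_eq_continuous_at continuous_at_imp_continuous_on)
next
  case (Suc k)
  have "f differentiable at x within V" if "x \<in> V" for x
    using Suc.prems[OF that] unfolding Ck_on_Suc
    by (metis differentiable_on_eq_differentiable_at differentiable_at_withinI)
  moreover have "Ck_on k V (partial a f)" for a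
    by (rule Suc.IH) (use Suc.prems in \<open>auto simp: Ck_on_Suc\<close>)
  ultimately show ?case by (auto simp: Ck_on_Suc differentiable_on_def)
qed

lemma Ck_on_SucD: "Ck_on (Suc k) V f \<Longrightarrow> Ck_on k V f"
  by (induction k arbitrary: f)
    (auto simp: Ck_on_Suc differentiable_imp_continuous_on)

text \<open>Any explicit derivative f' may be supplied, so \<open>frechet_derivative\<close> is
  never computed: derivatives are unique, hence the coefficients of f' are the partial derivatives
  on V.\<close>

lemma Ck_on_SucI:
  assumes "open V" "\<And>x. x \<in> V \<Longrightarrow> (f has_derivative f' x) (at x)"
    and "\<And>a. Ck_on k V (\<lambda>x. f' x (axis a 1))"
  shows "Ck_on (Suc k) V f"
proof -
  have "f differentiable_on V"
    using assms(2) unfolding differentiable_on_def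
    by (meson differentiable_at_withinI differentiableI)
  moreover have "Ck_on k V (partial a f)" for a
    by (subst Ck_on_cong[OF assms(1), where g = "\<lambda>x. f' x (axis a 1)"])
      (auto simp: partial_eqI[OF assms(2)] assms(3))
  ultimately show ?thesis by (simp add: Ck_on_Suc)
qed

lemma Ck_on_has_derivative:
  assumes "open V" "Ck_on (Suc k) V f" "x \<in> V"
  shows "(f has_derivative (\<lambda>y. \<Sum>a\<in>UNIV. y $ a * partial a f x)) (at x)"
  using assms by (intro has_derivative_partial) (auto simp: Ck_on_Suc differentiable_on_eq_differentiable_at)

lemma Ck_on_const: "open V \<Longrightarrow> Ck_on k V (\<lambda>x. c)"
proof (induction k arbitrary: c)
  case (Suc k)
  then show ?case by (intro Ck_on_SucI[OF _ has_derivative_const]) auto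
qed simp

lemma Ck_on_coord: 
  assumes "open V"
  shows "Ck_on k V (\<lambda>x. x $ a)"
proof (cases k)
  case (Suc l)
  show ?thesis unfolding Suc
    by (rule Ck_on_SucI[OF assms bounded_linear.has_derivative[OF bounded_linear_vec_nth has_derivative_ident]]) (simp add: Ck_on_const assms)
qed (simp add: continuous_on_component)

text \<open>Evaluates a derivative in the coordinate form of \<open>has_derivative_partial\<close>
  on a basis vector.\<close>

lemma sum_axis_1: "(\<Sum>c\<in>UNIV. axis a (1::real) $ c * h c) = h (a :: 'n::finite)"
proof -
  have "(\<Sum>c\<in>UNIV. axis a (1::real) $ c * h c) = (\<Sum>c\<in>UNIV. if c = a then h c else 0)"
    by (rule sum.cong) (auto simp: axis_def)
  then show ?thesis by simp
qed

lemma Ck_on_add: "open V \<Longrightarrow> Ck_on k V f \<Longrightarrow> Ck_on k V g \<Longrightarrow> Ck_on k V (\<lambda>x. f x + g x)"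
proof (induction k arbitrary: f g)
  case 0
  then show ?case by (simp add: continuous_on_add)
next
  case (Suc k)
  note D = Suc.prems(2,3)[THEN Ck_on_has_derivative[OF Suc.prems(1)]]
  show ?case
  proof (rule Ck_on_SucI[OF Suc.prems(1) has_derivative_add[OF D]])
    fix a
    have "Ck_on k V (\<lambda>x. partial a f x + partial a g x)"
      using Suc by (simp add: Ck_on_Suc)
    then show "Ck_on k V (\<lambda>x. (\<Sum>c\<in>UNIV. axis a 1 $ c * partial c f x) + (\<Sum>c\<in>UNIV. axis a 1 $ c * partial c g x))"
      by (simp add: sum_axis_1)
  qed
qed

lemma Ck_on_mult: "open V \<Longrightarrow> Ck_on k V f \<Longrightarrow> Ck_on k V g \<Longrightarrow> Ck_on k V (\<lambda>x. f x * g x)"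
proof (induction k arbitrary: f g)
  case 0
  then show ?case by (simp add: continuous_on_mult)
next
  case (Suc k)
  note D = Suc.prems(2,3)[THEN Ck_on_has_derivative[OF Suc.prems(1)]]
  show ?case
  proof (rule Ck_on_SucI[OF Suc.prems(1) has_derivative_mult[OF D]])
    fix a
    have "Ck_on k V (\<lambda>x. f x * partial a g x + partial a f x * g x)"
      using Suc.prems Suc.prems(2,3)[THEN Ck_on_SucD]
      by (intro Ck_on_add Suc.IH) (auto simp: Ck_on_Suc)
    then show "Ck_on k V (\<lambda>x. f x * (\<Sum>c\<in>UNIV. axis a 1 $ c * partial c g x) + (\<Sum>c\<in>UNIV. axis a 1 $ c * partial c f x) * g x)"
      by (simp add: sum_axis_1)
  qed
qed

text \<open>The derivative of 1/f is a product of partial derivatives of f with 1/f itself, so order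
  k for 1/f yields order k + 1.\<close>

lemma Ck_on_inverse: "open V \<Longrightarrow> Ck_on k V f \<Longrightarrow> (\<And>x. x \<in> V \<Longrightarrow> f x \<noteq> 0) \<Longrightarrow> Ck_on k V (\<lambda>x. inverse (f x))"
proof (induction k)
  case 0
  then show ?case by (simp add: continuous_on_inverse)
next
  case (Suc k)
  note D = Ck_on_has_derivative[OF Suc.prems(1,2)]
  show ?case
  proof (rule Ck_on_SucI[OF Suc.prems(1) Deriv.has_derivative_inverse[OF Suc.prems(3) D]])
    fix a
    have "Ck_on k V (\<lambda>x. (- 1) * (inverse (f x) * partial a f x * inverse (f x)))"
      using Suc.prems Suc.prems(2)[THEN Ck_on_SucD]
      by (intro Ck_on_mult Ck_on_const Suc.IH) (auto simp: Ck_on_Suc)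
    then show "Ck_on k V (\<lambda>x. - (inverse (f x) * (\<Sum>c\<in>UNIV. axis a 1 $ c * partial c f x) * inverse (f x)))"
      by (simp add: sum_axis_1)
  qed
qed

lemma smooth_on_cong: "open V \<Longrightarrow> (\<And>x. x \<in> V \<Longrightarrow> f x = g x) \<Longrightarrow> smooth_on V f \<longleftrightarrow> smooth_on V g"
  using Ck_on_cong unfolding smooth_on_def by blast

lemma smooth_on_subset: "smooth_on V f \<Longrightarrow> W \<subseteq> V \<Longrightarrow> smooth_on W f"
  using Ck_on_subset unfolding smooth_on_def by blast

lemma smooth_on_local:
  "open V \<Longrightarrow> (\<And>x. x \<in> V \<Longrightarrow> \<exists>W. open W \<and> x \<in> W \<and> smooth_on W f) \<Longrightarrow> smooth_on V f"
  using Ck_on_local unfolding smooth_on_def by meson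

lemma smooth_on_partial: "smooth_on V f \<Longrightarrow> smooth_on V (partial a f)"
  unfolding smooth_on_def using Ck_on_Suc by blast

lemma smooth_on_differentiable: "open V \<Longrightarrow> smooth_on V f \<Longrightarrow> x \<in> V \<Longrightarrow> f differentiable at x"
  unfolding smooth_on_def using Ck_on_Suc differentiable_on_eq_differentiable_at by blast

lemma smooth_on_continuous: "smooth_on V f \<Longrightarrow> continuous_on V f"
  unfolding smooth_on_def using Ck_on.simps(1) by blast

lemma smooth_on_const: "open V \<Longrightarrow> smooth_on V (\<lambda>x. c)"
  by (simp add: smooth_on_def Ck_on_const)

lemma smooth_on_coord: "open V \<Longrightarrow> smooth_on V (\<lambda>x. x $ a)"
  by (simp add: smooth_on_def Ck_on_coord)

lemma smooth_on_add: "open V \<Longrightarrow> smooth_on V f \<Longrightarrow> smooth_on V g \<Longrightarrow> smooth_on V (\<lambda>x. f x + g x)"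
  by (simp add: smooth_on_def Ck_on_add)

lemma smooth_on_mult: "open V \<Longrightarrow> smooth_on V f \<Longrightarrow> smooth_on V g \<Longrightarrow> smooth_on V (\<lambda>x. f x * g x)"
  by (simp add: smooth_on_def Ck_on_mult)

lemma smooth_on_inverse:
  "open V \<Longrightarrow> smooth_on V f \<Longrightarrow> (\<And>x. x \<in> V \<Longrightarrow> f x \<noteq> 0) \<Longrightarrow> smooth_on V (\<lambda>x. inverse (f x))"
  by (simp add: smooth_on_def Ck_on_inverse)

lemma smooth_on_prod:
  assumes "open V" "finite A" "\<And>a. a \<in> A \<Longrightarrow> smooth_on V (f a)"
  shows "smooth_on V (\<lambda>x. \<Prod>a\<in>A. f a x)"
  using assms(2,3) by (induction A) (auto intro!: smooth_on_const smooth_on_mult assms(1))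

lemma partial_add:
  assumes "f differentiable at x" "g differentiable at x"
  shows "partial a (\<lambda>x. f x + g x) x = partial a f x + partial a g x"
  using partial_eqI[OF has_derivative_add[OF assms[THEN has_derivative_partial]]]
  by (simp add: sum_axis_1)

lemma partial_mult:
  assumes "f differentiable at x" "g differentiable at x"
  shows "partial a (\<lambda>x. f x * g x) x = partial a f x * g x + f x * partial a g x"
  using partial_eqI[OF has_derivative_mult[OF assms[THEN has_derivative_partial]]]
  by (simp add: sum_axis_1)

lemma partial_const: "partial a (\<lambda>x. c) x = 0"
  by (simp add: partial_def[abs_def])

lemma partial_coord: "partial a (\<lambda>x. x $ b) x = (if a = b then 1 else 0)"
  using partial_eqI[OF bounded_linear.has_derivative[OF bounded_linear_vec_nth has_derivative_ident], where a = a]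
  by (auto simp: axis_def)

section \<open>Smooth cutoff functions built from exp(-1/t)\<close>

text \<open>The span of these functions is closed under differentiation, which makes $e^{-1/t}$ smooth at $0$.\<close>

definition flat_exp :: "nat \<Rightarrow> real \<Rightarrow> real"
  where "flat_exp j t = (if t > 0 then inverse t ^ j * exp (- inverse t) else 0)"

text \<open>With s = 1/t this is the decay of s^j / exp s at infinity.\<close>

lemma flat_exp_tendsto_0: "(flat_exp j \<longlongrightarrow> 0) (at_right 0)"
proof -
  have "((\<lambda>s::real. s ^ j / exp s) \<longlongrightarrow> 0) at_top" by (rule tendsto_power_div_exp_0)
  then have "((\<lambda>t::real. inverse t ^ j / exp (inverse t)) \<longlongrightarrow> 0) (at_right 0)"
    using filterlim_inverse_at_top_right by (rule filterlim_compose)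
  then show ?thesis
    by (rule Lim_transform_eventually)
      (rule eventually_mono[OF eventually_at_right_less], simp add: flat_exp_def exp_minus divide_inverse)
qed

lemma flat_exp_has_derivative:
  "(flat_exp j has_real_derivative (flat_exp (j + 2) t - real j * flat_exp (j + 1) t)) (at t)"
proof -
  consider "t > 0" | "t < 0" | "t = 0" by linarith
  then show ?thesis
  proof cases
    case 1
    have "((\<lambda>t. inverse t ^ j * exp (- inverse t)) has_real_derivative
        (flat_exp (j + 2) t - real j * flat_exp (j + 1) t)) (at t)"
      using 1
      by (auto intro!: derivative_eq_intros simp: flat_exp_def algebra_simps power2_eq_square)
        (cases j; simp)
    then show ?thesis
      by (rule has_field_derivative_transform_within_open[where S = "{0<..}"])
        (use 1 in \<open>auto simp: flat_exp_def\<close>)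
  next
    case 2
    have "((\<lambda>t. 0) has_real_derivative (flat_exp (j + 2) t - real j * flat_exp (j + 1) t)) (at t)"
      using 2 by (simp add: flat_exp_def)
    then show ?thesis
      by (rule has_field_derivative_transform_within_open[where S = "{..<0}"])
        (use 2 in \<open>auto simp: flat_exp_def\<close>)
  next
    case 3
    \<comment> \<open>The difference quotient at 0 is \<open>flat_exp (Suc j)\<close> on the right
      and 0 on the left.\<close>
    have "((\<lambda>y. (flat_exp j y - flat_exp j 0) / (y - 0)) \<longlongrightarrow> 0) (at 0)"
    proof (rule filterlim_split_at)
      show "((\<lambda>y. (flat_exp j y - flat_exp j 0) / (y - 0)) \<longlongrightarrow> 0) (at_right 0)"
        by (rule Lim_transform_eventually[OF flat_exp_tendsto_0[of "Suc j"]])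
          (rule eventually_mono[OF eventually_at_right_less], simp add: flat_exp_def divide_inverse)
      show "((\<lambda>y. (flat_exp j y - flat_exp j 0) / (y - 0)) \<longlongrightarrow> 0) (at_left 0)"
        by (rule tendsto_eventually) (auto simp: flat_exp_def eventually_at_filter)
    qed
    then show ?thesis
      unfolding 3 by (simp add: has_field_derivative_iff flat_exp_def)
  qed
qed

text \<open>Affine functions of a single coordinate are the only arguments that the cutoffs below
  need, so no chain rule for general C^k maps is required. The index j is arbitrary in the induction
  because differentiation raises it.\<close>

lemma Ck_on_flat_exp:
  "Ck_on k UNIV (\<lambda>x :: real ^ 'n::finite. flat_exp j (c + d * x $ a))"
proof (induction k arbitrary: j)
  case 0
  have "continuous_on UNIV (flat_exp j)"
    by (meson DERIV_isCont continuous_at_imp_continuous_on flat_exp_has_derivative)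
  then have "continuous_on UNIV (flat_exp j \<circ> (\<lambda>x :: real ^ 'n. c + d * x $ a))"
    by (intro continuous_on_compose continuous_intros) (auto intro: continuous_on_subset)
  then show ?case by (simp add: o_def)
next
  case (Suc k)
  show ?case
  proof (rule Ck_on_SucI[OF open_UNIV])
    fix x :: "real ^ 'n"
    show "((\<lambda>x. flat_exp j (c + d * x $ a)) has_derivative
        (\<lambda>y. d * y $ a * (flat_exp (j + 2) (c + d * x $ a) - real j * flat_exp (j + 1) (c + d * x $ a)))) (at x)"
      by (rule has_derivative_compose[OF _ flat_exp_has_derivative[unfolded has_field_derivative_def], THEN has_derivative_eq_rhs])
        (auto intro!: derivative_eq_intros bounded_linear.has_derivative[OF bounded_linear_vec_nth] simp: algebra_simps)
  next
    fix b
    have "Ck_on k UNIV (\<lambda>x :: real ^ 'n. d * axis b 1 $ a * (flat_exp (j + 2) (c + d * x $ a) + (- real j) * flat_exp (j + 1) (c + d * x $ a)))"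
      by (intro Ck_on_mult Ck_on_add Ck_on_const Suc.IH open_UNIV)
    then show "Ck_on k UNIV (\<lambda>x :: real ^ 'n. d * axis b 1 $ a * (flat_exp (j + 2) (c + d * x $ a) - real j * flat_exp (j + 1) (c + d * x $ a)))"
      by simp
  qed
qed

definition smooth_step :: "real \<Rightarrow> real"
  where "smooth_step t = flat_exp 0 t / (flat_exp 0 t + flat_exp 0 (1 - t))"

text \<open>One of t and 1 - t is positive, so the denominator of \<open>smooth_step\<close> never
  vanishes.\<close>

lemma flat_exp_sum_pos: "flat_exp 0 t + flat_exp 0 (1 - t) > 0"
  by (auto simp: flat_exp_def add_pos_pos)

lemma smooth_step_0: "t \<le> 0 \<Longrightarrow> smooth_step t = 0"
  and smooth_step_1: "t \<ge> 1 \<Longrightarrow> smooth_step t = 1"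
  by (auto simp: smooth_step_def flat_exp_def)

lemma smooth_on_smooth_step:
  "smooth_on UNIV (\<lambda>x :: real ^ 'n::finite. smooth_step (c + d * x $ a))"
proof -
  have E: "smooth_on UNIV (\<lambda>x :: real ^ 'n. flat_exp 0 (c + d * x $ a))" for c d
    by (simp add: smooth_on_def Ck_on_flat_exp)
  have "smooth_on UNIV (\<lambda>x :: real ^ 'n. flat_exp 0 (c + d * x $ a) *
      inverse (flat_exp 0 (c + d * x $ a) + flat_exp 0 ((1 - c) + (- d) * x $ a)))"
  proof (intro smooth_on_mult smooth_on_inverse smooth_on_add E open_UNIV)
    fix x :: "real ^ 'n"
    have "1 - (c + d * x $ a) = (1 - c) + (- d) * x $ a" by simp
    then show "flat_exp 0 (c + d * x $ a) + flat_exp 0 ((1 - c) + (- d) * x $ a) \<noteq> 0"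
      using flat_exp_sum_pos[of "c + d * x $ a"] by (metis less_irrefl)
  qed
  then show ?thesis by (simp add: smooth_step_def divide_inverse algebra_simps)
qed

text \<open>For r > 0 a cutoff on cubes rather than balls: it is 1 where all coordinates are within
  r of p and 0 as soon as one is off by 2r or more. As a product of steps in single coordinates it
  is smooth without any discussion of the norm.\<close>

definition plateau :: "real ^ 'n::finite \<Rightarrow> real \<Rightarrow> real ^ 'n \<Rightarrow> real"
  where "plateau p r x = (\<Prod>a\<in>UNIV. smooth_step (2 - (x $ a - p $ a) / r) * smooth_step (2 + (x $ a - p $ a) / r))"

lemma smooth_on_plateau: "smooth_on UNIV (plateau p r)"
proof -
  have "smooth_on UNIV (\<lambda>x. \<Prod>a\<in>UNIV. smooth_step ((2 + p $ a / r) + (- inverse r) * x $ a) *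
      smooth_step ((2 - p $ a / r) + inverse r * x $ a))"
    by (intro smooth_on_prod smooth_on_mult smooth_on_smooth_step) auto
  moreover have "plateau p r = (\<lambda>x. \<Prod>a\<in>UNIV. smooth_step ((2 + p $ a / r) + (- inverse r) * x $ a) *
      smooth_step ((2 - p $ a / r) + inverse r * x $ a))"
    unfolding plateau_def by (simp add: divide_inverse algebra_simps)
  ultimately show ?thesis by simp
qed

lemma plateau_eq_1:
  assumes "r > 0" "\<And>a. \<bar>x $ a - p $ a\<bar> \<le> r"
  shows "plateau p r x = 1"
proof -
  have "(x $ a - p $ a) / r \<le> 1 \<and> (x $ a - p $ a) / r \<ge> - 1" for a
    using assms(2)[of a] assms(1) by (auto simp: divide_simps abs_le_iff)
  then have "smooth_step (2 - (x $ a - p $ a) / r) = 1 \<and> smooth_step (2 + (x $ a - p $ a) / r) = 1" for a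
    by (intro conjI smooth_step_1) (smt (verit))+
  then show ?thesis by (simp add: plateau_def)
qed

lemma plateau_nonzeroD:
  assumes "r > 0" "plateau p r x \<noteq> 0"
  shows "\<bar>x $ a - p $ a\<bar> < 2 * r"
proof -
  have "smooth_step (2 - (x $ a - p $ a) / r) \<noteq> 0" "smooth_step (2 + (x $ a - p $ a) / r) \<noteq> 0"
    using assms(2) by (auto simp: plateau_def prod_zero_iff)
  then have "\<not> 2 - (x $ a - p $ a) / r \<le> 0" "\<not> 2 + (x $ a - p $ a) / r \<le> 0"
    using smooth_step_0 by blast+
  then show ?thesis using assms(1) by (auto simp: divide_simps abs_less_iff algebra_simps)
qed

section \<open>Integration along rays and Hadamard's lemma\<close>

text \<open>The weight t^j keeps the family closed under differentiation in x: by the chain rule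
  each partial derivative brings out one more factor t.\<close>

definition ray_integral :: "real ^ 'n::finite \<Rightarrow> nat \<Rightarrow> (real ^ 'n \<Rightarrow> real) \<Rightarrow> real ^ 'n \<Rightarrow> real"
  where "ray_integral p j f x = integral (cbox 0 1) (\<lambda>t. t ^ j * f (p + t *\<^sub>R (x - p)))"

lemma ray_in_ball:
  fixes p :: "'a::real_normed_vector"
  assumes "x \<in> ball p r" "t \<in> cbox 0 (1::real)"
  shows "p + t *\<^sub>R (x - p) \<in> ball p r"
proof -
  have "norm (t *\<^sub>R (x - p)) \<le> 1 * norm (x - p)"
    unfolding norm_scaleR using assms(2) by (intro mult_right_mono) auto
  then show ?thesis using assms(1) by (simp add: dist_norm norm_minus_commute)
qed

lemma continuous_on_ray:
  fixes p :: "'a::real_normed_vector"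
  assumes "continuous_on (ball p r) f"
  shows "continuous_on (ball p r \<times> cbox 0 1) (\<lambda>(x, t). t ^ j * f (p + t *\<^sub>R (x - p)) :: real)"
proof -
  have "continuous_on (ball p r \<times> cbox 0 1) (f \<circ> (\<lambda>z. p + snd z *\<^sub>R (fst z - p)))"
    by (intro continuous_on_compose continuous_intros continuous_on_subset[OF assms])
      (auto intro!: ray_in_ball[simplified])
  then show ?thesis
    unfolding case_prod_beta o_def by (intro continuous_intros)
qed

lemma ray_integrable:
  fixes p :: "'a::real_normed_vector"
  assumes "continuous_on (ball p r) f" "x \<in> ball p r"
  shows "(\<lambda>t. t ^ j * f (p + t *\<^sub>R (x - p))) integrable_on cbox 0 (1::real)"
proof (rule integrable_continuous)
  have "continuous_on (cbox 0 1) ((\<lambda>(x, t). t ^ j * f (p + t *\<^sub>R (x - p))) \<circ> Pair x)"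
    by (intro continuous_on_compose continuous_intros continuous_on_subset[OF continuous_on_ray[OF assms(1)]])
      (use assms(2) in auto)
  then show "continuous_on (cbox 0 1) (\<lambda>t. t ^ j * f (p + t *\<^sub>R (x - p)))"
    by (simp add: o_def)
qed

lemma ray_integral_has_derivative:
  fixes p :: "real ^ 'n::finite"
  assumes "smooth_on (ball p r) f" "x \<in> ball p r"
  shows "(ray_integral p j f has_derivative
    (\<lambda>y. \<Sum>a\<in>UNIV. y $ a * ray_integral p (Suc j) (partial a f) x)) (at x)"
proof -
  \<comment> \<open>The derivative of the integrand in x as a bounded linear map, the form in which
    differentiation under the integral sign expects it; \<open>Suc j\<close> contains the factor t
    of the chain rule.\<close>
  define L :: "real ^ 'n \<Rightarrow> real \<Rightarrow> (real ^ 'n) \<Rightarrow>\<^sub>L real" where "L x t = (\<Sum>a\<in>UNIV. (t ^ Suc j * partial a f (p + t *\<^sub>R (x - p))) *\<^sub>R blinfun_inner_left (axis a 1))" for x t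
  have L: "blinfun_apply (L x t) y = (\<Sum>a\<in>UNIV. y $ a * (t ^ Suc j * partial a f (p + t *\<^sub>R (x - p))))" for x t y
    by (simp add: L_def blinfun.sum_left blinfun.scaleR_left inner_axis mult.commute)
  note S = smooth_on_partial[OF assms(1)]
  have C: "continuous_on (ball p r \<times> cbox 0 1) (\<lambda>(x, t). L x t)"
    unfolding L_def case_prod_beta
    using continuous_on_ray[OF smooth_on_continuous[OF S], of "Suc j"]
    by (intro continuous_on_sum continuous_on_scaleR continuous_on_const)
      (simp add: case_prod_beta del: power_Suc)
  have "((\<lambda>x. integral (cbox 0 1) (\<lambda>t. t ^ j * f (p + t *\<^sub>R (x - p)))) has_derivative
      blinfun_apply (integral (cbox 0 1) (L x))) (at x within ball p r)"
  proof (rule leibniz_rule[OF _ _ C assms(2) convex_ball])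
    fix x and t :: real assume x: "x \<in> ball p r" and t: "t \<in> cbox 0 1"
    have "(f has_derivative (\<lambda>y. \<Sum>a\<in>UNIV. y $ a * partial a f (p + t *\<^sub>R (x - p)))) (at (p + t *\<^sub>R (x - p)))"
      by (intro has_derivative_partial smooth_on_differentiable[OF open_ball assms(1)] ray_in_ball x t)
    then have "((\<lambda>x. f (p + t *\<^sub>R (x - p))) has_derivative
        (\<lambda>y. \<Sum>a\<in>UNIV. (t *\<^sub>R y) $ a * partial a f (p + t *\<^sub>R (x - p)))) (at x within ball p r)"
      by (rule has_derivative_compose[rotated]) (auto intro!: derivative_eq_intros)
    then have "((\<lambda>x. t ^ j * f (p + t *\<^sub>R (x - p))) has_derivative
        (\<lambda>y. t ^ j * (\<Sum>a\<in>UNIV. (t *\<^sub>R y) $ a * partial a f (p + t *\<^sub>R (x - p))))) (at x within ball p r)"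
      by (rule has_derivative_mult_right)
    moreover have "blinfun_apply (L x t) = (\<lambda>y. t ^ j * (\<Sum>a\<in>UNIV. (t *\<^sub>R y) $ a * partial a f (p + t *\<^sub>R (x - p))))"
      unfolding L by (simp add: sum_distrib_left algebra_simps)
    ultimately show "((\<lambda>x. t ^ j * f (p + t *\<^sub>R (x - p))) has_derivative blinfun_apply (L x t)) (at x within ball p r)"
      by simp
  qed (use ray_integrable[OF smooth_on_continuous[OF assms(1)]] in blast)
  moreover have "blinfun_apply (integral (cbox 0 1) (L x)) y = (\<Sum>a\<in>UNIV. y $ a * ray_integral p (Suc j) (partial a f) x)" for y
  proof -
    have "continuous_on (cbox 0 1) ((\<lambda>(x, t). L x t) \<circ> Pair x)"
      by (intro continuous_on_compose continuous_intros continuous_on_subset[OF C]) (use assms(2) in auto)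
    then have "L x integrable_on cbox 0 1"
      by (intro integrable_continuous) (simp add: o_def)
    then have "blinfun_apply (integral (cbox 0 1) (L x)) y = integral (cbox 0 1) (\<lambda>t. blinfun_apply (L x t) y)"
      using integral_linear[OF _ blinfun.bounded_linear_left, of "L x" "cbox 0 1" y] by (simp only: o_def)
    also have "\<dots> = (\<Sum>a\<in>UNIV. integral (cbox 0 1) (\<lambda>t. y $ a * (t ^ Suc j * partial a f (p + t *\<^sub>R (x - p)))))"
      unfolding L
      by (intro integral_sum integrable_on_mult_right ray_integrable[OF smooth_on_continuous[OF S] assms(2)] finite)
    finally show ?thesis by (simp only: ray_integral_def integral_mult_right)
  qed
  then have "blinfun_apply (integral (cbox 0 1) (L x)) = (\<lambda>y. \<Sum>a\<in>UNIV. y $ a * ray_integral p (Suc j) (partial a f) x)"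
    by (rule ext)
  ultimately show ?thesis
    unfolding at_within_open[OF assms(2) open_ball] ray_integral_def[abs_def] by (simp only:)
qed

lemma Ck_on_ray_integral:
  assumes "smooth_on (ball p r) f"
  shows "Ck_on k (ball p r) (ray_integral p j f)"
  using assms
proof (induction k arbitrary: f j)
  case 0
  show ?case unfolding Ck_on.simps
    by (intro continuous_at_imp_continuous_on ballI has_derivative_continuous[OF ray_integral_has_derivative[OF 0]])
next
  case (Suc k)
  show ?case
  proof (rule Ck_on_SucI[OF open_ball ray_integral_has_derivative[OF Suc.prems]])
    show "Ck_on k (ball p r) (\<lambda>x. \<Sum>c\<in>UNIV. axis a 1 $ c * ray_integral p (Suc j) (partial c f) x)" for a
      unfolding sum_axis_1 by (rule Suc.IH[OF smooth_on_partial[OF Suc.prems]])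
  qed
qed

text \<open>Integrate the derivative of t \<mapsto> f (p + t (x - p)) over [0, 1]; the ball is
  star-shaped about p, so the ray stays inside. The smooth factors h are what allows the Leibniz
  rule of a point derivation to be applied to f.\<close>

lemma Hadamard:
  assumes f: "smooth_on (ball p r) f" and r: "r > 0"
  obtains h where "\<And>a. smooth_on (ball p r) (h a)" "\<And>a. h a p = partial a f p"
    "\<And>x. x \<in> ball p r \<Longrightarrow> f x = f p + (\<Sum>a\<in>UNIV. (x $ a - p $ a) * h a x)"
proof
  let ?h = "\<lambda>a. ray_integral p 0 (partial a f)"
  note S = smooth_on_partial[OF f]
  show "smooth_on (ball p r) (?h a)" for a
    using Ck_on_ray_integral[OF S] by (simp add: smooth_on_def)
  show "?h a p = partial a f p" for a
    by (simp add: ray_integral_def)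
  show "f x = f p + (\<Sum>a\<in>UNIV. (x $ a - p $ a) * ?h a x)" if x: "x \<in> ball p r" for x
  proof -
    let ?d = "\<lambda>t. \<Sum>a\<in>UNIV. (x - p) $ a * (t ^ 0 * partial a f (p + t *\<^sub>R (x - p)))"
    have "((\<lambda>t. f (p + t *\<^sub>R (x - p))) has_vector_derivative ?d t) (at t within {0..1})" if t: "t \<in> {0..1}" for t
    proof -
      have "(f has_derivative (\<lambda>y. \<Sum>a\<in>UNIV. y $ a * partial a f (p + t *\<^sub>R (x - p)))) (at (p + t *\<^sub>R (x - p)))"
        using t by (intro has_derivative_partial smooth_on_differentiable[OF open_ball f] ray_in_ball x) simp
      then have "((\<lambda>t. f (p + t *\<^sub>R (x - p))) has_derivative
          (\<lambda>s. \<Sum>a\<in>UNIV. (s *\<^sub>R (x - p)) $ a * partial a f (p + t *\<^sub>R (x - p)))) (at t within {0..1})"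
        by (rule has_derivative_compose[rotated]) (auto intro!: derivative_eq_intros)
      then show ?thesis
        unfolding has_vector_derivative_def
        by (rule has_derivative_eq_rhs) (simp add: sum_distrib_left algebra_simps fun_eq_iff)
    qed
    then have "(?d has_integral (f (p + 1 *\<^sub>R (x - p)) - f (p + 0 *\<^sub>R (x - p)))) {0..1}"
      by (intro fundamental_theorem_of_calculus) auto
    then have "f x - f p = integral (cbox 0 1) ?d"
      by (simp add: integral_unique)
    also have "\<dots> = (\<Sum>a\<in>UNIV. integral (cbox 0 1) (\<lambda>t. (x - p) $ a * (t ^ 0 * partial a f (p + t *\<^sub>R (x - p)))))"
      by (intro integral_sum integrable_on_mult_right ray_integrable[OF smooth_on_continuous[OF S] x] finite)
    finally show ?thesis by (simp only: ray_integral_def integral_mult_right vector_minus_component)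
  qed
qed

section \<open>The Levi-Civita connection of an algebra of functions\<close>

text \<open>The value 0 outside F makes derivations that agree on F equal in HOL.\<close>

definition derivations :: "('p \<Rightarrow> real) set \<Rightarrow> (('p \<Rightarrow> real) \<Rightarrow> 'p \<Rightarrow> real) set"
  where "derivations F = {d. (\<forall>f\<in>F. d f \<in> F) \<and> (\<forall>f. f \<notin> F \<longrightarrow> d f = (\<lambda>_. 0)) \<and>
    (\<forall>f\<in>F. \<forall>h\<in>F. d (\<lambda>m. f m + h m) = (\<lambda>m. d f m + d h m)) \<and>
    (\<forall>r. \<forall>f\<in>F. d (\<lambda>m. r * f m) = (\<lambda>m. r * d f m)) \<and>
    (\<forall>f\<in>F. \<forall>h\<in>F. d (\<lambda>m. f m * h m) = (\<lambda>m. d f m * h m + f m * d h m))}"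

definition der_add where "der_add u v = (\<lambda>f m. u f m + v f m :: real)"
definition der_mult where "der_mult h u = (\<lambda>f m. h m * u f m :: real)"
definition der_bracket where "der_bracket u v = (\<lambda>f m. u (v f) m - v (u f) m :: real)"

lemma der_add_apply: "der_add u v f m = u f m + v f m"
  and der_mult_apply: "der_mult h u f m = h m * u f m"
  and der_bracket_apply: "der_bracket u v f m = u (v f) m - v (u f) m"
  by (simp_all add: der_add_def der_mult_def der_bracket_def)

text \<open>\<open>F_local\<close> stands in for the sheaf property: it permits division by a member
  of F near the points where that member does not vanish, and membership may be checked one point at
  a time. Members of F vanish off X so that equality on X is equality in HOL.\<close>

locale function_algebra =
  fixes X :: "'p set" and F :: "('p \<Rightarrow> real) set"
  assumes F_outside: "f \<in> F \<Longrightarrow> m \<notin> X \<Longrightarrow> f m = 0"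
    and F_add [simp]: "f \<in> F \<Longrightarrow> h \<in> F \<Longrightarrow> (\<lambda>m. f m + h m) \<in> F"
    and F_mult [simp]: "f \<in> F \<Longrightarrow> h \<in> F \<Longrightarrow> (\<lambda>m. f m * h m) \<in> F"
    and F_scale [simp]: "f \<in> F \<Longrightarrow> (\<lambda>m. r * f m) \<in> F"
    and F_one: "(\<lambda>m. if m \<in> X then 1 else 0) \<in> F"
    and F_local: "(\<And>m. m \<notin> X \<Longrightarrow> f m = 0) \<Longrightarrow>
      (\<And>m. m \<in> X \<Longrightarrow> \<exists>\<rho>\<in>F. \<rho> m \<noteq> 0 \<and> (\<lambda>m. \<rho> m * f m) \<in> F) \<Longrightarrow> f \<in> F"
begin

abbreviation D where "D \<equiv> derivations F"

definition cst :: "real \<Rightarrow> 'p \<Rightarrow> real" where "cst r = (\<lambda>m. if m \<in> X then r else 0)"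

lemma F_cst [simp]: "cst r \<in> F"
proof -
  have "(\<lambda>m. r * (if m \<in> X then 1 else 0)) \<in> F" by (rule F_scale[OF F_one])
  moreover have "(\<lambda>m. r * (if m \<in> X then 1 else 0)) = cst r" by (auto simp: cst_def)
  ultimately show ?thesis by simp
qed

lemma F_zero [simp]: "(\<lambda>_. 0) \<in> F"
  using F_cst[of 0] by (simp add: cst_def)

lemma F_diff [simp]: "f \<in> F \<Longrightarrow> h \<in> F \<Longrightarrow> (\<lambda>m. f m - h m) \<in> F"
  using F_add[of f "\<lambda>m. - 1 * h m"] F_scale[of h "- 1"] by simp

lemma F_minus [simp]: "h \<in> F \<Longrightarrow> (\<lambda>m. - h m) \<in> F"
  using F_scale[of h "- 1"] by simp

lemma F_half [simp]: "h \<in> F \<Longrightarrow> (\<lambda>m. h m / 2) \<in> F"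
  using F_scale[of h "1 / 2"] by simp

lemma F_sum: "finite A \<Longrightarrow> (\<And>a. a \<in> A \<Longrightarrow> f a \<in> F) \<Longrightarrow> (\<lambda>m. \<Sum>a\<in>A. f a m) \<in> F"
  by (induction A rule: finite_induct) auto

text \<open>The empty product is excluded because it is 1 everywhere, also outside X.\<close>

lemma F_prod: "finite A \<Longrightarrow> A \<noteq> {} \<Longrightarrow> (\<And>a. a \<in> A \<Longrightarrow> f a \<in> F) \<Longrightarrow> (\<lambda>m. \<Prod>a\<in>A. f a m) \<in> F"
  by (induction A rule: finite_ne_induct) auto

lemma F_det:
  assumes "\<And>i j. (\<lambda>m. A m i j) \<in> F"
  shows "(\<lambda>m. det (\<chi> i j :: 'n::finite. A m i j)) \<in> F"
  unfolding det_def
  by (intro F_sum F_scale F_prod) (auto simp: assms)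

lemma der_F: "d \<in> D \<Longrightarrow> d f \<in> F"
  by (cases "f \<in> F") (auto simp: derivations_def)

lemma der_notin: "d \<in> D \<Longrightarrow> f \<notin> F \<Longrightarrow> d f m = 0"
  by (auto simp: derivations_def)

lemma der_sum_fun: "d \<in> D \<Longrightarrow> f \<in> F \<Longrightarrow> h \<in> F \<Longrightarrow> d (\<lambda>m. f m + h m) m' = d f m' + d h m'"
  by (auto simp: derivations_def)

lemma der_scale_fun: "d \<in> D \<Longrightarrow> f \<in> F \<Longrightarrow> d (\<lambda>m. r * f m) m' = r * d f m'"
  by (auto simp: derivations_def)

lemma der_mult_fun: "d \<in> D \<Longrightarrow> f \<in> F \<Longrightarrow> h \<in> F \<Longrightarrow> d (\<lambda>m. f m * h m) m' = d f m' * h m' + f m' * d h m'"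
  by (auto simp: derivations_def)

lemma der_zero: "d \<in> D \<Longrightarrow> d (\<lambda>_. 0) m' = 0"
  using der_scale_fun[of d "\<lambda>_. 0" 0] by simp

lemma der_outside: "d \<in> D \<Longrightarrow> m \<notin> X \<Longrightarrow> d f m = 0"
  by (rule F_outside[OF der_F])

text \<open>The unit is idempotent, so the Leibniz rule gives d(1) = 2 d(1) on X.\<close>

lemma der_cst: "d \<in> D \<Longrightarrow> d (cst r) m = 0"
proof -
  assume d: "d \<in> D"
  have sq: "(\<lambda>m. cst 1 m * cst 1 m) = cst 1" by (auto simp: cst_def)
  have "d (cst 1) m = d (cst 1) m * cst 1 m + cst 1 m * d (cst 1) m"
    using der_mult_fun[OF d, of "cst 1" "cst 1"] unfolding sq by simp
  then have "d (cst 1) m = 0"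
    using der_outside[OF d] by (cases "m \<in> X") (auto simp: cst_def)
  moreover have "(\<lambda>m. r * cst 1 m) = cst r" by (auto simp: cst_def)
  ultimately show ?thesis using der_scale_fun[OF d, of "cst 1" r m] by simp
qed

lemma D_I:
  assumes "\<And>f. f \<in> F \<Longrightarrow> d f \<in> F" "\<And>f m. f \<notin> F \<Longrightarrow> d f m = 0"
    "\<And>f h m. f \<in> F \<Longrightarrow> h \<in> F \<Longrightarrow> d (\<lambda>m. f m + h m) m = d f m + d h m"
    "\<And>r f m. f \<in> F \<Longrightarrow> d (\<lambda>m. r * f m) m = r * d f m"
    "\<And>f h m. f \<in> F \<Longrightarrow> h \<in> F \<Longrightarrow> d (\<lambda>m. f m * h m) m = d f m * h m + f m * d h m"
  shows "d \<in> D"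
  using assms by (auto simp: derivations_def fun_eq_iff)

lemma der_eqI:
  assumes "u \<in> D" "v \<in> D" "\<And>f m. f \<in> F \<Longrightarrow> m \<in> X \<Longrightarrow> u f m = v f m"
  shows "u = v"
proof (intro ext)
  fix f m show "u f m = v f m"
    using assms(3) der_notin[OF assms(1), of f m] der_notin[OF assms(2), of f m]
      der_outside[OF assms(1), of m f] der_outside[OF assms(2), of m f]
    by (cases "f \<in> F"; cases "m \<in> X") auto
qed

lemma D_add [simp]: "u \<in> D \<Longrightarrow> v \<in> D \<Longrightarrow> der_add u v \<in> D"
  by (rule D_I) (auto simp: der_F[of u] der_F[of v] der_add_def der_notin der_sum_fun der_scale_fun der_mult_fun algebra_simps)

lemma D_mult [simp]: "h \<in> F \<Longrightarrow> v \<in> D \<Longrightarrow> der_mult h v \<in> D"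
  by (rule D_I) (auto simp: der_F[of v] der_mult_def der_notin der_sum_fun der_scale_fun der_mult_fun algebra_simps)

lemma D_zero [simp]: "(\<lambda>_ _. 0) \<in> D"
  by (rule D_I) auto

text \<open>The two mixed terms are exchanged when u and v are, so they cancel in the
  bracket.\<close>

lemma der_der_mult:
  assumes "u \<in> D" "v \<in> D" "f \<in> F" "h \<in> F"
  shows "u (v (\<lambda>m. f m * h m)) m = u (v f) m * h m + v f m * u h m + u f m * v h m + f m * u (v h) m"
proof -
  have "v (\<lambda>m. f m * h m) = (\<lambda>m. v f m * h m + f m * v h m)"
    using assms by (intro ext der_mult_fun)
  then show ?thesis
    using assms der_F[OF assms(2)]
    by (simp add: der_sum_fun[OF assms(1), of "\<lambda>m. v f m * h m" "\<lambda>m. f m * v h m"]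
        der_mult_fun[OF assms(1), of "v f" h] der_mult_fun[OF assms(1), of f "v h"])
qed

lemma D_bracket [simp]: "u \<in> D \<Longrightarrow> v \<in> D \<Longrightarrow> der_bracket u v \<in> D"
proof (rule D_I)
  assume uv: "u \<in> D" "v \<in> D"
  have E: "w (\<lambda>m. f m + h m) = (\<lambda>m. w f m + w h m)" "w (\<lambda>m. r * f m) = (\<lambda>m. r * w f m)"
    "w (\<lambda>m. f m * h m) = (\<lambda>m. w f m * h m + f m * w h m)"
    if "w \<in> D" "f \<in> F" "h \<in> F" for w f h r
    using that by (auto simp: derivations_def)
  note uv_F [simp] = uv[THEN der_F]
  show "der_bracket u v (\<lambda>m. f m + h m) m = der_bracket u v f m + der_bracket u v h m" if "f \<in> F" "h \<in> F" for f h m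
    using that uv uv_F by (simp add: der_bracket_def E)
  show "der_bracket u v (\<lambda>m. r * f m) m = r * der_bracket u v f m" if "f \<in> F" for r f m
    using that uv uv_F by (simp add: der_bracket_def E algebra_simps)
  show "der_bracket u v (\<lambda>m. f m * h m) m = der_bracket u v f m * h m + f m * der_bracket u v h m" if "f \<in> F" "h \<in> F" for f h m
    unfolding der_bracket_apply der_der_mult[OF uv that] der_der_mult[OF uv(2,1) that] by (simp add: algebra_simps)
  show "der_bracket u v f m = 0" if "f \<notin> F" for f m
  proof -
    have "u f = (\<lambda>_. 0)" "v f = (\<lambda>_. 0)" using der_notin that uv by blast+
    then show ?thesis using uv by (simp add: der_bracket_def der_zero)
  qed
  show "der_bracket u v f \<in> F" if "f \<in> F" for f
    unfolding der_bracket_def by (intro F_diff uv_F)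
qed

lemma der_add_eq: "der_add u v f = (\<lambda>m. u f m + v f m)"
  and der_mult_eq: "der_mult h u f = (\<lambda>m. h m * u f m)"
  by (simp_all add: der_add_def der_mult_def)

lemma der_bracket_add: "u \<in> D \<Longrightarrow> v \<in> D \<Longrightarrow> w \<in> D \<Longrightarrow>
    der_bracket u (der_add v w) = der_add (der_bracket u v) (der_bracket u w)"
  by (rule der_eqI) (auto simp: der_bracket_apply der_add_apply der_add_eq der_sum_fun der_F[of u] der_F[of v] der_F[of w])

lemma der_bracket_add_left: "u \<in> D \<Longrightarrow> v \<in> D \<Longrightarrow> w \<in> D \<Longrightarrow>
    der_bracket (der_add v w) u = der_add (der_bracket v u) (der_bracket w u)"
  by (rule der_eqI) (auto simp: der_bracket_apply der_add_apply der_add_eq der_sum_fun der_F[of u] der_F[of v] der_F[of w])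

lemma der_bracket_mult: "u \<in> D \<Longrightarrow> v \<in> D \<Longrightarrow> h \<in> F \<Longrightarrow>
    der_bracket u (der_mult h v) = der_add (der_mult (u h) v) (der_mult h (der_bracket u v))"
  by (rule der_eqI)
    (auto simp: der_bracket_apply der_add_apply der_mult_apply der_mult_eq der_mult_fun der_F[of u] der_F[of v] algebra_simps)

lemma der_bracket_mult_left: "u \<in> D \<Longrightarrow> v \<in> D \<Longrightarrow> h \<in> F \<Longrightarrow>
    der_bracket (der_mult h v) u = der_add (der_mult (\<lambda>m. - u h m) v) (der_mult h (der_bracket v u))"
  by (rule der_eqI)
    (auto simp: der_bracket_apply der_add_apply der_mult_apply der_mult_eq der_mult_fun der_F[of u] der_F[of v] algebra_simps)

lemma der_bracket_swap: "u \<in> D \<Longrightarrow> v \<in> D \<Longrightarrow> der_bracket v u = der_mult (cst (- 1)) (der_bracket u v)"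
  by (rule der_eqI) (simp_all, simp add: der_bracket_apply der_mult_apply cst_def)

text \<open>These are the 1-forms of the algebra.\<close>

definition F_linear :: "((('p \<Rightarrow> real) \<Rightarrow> 'p \<Rightarrow> real) \<Rightarrow> 'p \<Rightarrow> real) \<Rightarrow> bool"
  where "F_linear l \<longleftrightarrow> (\<forall>u\<in>D. l u \<in> F) \<and>
    (\<forall>u\<in>D. \<forall>v\<in>D. l (der_add u v) = (\<lambda>m. l u m + l v m)) \<and>
    (\<forall>h\<in>F. \<forall>u\<in>D. l (der_mult h u) = (\<lambda>m. h m * l u m))"

lemma D_sum:
  assumes "finite A" "\<And>a. a \<in> A \<Longrightarrow> h a \<in> F" "\<And>a. a \<in> A \<Longrightarrow> E a \<in> D"
  shows "(\<lambda>f m. \<Sum>a\<in>A. h a m * E a f m) \<in> D"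
  using assms
proof (induction A rule: finite_induct)
  case (insert a A)
  have "(\<lambda>f m. \<Sum>a\<in>insert a A. h a m * E a f m) = der_add (der_mult (h a) (E a)) (\<lambda>f m. \<Sum>a\<in>A. h a m * E a f m)"
    using insert by (simp add: der_add_def der_mult_def)
  then show ?case using insert by auto
qed auto

lemma F_linear_sum:
  assumes "F_linear l" "finite A" "\<And>a. a \<in> A \<Longrightarrow> h a \<in> F" "\<And>a. a \<in> A \<Longrightarrow> E a \<in> D"
  shows "l (\<lambda>f m. \<Sum>a\<in>A. h a m * E a f m) m = (\<Sum>a\<in>A. h a m * l (E a) m)"
  using assms(2-)
proof (induction A rule: finite_induct)
  case empty
  have "l (der_mult (\<lambda>_. 0) (\<lambda>_ _. 0)) = (\<lambda>m. 0 * l (\<lambda>_ _. 0) m)"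
    using assms(1) F_zero D_zero unfolding F_linear_def by blast
  then show ?case by (simp add: der_mult_def)
next
  case (insert a A)
  have "(\<lambda>f m. \<Sum>a\<in>insert a A. h a m * E a f m) = der_add (der_mult (h a) (E a)) (\<lambda>f m. \<Sum>a\<in>A. h a m * E a f m)"
    using insert by (simp add: der_add_def der_mult_def)
  moreover have "(\<lambda>f m. \<Sum>a\<in>A. h a m * E a f m) \<in> D"
    by (rule D_sum) (use insert in simp_all)
  ultimately show ?case using insert assms(1) by (simp add: F_linear_def)
qed

end

section \<open>Representation of 1-forms by a nondegenerate metric\<close>

text \<open>
  The local frame is stated with a cutoff function \<open>\<beta>\<close>, so that only globally defined derivations occur.
\<close>

locale metric_algebra = function_algebra X F for X :: "'p set" and F +
  fixes N :: "'n::finite itself" and \<gamma> :: "(('p \<Rightarrow> real) \<Rightarrow> 'p \<Rightarrow> real) \<Rightarrow> (('p \<Rightarrow> real) \<Rightarrow> 'p \<Rightarrow> real) \<Rightarrow> 'p \<Rightarrow> real"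
  assumes local_frame: "m \<in> X \<Longrightarrow> \<exists>\<beta>\<in>F. \<exists>x :: 'n \<Rightarrow> 'p \<Rightarrow> real. \<exists>E. \<beta> m \<noteq> 0 \<and>
      (\<forall>a. x a \<in> F) \<and> (\<forall>a. E a \<in> derivations F) \<and>
      (\<forall>a b. E a (x b) m = (if a = b then 1 else 0)) \<and>
      (\<forall>Z\<in>derivations F. \<forall>f\<in>F. \<forall>m'. \<beta> m' * Z f m' = (\<Sum>a\<in>UNIV. (\<beta> m' * Z (x a) m') * E a f m'))"
    and \<gamma>_F [simp]: "u \<in> derivations F \<Longrightarrow> v \<in> derivations F \<Longrightarrow> \<gamma> u v \<in> F"
    and \<gamma>_sym: "u \<in> derivations F \<Longrightarrow> v \<in> derivations F \<Longrightarrow> \<gamma> u v = \<gamma> v u"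
    and \<gamma>_add: "u \<in> derivations F \<Longrightarrow> v \<in> derivations F \<Longrightarrow> w \<in> derivations F \<Longrightarrow> \<gamma> (der_add u v) w = (\<lambda>m. \<gamma> u w m + \<gamma> v w m)"
    and \<gamma>_mult: "h \<in> F \<Longrightarrow> u \<in> derivations F \<Longrightarrow> v \<in> derivations F \<Longrightarrow> \<gamma> (der_mult h u) v = (\<lambda>m. h m * \<gamma> u v m)"
    and \<gamma>_nondegenerate: "m \<in> X \<Longrightarrow> u \<in> derivations F \<Longrightarrow> (\<And>v. v \<in> derivations F \<Longrightarrow> \<gamma> u v m = 0) \<Longrightarrow> f \<in> F \<Longrightarrow> u f m = 0"
begin

lemma \<gamma>_add_right: "u \<in> D \<Longrightarrow> v \<in> D \<Longrightarrow> w \<in> D \<Longrightarrow> \<gamma> u (der_add v w) = (\<lambda>m. \<gamma> u v m + \<gamma> u w m)"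
  by (simp add: \<gamma>_sym[of u] \<gamma>_add)

lemma \<gamma>_mult_right: "h \<in> F \<Longrightarrow> u \<in> D \<Longrightarrow> v \<in> D \<Longrightarrow> \<gamma> u (der_mult h v) = (\<lambda>m. h m * \<gamma> u v m)"
  by (simp add: \<gamma>_sym[of u] \<gamma>_mult)

lemma F_linear_\<gamma>: "u \<in> D \<Longrightarrow> F_linear (\<gamma> u)"
  by (simp add: F_linear_def \<gamma>_add_right \<gamma>_mult_right)

lemma \<gamma>_eq_imp_eq_at:
  assumes "m \<in> X" "u \<in> D" "v \<in> D" "\<And>w. w \<in> D \<Longrightarrow> \<gamma> u w m = \<gamma> v w m" "f \<in> F"
  shows "u f m = v f m"
proof -
  have "der_add u (der_mult (cst (- 1)) v) f m = 0"
    by (rule \<gamma>_nondegenerate[OF assms(1) _ _ assms(5)])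
      (use assms(1-4) in \<open>simp_all add: \<gamma>_add \<gamma>_mult, simp add: cst_def\<close>)
  then show ?thesis using assms(1) by (simp add: der_add_apply der_mult_apply cst_def)
qed

lemma \<gamma>_eq_imp_eq:
  assumes "u \<in> D" "v \<in> D" "\<And>w m. w \<in> D \<Longrightarrow> \<gamma> u w m = \<gamma> v w m"
  shows "u = v"
proof (rule der_eqI[OF assms(1,2)])
  fix f m assume fm: "f \<in> F" "m \<in> X"
  show "u f m = v f m" by (rule \<gamma>_eq_imp_eq_at[OF fm(2) assms fm(1)])
qed

text \<open>In the frame around m this is a linear system with the Gram matrix of \<gamma>. Cramer's
  rule solves it, and clearing all denominators turns the solution into a globally defined
  derivation; \<rho> collects the cleared factors.\<close>

lemma local_riesz:
  assumes l: "F_linear l" and m: "m \<in> X"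
  shows "\<exists>\<rho>\<in>F. \<exists>Y\<in>D. \<rho> m \<noteq> 0 \<and> (\<forall>Z\<in>D. \<forall>m'. \<gamma> Y Z m' = \<rho> m' * l Z m')"
proof -
  obtain \<beta> and x :: "'n \<Rightarrow> 'p \<Rightarrow> real" and E where \<beta>: "\<beta> \<in> F" "\<beta> m \<noteq> 0" and x: "\<And>a. x a \<in> F"
    and E: "\<And>a. E a \<in> D" and dual: "\<And>a b. E a (x b) m = (if a = b then 1 else 0)"
    and frame: "\<And>Z f m'. Z \<in> D \<Longrightarrow> f \<in> F \<Longrightarrow> \<beta> m' * Z f m' = (\<Sum>a\<in>UNIV. (\<beta> m' * Z (x a) m') * E a f m')"
    using local_frame[OF m] by blast
  \<comment> \<open>An F-linear form is determined by its values on the frame wherever \<beta> is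
    nonzero. Applying it to \<beta>Z instead of Z keeps every term a globally defined
    derivation.\<close>
  have expand: "\<beta> m' * k Z m' = (\<Sum>a\<in>UNIV. (\<beta> m' * Z (x a) m') * k (E a) m')"
    if k: "F_linear k" and Z: "Z \<in> D" for k Z m'
  proof -
    have "der_mult \<beta> Z = (\<lambda>f m'. \<Sum>a\<in>UNIV. (\<beta> m' * Z (x a) m') * E a f m')"
    proof (rule der_eqI)
      show "(\<lambda>f m'. \<Sum>a\<in>UNIV. (\<beta> m' * Z (x a) m') * E a f m') \<in> D"
        by (rule D_sum) (use \<beta> der_F[OF Z] E in simp_all)
    qed (use \<beta> Z frame in \<open>auto simp: der_mult_apply\<close>)
    then have "k (der_mult \<beta> Z) m' = (\<Sum>a\<in>UNIV. (\<beta> m' * Z (x a) m') * k (E a) m')"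
      using F_linear_sum[OF k finite, of UNIV "\<lambda>a m'. \<beta> m' * Z (x a) m'" E m'] \<beta> der_F[OF Z] E by simp
    then show ?thesis using k \<beta> Z by (simp add: F_linear_def)
  qed
  \<comment> \<open>G is the Gram matrix of the frame, b the right-hand side, and
    \<open>nu k\<close> the Cramer numerator, so that \<open>nu k / dt\<close> is the k-th unknown
    where \<open>dt\<close> is nonzero.\<close>
  define G where "G m' = (\<chi> i j. \<gamma> (E i) (E j) m')" for m'
  define b where "b m' = (\<chi> i. l (E i) m')" for m'
  define dt where "dt m' = det (G m')" for m'
  define nu where "nu k m' = det (\<chi> i j. if j = k then b m' $ i else G m' $ i $ j)" for k m'
  have lE: "l (E i) \<in> F" for i using l E by (simp add: F_linear_def)
  have dtF: "dt \<in> F" unfolding dt_def[abs_def] G_def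
    by (rule F_det) (use E in simp_all)
  have nuF: "nu k \<in> F" for k
  proof -
    have "(\<lambda>m'. det (\<chi> i j. (if j = k then l (E i) else \<gamma> (E i) (E j)) m')) \<in> F"
      by (rule F_det) (use E lE in simp_all)
    then show ?thesis
      unfolding nu_def[abs_def] b_def G_def by (simp add: if_distrib[of "\<lambda>f. f _"] cong: if_cong)
  qed
  have cramer': "dt m' * (\<Sum>k\<in>UNIV. \<gamma> (E i) (E k) m' * nu k m') = dt m' * dt m' * l (E i) m'" for i m'
  proof (cases "dt m' = 0")
    case False
    then have "G m' *v (\<chi> k. nu k m' / dt m') = b m'"
      using cramer[of "G m'" _ "b m'"] by (simp add: dt_def nu_def)
    then have "(G m' *v (\<chi> k. nu k m' / dt m')) $ i = b m' $ i" by simp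
    then have "(\<Sum>k\<in>UNIV. \<gamma> (E i) (E k) m' * (nu k m' / dt m')) = l (E i) m'"
      by (simp add: matrix_vector_mult_def G_def b_def)
    then show ?thesis using False by (simp add: sum_divide_distrib[symmetric] field_simps)
  qed simp
  \<comment> \<open>A null vector c of the Gram matrix at m would be the coefficient vector of a
    derivation u orthogonal at m to everything. Nondegeneracy then gives u (x b) = 0 at m, while the
    frame is dual to x at m, so this value is the b-th entry of c.\<close>
  have dtm: "dt m \<noteq> 0"
  proof
    assume "dt m = 0"
    then obtain c where c: "c \<noteq> 0" "G m *v c = 0"
      unfolding dt_def by (metis invertible_det_nz invertible_left_inverse matrix_left_invertible_ker)
    define u where "u = (\<lambda>f m'. \<Sum>a\<in>UNIV. cst (c $ a) m' * E a f m')"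
    have u: "u \<in> D" unfolding u_def by (rule D_sum) (use E in simp_all)
    have "\<gamma> u v m = 0" if v: "v \<in> D" for v
    proof -
      have "\<gamma> (E a) u m = 0" for a
      proof -
        have "\<gamma> (E a) u m = (\<Sum>k\<in>UNIV. cst (c $ k) m * \<gamma> (E a) (E k) m)"
          unfolding u_def by (rule F_linear_sum[OF F_linear_\<gamma>]) (use E in simp_all)
        also have "\<dots> = (G m *v c) $ a"
          using m by (simp add: matrix_vector_mult_def G_def cst_def mult.commute)
        finally show ?thesis using c by simp
      qed
      then have "\<beta> m * \<gamma> u v m = 0"
        using expand[OF F_linear_\<gamma>[OF u] v, of m] by (simp add: \<gamma>_sym[OF u E])
      then show ?thesis using \<beta> by simp
    qed
    then have "u (x b) m = 0" for b using \<gamma>_nondegenerate[OF m u _ x] by blast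
    moreover have "u (x b) m = c $ b" for b
      using m by (simp add: u_def dual cst_def if_distrib[of "\<lambda>t. _ * t"] cong: if_cong)
    ultimately show False using c by (simp add: vec_eq_iff)
  qed
  txt \<open>The square of the determinant makes Cramer's rule hold also where the determinant vanishes.\<close>
  define \<rho> where "\<rho> = (\<lambda>m'. \<beta> m' * (dt m' * dt m'))"
  define Y where "Y = (\<lambda>f m'. \<Sum>k\<in>UNIV. (\<beta> m' * (dt m' * nu k m')) * E k f m')"
  have h: "(\<lambda>m'. \<beta> m' * (dt m' * nu k m')) \<in> F" for k using \<beta> dtF nuF by simp
  have Y: "Y \<in> D" unfolding Y_def by (rule D_sum) (use E h in simp_all)
  have "\<gamma> Y Z m' = \<rho> m' * l Z m'" if Z: "Z \<in> D" for Z m'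
  proof -
    have "\<gamma> Y Z m' = \<gamma> Z Y m'" using Y Z \<gamma>_sym by metis
    also have "\<dots> = (\<Sum>k\<in>UNIV. (\<beta> m' * (dt m' * nu k m')) * \<gamma> Z (E k) m')"
      unfolding Y_def by (rule F_linear_sum[OF F_linear_\<gamma>[OF Z]]) (use E h in simp_all)
    also have "\<dots> = (\<Sum>k\<in>UNIV. (dt m' * nu k m') * (\<beta> m' * \<gamma> (E k) Z m'))"
      using E Z by (simp add: \<gamma>_sym[of Z] mult_ac)
    also have "\<dots> = (\<Sum>k\<in>UNIV. \<Sum>a\<in>UNIV. (dt m' * nu k m') * ((\<beta> m' * Z (x a) m') * \<gamma> (E a) (E k) m'))"
      by (simp add: expand[OF F_linear_\<gamma>[OF E] Z] sum_distrib_left \<gamma>_sym[OF E E])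
    also have "\<dots> = (\<Sum>a\<in>UNIV. (\<beta> m' * Z (x a) m') * (dt m' * (\<Sum>k\<in>UNIV. \<gamma> (E a) (E k) m' * nu k m')))"
      by (subst sum.swap) (simp add: sum_distrib_left mult_ac)
    also have "\<dots> = dt m' * dt m' * (\<beta> m' * l Z m')"
      unfolding cramer' expand[OF l Z] by (simp add: sum_distrib_left mult_ac)
    finally show ?thesis by (simp add: \<rho>_def)
  qed
  moreover have "\<rho> \<in> F" "\<rho> m \<noteq> 0" using \<beta> dtF dtm by (auto simp: \<rho>_def)
  ultimately show ?thesis using Y by blast
qed

text \<open>Local solutions are unique at each point by nondegeneracy. Dividing each by its factor
  \<rho> therefore gives one well-defined derivation, and no averaging of local solutions is
  needed.\<close>

lemma ex1_riesz:
  assumes l: "F_linear l"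
  shows "\<exists>!Y. Y \<in> D \<and> (\<forall>Z\<in>D. \<gamma> Y Z = l Z)"
proof (rule ex_ex1I)
  have "\<forall>m\<in>X. \<exists>\<rho> Y. \<rho> \<in> F \<and> Y \<in> D \<and> \<rho> m \<noteq> 0 \<and> (\<forall>Z\<in>D. \<forall>m'. \<gamma> Y Z m' = \<rho> m' * l Z m')"
    using local_riesz[OF l] by blast
  then obtain \<rho> Y where "\<forall>m\<in>X. \<rho> m \<in> F \<and> Y m \<in> D \<and> \<rho> m m \<noteq> 0 \<and> (\<forall>Z\<in>D. \<forall>m'. \<gamma> (Y m) Z m' = \<rho> m m' * l Z m')"
    by metis
  then have \<rho>: "\<And>m. m \<in> X \<Longrightarrow> \<rho> m \<in> F" "\<And>m. m \<in> X \<Longrightarrow> \<rho> m m \<noteq> 0" and Y: "\<And>m. m \<in> X \<Longrightarrow> Y m \<in> D"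
    and \<gamma>Y: "\<And>m m' Z. m \<in> X \<Longrightarrow> Z \<in> D \<Longrightarrow> \<gamma> (Y m) Z m' = \<rho> m m' * l Z m'"
    by auto
  \<comment> \<open>At m the solution belonging to m itself is evaluated, since its factor is known
    to be nonzero there.\<close>
  define y where "y = (\<lambda>f m. if m \<in> X then Y m f m / \<rho> m m else 0)"
  \<comment> \<open>Multiplied crosswise by the two numbers \<rho>, the solutions belonging to m and
    m' have equal pairings at m', hence equal values there. The numbers enter through
    \<open>cst\<close> so that the products are derivations.\<close>
  have compat: "Y m f m' = \<rho> m m' * y f m'" if m: "m \<in> X" "m' \<in> X" "f \<in> F" for m m' f
  proof -
    have "der_mult (cst (\<rho> m' m')) (Y m) f m' = der_mult (cst (\<rho> m m')) (Y m') f m'"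
      by (rule \<gamma>_eq_imp_eq_at) (use m Y in \<open>simp_all add: \<gamma>_mult \<gamma>Y\<close>, simp add: cst_def)
    then show ?thesis using \<rho>(2)[OF m(2)] m by (simp add: der_mult_apply cst_def y_def field_simps)
  qed
  have y: "y \<in> D"
  proof (rule D_I)
    fix f assume f: "f \<in> F"
    show "y f \<in> F"
    proof (rule F_local)
      fix m assume m: "m \<in> X"
      \<comment> \<open>This exhibits y f as a quotient near m of members of F, the situation that
        \<open>F_local\<close> covers.\<close>
      have "(\<lambda>m'. \<rho> m m' * y f m') = Y m f"
      proof
        fix m' show "\<rho> m m' * y f m' = Y m f m'"
          using compat[OF m _ f] der_outside[OF Y[OF m]] by (cases "m' \<in> X") (auto simp: y_def)
      qed
      then show "\<exists>\<rho>\<in>F. \<rho> m \<noteq> 0 \<and> (\<lambda>m'. \<rho> m' * y f m') \<in> F"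
        using \<rho> m der_F[OF Y[OF m]] by metis
    qed (simp add: y_def)
  qed (auto simp: y_def der_notin[OF Y] der_sum_fun[OF Y] der_scale_fun[OF Y] der_mult_fun[OF Y] add_divide_distrib)
  have "\<gamma> y Z m = l Z m" if Z: "Z \<in> D" for Z m
  proof (cases "m \<in> X")
    case True
    have "der_mult (\<rho> m) y = Y m"
      by (rule der_eqI) (use True y \<rho> Y in \<open>auto simp: der_mult_apply compat\<close>)
    then have "\<rho> m m * \<gamma> y Z m = \<rho> m m * l Z m"
      using \<gamma>_mult[OF \<rho>(1)[OF True] y Z] \<gamma>Y[OF True Z] by metis
    then show ?thesis using \<rho>(2)[OF True] by simp
  next
    case False
    have "l Z \<in> F" using l Z by (simp add: F_linear_def)
    then show ?thesis using F_outside[OF \<gamma>_F[OF y Z] False] F_outside[of "l Z", OF _ False] by simp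
  qed
  then show "\<exists>Y. Y \<in> D \<and> (\<forall>Z\<in>D. \<gamma> Y Z = l Z)" using y by blast
next
  fix Y Y' assume "Y \<in> D \<and> (\<forall>Z\<in>D. \<gamma> Y Z = l Z)" "Y' \<in> D \<and> (\<forall>Z\<in>D. \<gamma> Y' Z = l Z)"
  then show "Y = Y'" by (intro \<gamma>_eq_imp_eq) simp_all
qed

section \<open>Koszul's formula and the Levi-Civita connection\<close>

text \<open>The value that compatibility with \<gamma> and vanishing torsion force on the pairing of
  the covariant derivative of v along u with w.\<close>

definition koszul_form where
  "koszul_form u v w = (\<lambda>m. (u (\<gamma> v w) m + v (\<gamma> u w) m - w (\<gamma> u v) m
     + \<gamma> (der_bracket u v) w m - \<gamma> (der_bracket u w) v m - \<gamma> (der_bracket v w) u m) / 2)"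

definition levi_civita where
  "levi_civita u v = (THE y. y \<in> D \<and> (\<forall>w\<in>D. \<gamma> y w = koszul_form u v w))"

lemmas bracket_simps = der_bracket_add der_bracket_add_left der_bracket_mult der_bracket_mult_left
lemmas \<gamma>_simps = \<gamma>_add \<gamma>_mult \<gamma>_add_right \<gamma>_mult_right

text \<open>When w is multiplied by h, the derivatives u h and v h arise once from differentiating
  \<gamma> and once, with opposite sign, from the brackets with w.\<close>

lemma F_linear_koszul_form:
  assumes "u \<in> D" "v \<in> D"
  shows "F_linear (koszul_form u v)"
  unfolding F_linear_def
proof (intro conjI ballI)
  note uv_F [simp] = assms[THEN der_F]
  fix w assume w: "w \<in> D"
  note w_F [simp] = w[THEN der_F]
  show "koszul_form u v w \<in> F"
    unfolding koszul_form_def by (intro F_half F_diff F_add \<gamma>_F D_bracket assms w der_F)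
  show "koszul_form u v (der_add w w') = (\<lambda>m. koszul_form u v w m + koszul_form u v w' m)" if "w' \<in> D" for w'
    using assms w that
    by (intro ext, simp add: koszul_form_def bracket_simps \<gamma>_simps der_sum_fun der_add_apply, simp add: field_simps)
  show "koszul_form u v (der_mult h w) = (\<lambda>m. h m * koszul_form u v w m)" if "h \<in> F" for h
    using assms w that
    by (intro ext, simp add: koszul_form_def bracket_simps \<gamma>_simps der_mult_fun der_mult_apply \<gamma>_sym[of v u] \<gamma>_sym[of w], simp add: field_simps)
qed

lemma levi_civita:
  assumes "u \<in> D" "v \<in> D"
  shows levi_civita_D [simp]: "levi_civita u v \<in> D"
    and \<gamma>_levi_civita: "w \<in> D \<Longrightarrow> \<gamma> (levi_civita u v) w = koszul_form u v w"
  using theI'[OF ex1_riesz[OF F_linear_koszul_form[OF assms]]] by (auto simp: levi_civita_def)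

text \<open>This and the three rules that follow are tested by pairing with an arbitrary w, which
  reduces them to identities of Koszul's expression.\<close>

lemma levi_civita_add_left:
  assumes "u \<in> D" "u' \<in> D" "v \<in> D"
  shows "levi_civita (der_add u u') v = der_add (levi_civita u v) (levi_civita u' v)"
  by (rule \<gamma>_eq_imp_eq)
    (use assms in \<open>simp_all add: \<gamma>_levi_civita \<gamma>_simps\<close>,
     simp add: koszul_form_def bracket_simps \<gamma>_simps der_sum_fun der_add_apply field_simps)

lemma levi_civita_add_right:
  assumes "u \<in> D" "v \<in> D" "v' \<in> D"
  shows "levi_civita u (der_add v v') = der_add (levi_civita u v) (levi_civita u v')"
  by (rule \<gamma>_eq_imp_eq)
    (use assms in \<open>simp_all add: \<gamma>_levi_civita \<gamma>_simps\<close>,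
     simp add: koszul_form_def bracket_simps \<gamma>_simps der_sum_fun der_add_apply field_simps)

lemma levi_civita_mult_left:
  assumes "h \<in> F" "u \<in> D" "v \<in> D"
  shows "levi_civita (der_mult h u) v = der_mult h (levi_civita u v)"
proof (rule \<gamma>_eq_imp_eq)
  fix w m assume w: "w \<in> D"
  show "\<gamma> (levi_civita (der_mult h u) v) w m = \<gamma> (der_mult h (levi_civita u v)) w m"
    using assms w assms(2,3)[THEN der_F] der_F[OF w]
    by (simp add: \<gamma>_levi_civita \<gamma>_simps)
      (simp add: koszul_form_def bracket_simps \<gamma>_simps der_mult_fun der_mult_apply \<gamma>_sym[of w] \<gamma>_sym[of v u] field_simps)
qed (use assms in simp_all)

lemma levi_civita_mult_right:
  assumes "h \<in> F" "u \<in> D" "v \<in> D"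
  shows "levi_civita u (der_mult h v) = der_add (der_mult (u h) v) (der_mult h (levi_civita u v))"
proof (rule \<gamma>_eq_imp_eq)
  fix w m assume w: "w \<in> D"
  show "\<gamma> (levi_civita u (der_mult h v)) w m = \<gamma> (der_add (der_mult (u h) v) (der_mult h (levi_civita u v))) w m"
    using assms w assms(2,3)[THEN der_F] der_F[OF w]
    by (simp add: \<gamma>_levi_civita \<gamma>_simps)
      (simp add: koszul_form_def bracket_simps \<gamma>_simps der_mult_fun der_mult_apply \<gamma>_sym[of w] \<gamma>_sym[of v u] field_simps)
qed (use assms der_F[OF assms(2)] in simp_all)

text \<open>In the sum of Koszul's expressions for (u, v, w) and (u, w, v) all terms cancel except
  two copies of u (\<gamma> v w), once the bracket of w and v is replaced by minus that of v and
  w.\<close>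

lemma levi_civita_metric:
  assumes "u \<in> D" "v \<in> D" "w \<in> D"
  shows "u (\<gamma> v w) m = \<gamma> (levi_civita u v) w m + \<gamma> v (levi_civita u w) m"
proof -
  have "\<gamma> (der_bracket w v) u m = - \<gamma> (der_bracket v w) u m"
    using assms F_outside[OF \<gamma>_F, of "der_bracket v w" u m]
    by (simp add: der_bracket_swap[of v w] \<gamma>_mult, simp add: cst_def)
  then show ?thesis
    using assms
    by (simp add: \<gamma>_sym[of v "levi_civita u w"] \<gamma>_levi_civita koszul_form_def \<gamma>_sym[of w v] field_simps)
qed

end

section \<open>Superalgebras and superdomains with one odd coordinate\<close>

lemma superalg_homD:
  assumes "h \<in> superalg_hom R S"
  shows "f \<in> carrier R \<Longrightarrow> h f \<in> carrier S"
    and "f \<in> carrier R \<Longrightarrow> k \<in> carrier R \<Longrightarrow> h (f \<otimes>\<^bsub>R\<^esub> k) = h f \<otimes>\<^bsub>S\<^esub> h k"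
    and "f \<in> carrier R \<Longrightarrow> k \<in> carrier R \<Longrightarrow> h (f \<oplus>\<^bsub>R\<^esub> k) = h f \<oplus>\<^bsub>S\<^esub> h k"
    and "h \<one>\<^bsub>R\<^esub> = \<one>\<^bsub>S\<^esub>"
    and "f \<in> carrier R \<Longrightarrow> h (r \<odot>\<^bsub>R\<^esub> f) = r \<odot>\<^bsub>S\<^esub> h f"
    and "f \<in> homog R i \<Longrightarrow> h f \<in> homog S i"
proof -
  have h: "h \<in> ring_hom R S" and 2: "\<forall>r. \<forall>x\<in>carrier R. h (r \<odot>\<^bsub>R\<^esub> x) = r \<odot>\<^bsub>S\<^esub> h x"
    and 3: "\<forall>i. h ` homog R i \<subseteq> homog S i"
    using assms by (auto simp: superalg_hom_def)
  show "f \<in> carrier R \<Longrightarrow> h f \<in> carrier S" by (rule ring_hom_closed[OF h])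
  show "f \<in> carrier R \<Longrightarrow> k \<in> carrier R \<Longrightarrow> h (f \<otimes>\<^bsub>R\<^esub> k) = h f \<otimes>\<^bsub>S\<^esub> h k" by (rule ring_hom_mult[OF h])
  show "f \<in> carrier R \<Longrightarrow> k \<in> carrier R \<Longrightarrow> h (f \<oplus>\<^bsub>R\<^esub> k) = h f \<oplus>\<^bsub>S\<^esub> h k" by (rule ring_hom_add[OF h])
  show "h \<one>\<^bsub>R\<^esub> = \<one>\<^bsub>S\<^esub>" by (rule ring_hom_one[OF h])
  show "f \<in> carrier R \<Longrightarrow> h (r \<odot>\<^bsub>R\<^esub> f) = r \<odot>\<^bsub>S\<^esub> h f" using 2 by simp
  show "f \<in> homog R i \<Longrightarrow> h f \<in> homog S i" using 3 by blast
qed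

lemma superalg_hom_comp:
  assumes "h \<in> superalg_hom R S" "k \<in> superalg_hom S T"
  shows "(\<lambda>f. k (h f)) \<in> superalg_hom R T"
proof -
  have "h \<in> ring_hom R S" "k \<in> ring_hom S T"
    using assms by (simp_all add: superalg_hom_def)
  then have "k \<circ> h \<in> ring_hom R T"
    by (rule ring_hom_trans)
  moreover have "k (h (r \<odot>\<^bsub>R\<^esub> x)) = r \<odot>\<^bsub>T\<^esub> k (h x)" if "x \<in> carrier R" for r x
    using that superalg_homD(1,5)[OF assms(1)] superalg_homD(5)[OF assms(2)] by simp
  moreover have "k (h x) \<in> homog T i" if "x \<in> homog R i" for x i
    using that superalg_homD(6)[OF assms(1)] superalg_homD(6)[OF assms(2)] by simp
  ultimately show ?thesis
    by (auto simp: superalg_hom_def o_def)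
qed

lemma superalgebraD:
  assumes "superalgebra R"
  shows "Ring.ring R" "Module.module real_ring R"
    and "submodule (homog R i) real_ring R"
    and "x \<in> carrier R \<Longrightarrow> \<exists>x0\<in>homog R 0. \<exists>x1\<in>homog R 1. x = x0 \<oplus>\<^bsub>R\<^esub> x1"
proof -
  note c = assms[unfolded superalgebra_def]
  note c2 = c[THEN conjunct2, THEN conjunct2, THEN conjunct2]
  show "Ring.ring R" by (rule c[THEN conjunct1])
  show "Module.module real_ring R" by (rule c[THEN conjunct2, THEN conjunct1])
  show "submodule (homog R i) real_ring R" by (rule c2[THEN conjunct1, THEN spec])
  show "x \<in> carrier R \<Longrightarrow> \<exists>x0\<in>homog R 0. \<exists>x1\<in>homog R 1. x = x0 \<oplus>\<^bsub>R\<^esub> x1"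
    by (rule bspec[OF c2[THEN conjunct2, THEN conjunct2, THEN conjunct1]])
qed

lemma superalgebra_smult_closed:
  assumes "superalgebra R" "x \<in> carrier R"
  shows "r \<odot>\<^bsub>R\<^esub> x \<in> carrier R"
proof -
  interpret Module.module real_ring R using superalgebraD(2)[OF assms(1)] .
  show ?thesis using assms by (simp add: real_ring_def)
qed

lemma homog_subset_carrier: "superalgebra R \<Longrightarrow> homog R i \<subseteq> carrier R"
  by (rule module.submoduleE(1)[OF superalgebraD(2,3)])

lemma wedge_sign_empty [simp]: "wedge_sign {} J = 1" "wedge_sign I {} = 1"
  by (auto simp: wedge_sign_def)

declare One_nat_def [simp del]

section \<open>Superfunctions with one odd coordinate as pairs of smooth functions\<close>

context
  fixes V :: "(real ^ 'n::finite) set"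
begin

abbreviation sd where "sd \<equiv> superdomain 1 V"

lemma sd_simps:
  "(h \<otimes>\<^bsub>sd\<^esub> k) x {} = h x {} * k x {}"
  "(h \<otimes>\<^bsub>sd\<^esub> k) x {0} = h x {} * k x {0} + h x {0} * k x {}"
  "(h \<oplus>\<^bsub>sd\<^esub> k) x I = h x I + k x I"
  "\<zero>\<^bsub>sd\<^esub> x I = 0"
  "\<one>\<^bsub>sd\<^esub> x I = (if x \<in> V \<and> I = {} then 1 else 0)"
  "(r \<odot>\<^bsub>sd\<^esub> h) x I = r * h x I"
proof -
  have "Pow {0::nat} = {{}, {0}}" by (auto simp: Pow_insert)
  then show "(h \<otimes>\<^bsub>sd\<^esub> k) x {0} = h x {} * k x {0} + h x {0} * k x {}"
    by (simp add: superdomain_def)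
qed (simp_all add: superdomain_def)

lemma subset_1: "I \<subseteq> {..<1::nat} \<longleftrightarrow> I = {} \<or> I = {0}"
  by (auto simp: lessThan_Suc)

lemma sd_carrier_outside: "h \<in> carrier sd \<Longrightarrow> x \<notin> V \<or> (I \<noteq> {} \<and> I \<noteq> {0}) \<Longrightarrow> h x I = 0"
  unfolding superdomain_def using subset_1 by auto

lemma sd_carrier_smooth: "h \<in> carrier sd \<Longrightarrow> smooth_on V (\<lambda>x. h x I)"
  by (simp add: superdomain_def)

definition sf_pair :: "(real ^ 'n \<Rightarrow> real) \<Rightarrow> (real ^ 'n \<Rightarrow> real) \<Rightarrow> real ^ 'n \<Rightarrow> nat set \<Rightarrow> real"
  where "sf_pair u w = (\<lambda>x I. if x \<in> V then if I = {} then u x else if I = {0} then w x else 0 else 0)"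

lemma sf_pair_simps:
  "x \<in> V \<Longrightarrow> sf_pair u w x {} = u x" "x \<in> V \<Longrightarrow> sf_pair u w x {0} = w x" "x \<notin> V \<Longrightarrow> sf_pair u w x I = 0"
  by (auto simp: sf_pair_def)

lemma sf_pair_cong:
  "(\<And>x. x \<in> V \<Longrightarrow> u x = u' x) \<Longrightarrow> (\<And>x. x \<in> V \<Longrightarrow> w x = w' x) \<Longrightarrow> sf_pair u w = sf_pair u' w'"
  by (auto simp: sf_pair_def fun_eq_iff)

lemma sf_pair_carrier:
  assumes "open V" "smooth_on V u" "smooth_on V w"
  shows "sf_pair u w \<in> carrier sd"
proof -
  have "smooth_on V (\<lambda>x. sf_pair u w x I)" for I
    by (subst smooth_on_cong[OF assms(1), where g = "if I = {} then u else if I = {0} then w else (\<lambda>x. 0)"])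
      (auto simp: sf_pair_def assms smooth_on_const)
  moreover have "\<forall>x I. sf_pair u w x I \<noteq> 0 \<longrightarrow> x \<in> V \<and> I \<subseteq> {..<1}"
    unfolding subset_1 by (auto simp: sf_pair_def)
  ultimately show ?thesis by (simp add: superdomain_def)
qed

lemma sd_homogD: "h \<in> homog sd i \<Longrightarrow> h x I \<noteq> 0 \<Longrightarrow> of_nat (card I) = i"
  by (simp add: superdomain_def)

lemma sd_homog_1: "h \<in> homog sd 1 \<Longrightarrow> h x {} = 0"
  using sd_homogD[of h 1 x "{}"] by auto

lemma sd_homog_0: "h \<in> homog sd 0 \<Longrightarrow> h x {0} = 0"
  using sd_homogD[of h 0 x "{0}"] by auto

lemma sd_unit_nonzero:
  assumes "h \<in> Units sd" "x \<in> V"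
  shows "h x {} \<noteq> 0"
proof -
  obtain k where "h \<otimes>\<^bsub>sd\<^esub> k = \<one>\<^bsub>sd\<^esub>" using assms(1) by (auto simp: Units_def)
  then have "h x {} * k x {} = 1" using assms(2) sd_simps(1)[of h k x] by (simp add: sd_simps)
  then show ?thesis by auto
qed

lemma sd_mult_carrier:
  assumes "open V" "h \<in> carrier sd" "k \<in> carrier sd"
  shows "h \<otimes>\<^bsub>sd\<^esub> k = sf_pair (\<lambda>x. h x {} * k x {}) (\<lambda>x. h x {} * k x {0} + h x {0} * k x {})"
proof (intro ext)
  fix x I
  show "(h \<otimes>\<^bsub>sd\<^esub> k) x I = sf_pair (\<lambda>x. h x {} * k x {}) (\<lambda>x. h x {} * k x {0} + h x {0} * k x {}) x I"
  proof (cases "x \<in> V \<and> (I = {} \<or> I = {0})")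
    case True
    then show ?thesis by (auto simp: sd_simps sf_pair_simps)
  next
    case False
    \<comment> \<open>If both factors were nonzero, J and its complement in I would be disjoint sets
      among {} and {0}; then I would be one of these two as well.\<close>
    have hk: "h x J = 0 \<or> k x (I - J) = 0" if "J \<subseteq> I" for J
    proof (rule ccontr)
      assume "\<not> (h x J = 0 \<or> k x (I - J) = 0)"
      then have "x \<in> V" and "J = {} \<or> J = {0}" and "I - J = {} \<or> I - J = {0}"
        using sd_carrier_outside[OF assms(2), of x J] sd_carrier_outside[OF assms(3), of x "I - J"] by auto
      moreover have "I = J \<union> (I - J)" using that by auto
      ultimately show False using False by (metis Un_empty_left Un_empty_right Un_absorb)
    qed
    have "(\<Sum>J\<in>Pow I. wedge_sign J (I - J) * h x J * k x (I - J)) = 0"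
      by (intro sum.neutral ballI) (use hk in auto)
    then have "(h \<otimes>\<^bsub>sd\<^esub> k) x I = 0"
      by (simp add: superdomain_def)
    then show ?thesis using False by (auto simp: sf_pair_def)
  qed
qed

text \<open>The odd part is nilpotent: with nowhere vanishing u, the inverse of u + w\<theta> is 1/u
  - (w/u^2)\<theta>.\<close>

lemma sd_UnitsI:
  assumes "open V" "h \<in> carrier sd" "\<And>x. x \<in> V \<Longrightarrow> h x {} \<noteq> 0"
  shows "h \<in> Units sd"
proof -
  define k where "k = sf_pair (\<lambda>x. inverse (h x {})) (\<lambda>x. (- 1) * (h x {0} * (inverse (h x {}) * inverse (h x {}))))"
  have k: "k \<in> carrier sd" unfolding k_def
    by (intro sf_pair_carrier smooth_on_inverse smooth_on_mult smooth_on_const sd_carrier_smooth assms)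
  have one: "\<one>\<^bsub>sd\<^esub> = sf_pair (\<lambda>x. 1) (\<lambda>x. 0)"
    by (auto simp: superdomain_def sf_pair_def fun_eq_iff)
  have kx: "k x {} = inverse (h x {})" "k x {0} = - (h x {0} * (inverse (h x {}) * inverse (h x {})))" if "x \<in> V" for x
    using that by (simp_all add: k_def sf_pair_simps)
  have "h \<otimes>\<^bsub>sd\<^esub> k = \<one>\<^bsub>sd\<^esub>" "k \<otimes>\<^bsub>sd\<^esub> h = \<one>\<^bsub>sd\<^esub>"
    unfolding one sd_mult_carrier[OF assms(1,2) k] sd_mult_carrier[OF assms(1) k assms(2)]
    by (rule sf_pair_cong; use assms(3) in \<open>simp add: kx\<close>)+
  then show ?thesis using assms(2) k by (auto simp: Units_def)
qed

end

section \<open>Supermanifolds with one odd direction\<close>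

text \<open>The property of Q extracted from a Shander chart: in Qf = \<partial>f/\<partial>\<tau> +
  \<tau> \<partial>f/\<partial>t the second summand has no part of degree 0, so the degree 0 part of
  Qf is the \<tau>-coefficient of f.\<close>

definition Q_chart ::
  "('p, 'f) superspace \<Rightarrow> ('f \<Rightarrow> 'f) \<Rightarrow> 'p set \<Rightarrow> (real ^ 'n::finite) set \<Rightarrow> ('p \<Rightarrow> real ^ 'n)
     \<Rightarrow> ('p set \<Rightarrow> 'f \<Rightarrow> 'n superfun) \<Rightarrow> bool"
  where "Q_chart M Q U V \<phi> \<Phi> \<longleftrightarrow> super_chart M 1 U V \<phi> \<Phi> \<and>
    (\<forall>f\<in>carrier (Cinf M). \<forall>x. \<Phi> U (restr M (topspace (body M)) U (Q f)) x {} =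
       \<Phi> U (restr M (topspace (body M)) U f) x {0})"

locale odd_line_manifold =
  fixes N :: "'n::finite itself" and M :: "('p, 'f) superspace" and Q :: "'f \<Rightarrow> 'f"
  assumes supermanifold: "supermanifold N 1 M"
    and Q: "Q \<in> Vect_homog M 1"
    and Q_chart_ex: "m \<in> topspace (body M) \<Longrightarrow> \<exists>U (V :: (real ^ 'n) set) \<phi> \<Phi>. m \<in> U \<and> Q_chart M Q U V \<phi> \<Phi>"
begin

abbreviation T where "T \<equiv> body M"
abbreviation X where "X \<equiv> topspace (body M)"
abbreviation A where "A \<equiv> Cinf M"
abbreviation res where "res \<equiv> restr M (topspace (body M))"
abbreviation is_chart where "is_chart U (V :: (real ^ 'n) set) \<phi> \<Phi> \<equiv> Q_chart M Q U V \<phi> \<Phi>"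
abbreviation S where "S \<equiv> sections M"

lemma sheaf: "superalgebra_sheaf M" and Hausdorff: "Hausdorff_space T"
  using supermanifold by (auto simp: supermanifold_def)

lemma superalgebra_S: "openin T U \<Longrightarrow> superalgebra (S U)"
  and restr_hom: "openin T U \<Longrightarrow> openin T V \<Longrightarrow> V \<subseteq> U \<Longrightarrow> restr M U V \<in> superalg_hom (S U) (S V)"
  and restr_id: "openin T U \<Longrightarrow> f \<in> carrier (S U) \<Longrightarrow> restr M U U f = f"
  and restr_restr: "openin T U \<Longrightarrow> openin T V \<Longrightarrow> openin T W \<Longrightarrow> W \<subseteq> V \<Longrightarrow> V \<subseteq> U \<Longrightarrow> f \<in> carrier (S U) \<Longrightarrow>
    restr M V W (restr M U V f) = restr M U W f"
proof -
  note c = sheaf[unfolded superalgebra_sheaf_def]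
  show "openin T U \<Longrightarrow> superalgebra (S U)"
    using c[THEN conjunct1] by blast
  show "openin T U \<Longrightarrow> openin T V \<Longrightarrow> V \<subseteq> U \<Longrightarrow> restr M U V \<in> superalg_hom (S U) (S V)"
    using c[THEN conjunct2, THEN conjunct1] by blast
  show "openin T U \<Longrightarrow> f \<in> carrier (S U) \<Longrightarrow> restr M U U f = f"
    using c[THEN conjunct2, THEN conjunct2, THEN conjunct1] by blast
  show "openin T U \<Longrightarrow> openin T V \<Longrightarrow> openin T W \<Longrightarrow> W \<subseteq> V \<Longrightarrow> V \<subseteq> U \<Longrightarrow> f \<in> carrier (S U) \<Longrightarrow>
      restr M V W (restr M U V f) = restr M U W f"
    using c[THEN conjunct2, THEN conjunct2, THEN conjunct2, THEN conjunct1] by blast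
qed

lemma gluing:
  assumes "\<And>U. U \<in> \<U> \<Longrightarrow> openin T U" "\<And>U. U \<in> \<U> \<Longrightarrow> s U \<in> carrier (S U)"
    and "\<And>U V. U \<in> \<U> \<Longrightarrow> V \<in> \<U> \<Longrightarrow> restr M U (U \<inter> V) (s U) = restr M V (U \<inter> V) (s V)"
  shows "\<exists>!f. f \<in> carrier (S (\<Union>\<U>)) \<and> (\<forall>U\<in>\<U>. restr M (\<Union>\<U>) U f = s U)"
proof -
  note c = sheaf[unfolded superalgebra_sheaf_def, THEN conjunct2, THEN conjunct2, THEN conjunct2, THEN conjunct2]
  show ?thesis using assms by (intro c[rule_format, of \<U> s]) blast
qed

lemma superalgebra_A: "superalgebra A"
  unfolding Cinf_def by (rule superalgebra_S) simp

lemma ring_A: "Ring.ring A"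
  by (rule superalgebraD(1)[OF superalgebra_A])

lemma res_hom: "openin T U \<Longrightarrow> res U \<in> superalg_hom A (S U)"
  unfolding Cinf_def by (intro restr_hom) (auto dest: openin_subset)

lemma res_X: "f \<in> carrier A \<Longrightarrow> res X f = f"
  unfolding Cinf_def by (rule restr_id) auto

lemma restr_res: "openin T V \<Longrightarrow> openin T W \<Longrightarrow> W \<subseteq> V \<Longrightarrow> f \<in> carrier A \<Longrightarrow> restr M V W (res V f) = res W f"
  unfolding Cinf_def by (intro restr_restr) (auto dest: openin_subset)

text \<open>The uniqueness half of gluing, applied to the cover of W by all open sets on which the
  two sections agree.\<close>

lemma sections_eqI:
  assumes "openin T W" "f \<in> carrier (S W)" "f' \<in> carrier (S W)"
    and "\<And>m. m \<in> W \<Longrightarrow> \<exists>U. openin T U \<and> m \<in> U \<and> U \<subseteq> W \<and> restr M W U f = restr M W U f'"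
  shows "f = f'"
proof -
  define \<U> where "\<U> = {U. openin T U \<and> U \<subseteq> W \<and> restr M W U f = restr M W U f'}"
  have W: "\<Union>\<U> = W" using assms(4) by (fastforce simp: \<U>_def)
  have "\<exists>!h. h \<in> carrier (S (\<Union>\<U>)) \<and> (\<forall>U\<in>\<U>. restr M (\<Union>\<U>) U h = restr M W U f)"
  proof (rule gluing)
    fix U V assume UV: "U \<in> \<U>" "V \<in> \<U>"
    then have "openin T (U \<inter> V)" by (auto simp: \<U>_def)
    then show "restr M U (U \<inter> V) (restr M W U f) = restr M V (U \<inter> V) (restr M W V f)"
      using UV restr_restr[OF assms(1) _ _ Int_lower1 _ assms(2), of U V] restr_restr[OF assms(1) _ _ Int_lower2 _ assms(2), of V U]
      by (auto simp: \<U>_def)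
  next
    fix U assume "U \<in> \<U>"
    then show "restr M W U f \<in> carrier (S U)"
      by (intro superalg_homD(1)[OF restr_hom[OF assms(1)] assms(2)]) (simp_all add: \<U>_def)
  qed (simp add: \<U>_def)
  moreover have "\<forall>U\<in>\<U>. restr M W U f' = restr M W U f" by (auto simp: \<U>_def)
  ultimately show ?thesis unfolding W using assms(2,3) by blast
qed

section \<open>Charts, invertibility and values of functions\<close>

context
  fixes U V \<phi> \<Phi>
  assumes chart: "is_chart U V \<phi> \<Phi>"
begin

lemma U_open: "openin T U" and V_open: "open V"
  and \<phi>_homeo: "homeomorphic_map (subtopology T U) (top_of_set V) \<phi>"
  using chart unfolding Q_chart_def super_chart_def by auto

lemma U_X: "U \<subseteq> X" using U_open by (rule openin_subset)

lemma topspace_U: "topspace (subtopology T U) = U"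
  using U_X by auto

lemma \<phi>_U: "\<phi> ` U = V" and \<phi>_inj: "inj_on \<phi> U"
  using homeomorphic_imp_surjective_map[OF \<phi>_homeo] homeomorphic_imp_injective_map[OF \<phi>_homeo] topspace_U by auto

lemma \<phi>_open: "openin T W \<Longrightarrow> W \<subseteq> U \<Longrightarrow> open (\<phi> ` W)"
proof -
  assume W: "openin T W" "W \<subseteq> U"
  then have "openin (subtopology T U) W"
    by (auto simp: openin_subtopology)
  then have "openin (top_of_set V) (\<phi> ` W)"
    using homeomorphic_imp_open_map[OF \<phi>_homeo] by (simp add: open_map_def)
  then show ?thesis using V_open openin_open_trans by blast
qed

lemma \<phi>_preimage_open: "open B \<Longrightarrow> openin T {m\<in>U. \<phi> m \<in> B}"
proof -
  assume "open B"
  then have "openin (top_of_set V) (V \<inter> B)" by (auto simp: openin_open)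
  then have "openin (subtopology T U) {m \<in> topspace (subtopology T U). \<phi> m \<in> V \<inter> B}"
    using homeomorphic_imp_continuous_map[OF \<phi>_homeo] by (rule openin_continuous_map_preimage[rotated])
  then have "openin (subtopology T U) {m \<in> U. \<phi> m \<in> V \<inter> B}"
    by (simp only: topspace_U)
  then have "openin T {m \<in> U. \<phi> m \<in> V \<inter> B}"
    using openin_trans_full U_open by blast
  moreover have "{m \<in> U. \<phi> m \<in> V \<inter> B} = {m \<in> U. \<phi> m \<in> B}" using \<phi>_U by auto
  ultimately show ?thesis by simp
qed

text \<open>Compact sets in a chart stay compact in |M|, and are closed there because |M| is
  Hausdorff. This makes extension by zero possible.\<close>

lemma \<phi>_preimage_compact: "compact K \<Longrightarrow> K \<subseteq> V \<Longrightarrow> closedin T {m\<in>U. \<phi> m \<in> K}"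
proof -
  assume K: "compact K" "K \<subseteq> V"
  obtain \<psi> where \<psi>: "homeomorphic_maps (subtopology T U) (top_of_set V) \<phi> \<psi>"
    using \<phi>_homeo homeomorphic_map_maps by blast
  then have "continuous_map (top_of_set V) (subtopology T U) \<psi>"
    by (simp add: homeomorphic_maps_def)
  moreover have "compactin (top_of_set V) K"
    using K by (simp add: compactin_subtopology)
  ultimately have "compactin (subtopology T U) (\<psi> ` K)"
    using image_compactin by blast
  moreover have "\<psi> ` K = {m\<in>U. \<phi> m \<in> K}"
  proof -
    have "\<psi> x \<in> U \<and> \<phi> (\<psi> x) = x" if "x \<in> V" for x
      using \<psi> that continuous_map_image_subset_topspace[of "top_of_set V" "subtopology T U" \<psi>]
      by (auto simp: homeomorphic_maps_def)
    moreover have "\<psi> (\<phi> m) = m" if "m \<in> U" for m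
      using \<psi> that U_X by (auto simp: homeomorphic_maps_def)
    ultimately show ?thesis using K by force
  qed
  ultimately have "compactin T {m\<in>U. \<phi> m \<in> K}"
    by (simp add: compactin_subtopology)
  then show ?thesis using compactin_imp_closedin Hausdorff by blast
qed

lemma \<Phi>_hom: "openin T W \<Longrightarrow> W \<subseteq> U \<Longrightarrow> \<Phi> W \<in> superalg_hom (S W) (superdomain 1 (\<phi> ` W))"
  and \<Phi>_bij: "openin T W \<Longrightarrow> W \<subseteq> U \<Longrightarrow> bij_betw (\<Phi> W) (carrier (S W)) (carrier (superdomain 1 (\<phi> ` W)))"
  and \<Phi>_restr: "openin T W \<Longrightarrow> openin T W' \<Longrightarrow> W' \<subseteq> W \<Longrightarrow> W \<subseteq> U \<Longrightarrow> f \<in> carrier (S W) \<Longrightarrow>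
    \<Phi> W' (restr M W W' f) = sf_restrict (\<phi> ` W') (\<Phi> W f)"
  using chart unfolding Q_chart_def super_chart_def superalg_iso_def by auto

definition loc where "loc f = \<Phi> U (res U f)"

lemma loc_hom: "loc \<in> superalg_hom A (superdomain 1 V)"
  unfolding loc_def[abs_def] using superalg_hom_comp[OF res_hom[OF U_open] \<Phi>_hom[OF U_open]] \<phi>_U by simp

lemmas locD = superalg_homD[OF loc_hom]

lemma loc_diff:
  assumes "f \<in> carrier A" "k \<in> carrier A"
  shows "loc (f \<ominus>\<^bsub>A\<^esub> k) x I = loc f x I - loc k x I"
proof -
  interpret ring A by (rule ring_A)
  have "loc ((f \<ominus>\<^bsub>A\<^esub> k) \<oplus>\<^bsub>A\<^esub> k) x I = loc (f \<ominus>\<^bsub>A\<^esub> k) x I + loc k x I"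
    using assms locD(3)[of "f \<ominus>\<^bsub>A\<^esub> k" k] by (simp add: sd_simps)
  moreover have "(f \<ominus>\<^bsub>A\<^esub> k) \<oplus>\<^bsub>A\<^esub> k = f" using assms by algebra
  ultimately show ?thesis by simp
qed

lemma loc_zero: "loc \<zero>\<^bsub>A\<^esub> x I = 0"
proof -
  interpret ring A by (rule ring_A)
  have "loc (\<zero>\<^bsub>A\<^esub> \<ominus>\<^bsub>A\<^esub> \<zero>\<^bsub>A\<^esub>) x I = loc \<zero>\<^bsub>A\<^esub> x I - loc \<zero>\<^bsub>A\<^esub> x I"
    by (rule loc_diff) auto
  then show ?thesis by (simp add: minus_eq)
qed

lemma \<Phi>_res: "openin T W \<Longrightarrow> W \<subseteq> U \<Longrightarrow> f \<in> carrier A \<Longrightarrow> \<Phi> W (res W f) = sf_restrict (\<phi> ` W) (loc f)"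
  using \<Phi>_restr[OF U_open, of W "res U f"] restr_res[OF U_open, of W f] superalg_homD(1)[OF res_hom[OF U_open], of f]
  by (simp add: loc_def)

text \<open>The chart isomorphism preserves units, and in the superdomain the degree 0 coefficient
  decides invertibility.\<close>

lemma res_unit_iff:
  assumes W: "openin T W" "W \<subseteq> U" and f: "f \<in> carrier A"
  shows "res W f \<in> Units (S W) \<longleftrightarrow> (\<forall>m\<in>W. loc f (\<phi> m) {} \<noteq> 0)"
proof
  let ?sd = "superdomain 1 (\<phi> ` W)"
  note h = superalg_homD[OF \<Phi>_hom[OF W]]
  have fW: "res W f \<in> carrier (S W)" using superalg_homD(1)[OF res_hom[OF W(1)] f] .
  {
    assume "res W f \<in> Units (S W)"
    then obtain k where k: "k \<in> carrier (S W)" "res W f \<otimes>\<^bsub>S W\<^esub> k = \<one>\<^bsub>S W\<^esub>" "k \<otimes>\<^bsub>S W\<^esub> res W f = \<one>\<^bsub>S W\<^esub>"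
      by (auto simp: Units_def)
    then have "\<Phi> W (res W f) \<otimes>\<^bsub>?sd\<^esub> \<Phi> W k = \<one>\<^bsub>?sd\<^esub>" "\<Phi> W k \<otimes>\<^bsub>?sd\<^esub> \<Phi> W (res W f) = \<one>\<^bsub>?sd\<^esub>"
      using h(2)[OF fW, of k] h(2)[of k, OF _ fW] h(4) by metis+
    then have "\<Phi> W (res W f) \<in> Units ?sd"
      using h(1) k(1) fW by (auto simp: Units_def)
    then have "\<Phi> W (res W f) (\<phi> m) {} \<noteq> 0" if "m \<in> W" for m
      using that by (intro sd_unit_nonzero) auto
    then show "\<forall>m\<in>W. loc f (\<phi> m) {} \<noteq> 0"
      by (simp add: \<Phi>_res[OF W f] sf_restrict_def)
  }
  {
    assume "\<forall>m\<in>W. loc f (\<phi> m) {} \<noteq> 0"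
    then have "\<Phi> W (res W f) x {} \<noteq> 0" if "x \<in> \<phi> ` W" for x
      using that by (auto simp: \<Phi>_res[OF W f] sf_restrict_def)
    then have "\<Phi> W (res W f) \<in> Units ?sd"
      using \<phi>_open[OF W] h(1)[OF fW] by (intro sd_UnitsI)
    then obtain k where k: "k \<in> carrier ?sd" "\<Phi> W (res W f) \<otimes>\<^bsub>?sd\<^esub> k = \<one>\<^bsub>?sd\<^esub>" "k \<otimes>\<^bsub>?sd\<^esub> \<Phi> W (res W f) = \<one>\<^bsub>?sd\<^esub>"
      by (auto simp: Units_def)
    obtain k' where k': "k' \<in> carrier (S W)" "\<Phi> W k' = k"
      using \<Phi>_bij[OF W] k(1) by (metis bij_betw_imp_surj_on imageE)
    interpret ring "S W" by (rule superalgebraD(1)[OF superalgebra_S[OF W(1)]])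
    have "\<Phi> W (res W f \<otimes>\<^bsub>S W\<^esub> k') = \<Phi> W \<one>\<^bsub>S W\<^esub>" "\<Phi> W (k' \<otimes>\<^bsub>S W\<^esub> res W f) = \<Phi> W \<one>\<^bsub>S W\<^esub>"
      using h(2,4) k k' fW by simp_all
    then have "res W f \<otimes>\<^bsub>S W\<^esub> k' = \<one>\<^bsub>S W\<^esub>" "k' \<otimes>\<^bsub>S W\<^esub> res W f = \<one>\<^bsub>S W\<^esub>"
      using inj_onD[OF bij_betw_imp_inj_on[OF \<Phi>_bij[OF W]]] k' fW by simp_all
    then show "res W f \<in> Units (S W)" using k' fW by (auto simp: Units_def)
  }
qed

text \<open>The function f - r is invertible near m exactly when the degree 0 coefficient of f at m
  differs from r, so the intrinsic value is that coefficient.\<close>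

lemma fun_value_loc:
  assumes f: "f \<in> carrier A" and m: "m \<in> U"
  shows "fun_value M m f = loc f (\<phi> m) {}"
  unfolding fun_value_def
proof (rule the_equality)
  interpret ring A by (rule ring_A)
  have c: "r \<odot>\<^bsub>A\<^esub> \<one>\<^bsub>A\<^esub> \<in> carrier A" for r
    by (intro superalgebra_smult_closed superalgebra_A) simp
  have k: "f \<ominus>\<^bsub>A\<^esub> (r \<odot>\<^bsub>A\<^esub> \<one>\<^bsub>A\<^esub>) \<in> carrier A" for r using f c by simp
  have val: "loc (f \<ominus>\<^bsub>A\<^esub> (r \<odot>\<^bsub>A\<^esub> \<one>\<^bsub>A\<^esub>)) (\<phi> m') {} = loc f (\<phi> m') {} - r" if "m' \<in> U" for r m'
    using f c that \<phi>_U locD(4) locD(5)[of "\<one>\<^bsub>A\<^esub>" r] by (auto simp: loc_diff sd_simps)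
  let ?P = "\<lambda>r. \<forall>U. openin T U \<and> m \<in> U \<longrightarrow> res U (f \<ominus>\<^bsub>A\<^esub> (r \<odot>\<^bsub>A\<^esub> \<one>\<^bsub>A\<^esub>)) \<notin> Units (S U)"
  show "?P (loc f (\<phi> m) {})"
  proof (intro allI impI notI)
    fix U' assume U': "openin T U' \<and> m \<in> U'" and
      u: "res U' (f \<ominus>\<^bsub>A\<^esub> (loc f (\<phi> m) {} \<odot>\<^bsub>A\<^esub> \<one>\<^bsub>A\<^esub>)) \<in> Units (S U')" (is "res U' ?k \<in> _")
    \<comment> \<open>The neighbourhood U' need not lie in the chart. A unit over U' restricts to a
      unit over the intersection, where the chart sees the zero at m.\<close>
    let ?W = "U' \<inter> U"
    have W: "openin T ?W" "?W \<subseteq> U" "?W \<subseteq> U'" using U' U_open by auto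
    obtain i where i: "i \<in> carrier (S U')" "res U' ?k \<otimes>\<^bsub>S U'\<^esub> i = \<one>\<^bsub>S U'\<^esub>" "i \<otimes>\<^bsub>S U'\<^esub> res U' ?k = \<one>\<^bsub>S U'\<^esub>"
      using u by (auto simp: Units_def)
    have kU: "res U' ?k \<in> carrier (S U')" using superalg_homD(1)[OF res_hom k] U' by blast
    note h = superalg_homD[OF restr_hom[OF _ W(1) W(3)]]
    have "restr M U' ?W (res U' ?k) \<in> Units (S ?W)"
      using h(1)[OF _ i(1)] h(1)[OF _ kU] h(2)[OF _ kU i(1)] h(2)[OF _ i(1) kU] h(4) i U'
      by (auto simp: Units_def)
    then have "res ?W ?k \<in> Units (S ?W)"
      using restr_res[OF _ W(1) W(3) k] U' by simp
    then have "loc ?k (\<phi> m) {} \<noteq> 0" using res_unit_iff[OF W(1,2) k] U' m by blast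
    then show False using val[OF m] by simp
  qed
  fix r assume P: "?P r"
  show "r = loc f (\<phi> m) {}"
  proof (rule ccontr)
    assume ne: "r \<noteq> loc f (\<phi> m) {}"
    \<comment> \<open>Open by continuity of the coefficient, and over its preimage f - r is
      invertible.\<close>
    let ?B = "{x\<in>V. loc f x {} \<noteq> r}"
    have "continuous_on V (\<lambda>x. loc f x {})"
      by (rule smooth_on_continuous[OF sd_carrier_smooth[OF locD(1)[OF f]]])
    then have "open (V \<inter> (\<lambda>x. loc f x {}) -` (- {r}))"
      by (intro continuous_open_preimage V_open) auto
    then have "open ?B" by (simp add: vimage_def Int_def)
    then have W: "openin T {m\<in>U. \<phi> m \<in> ?B}" by (rule \<phi>_preimage_open)
    moreover have "m \<in> {m\<in>U. \<phi> m \<in> ?B}" using m ne \<phi>_U by auto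
    ultimately have "res {m\<in>U. \<phi> m \<in> ?B} (f \<ominus>\<^bsub>A\<^esub> (r \<odot>\<^bsub>A\<^esub> \<one>\<^bsub>A\<^esub>)) \<notin> Units (S {m\<in>U. \<phi> m \<in> ?B})"
      using P by blast
    moreover have "\<forall>m'\<in>{m\<in>U. \<phi> m \<in> ?B}. loc (f \<ominus>\<^bsub>A\<^esub> (r \<odot>\<^bsub>A\<^esub> \<one>\<^bsub>A\<^esub>)) (\<phi> m') {} \<noteq> 0"
      using val by auto
    ultimately show False using res_unit_iff[OF W _ k] by blast
  qed
qed

end

end

section \<open>The two coefficients of a global function\<close>

context odd_line_manifold begin

lemma Q_closed: "f \<in> carrier A \<Longrightarrow> Q f \<in> carrier A"
  using Q by (auto simp: Vect_homog_def)

text \<open>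
  \<open>e1 f\<close> is the coefficient of $\tau$ in \<open>f\<close>: if $f = f_0 + f_1\tau$, then $Qf_0$ is odd and $Q(f_1\tau)$ has value $f_1$.
\<close>

definition e0 :: "'f \<Rightarrow> 'p \<Rightarrow> real" where "e0 f = (\<lambda>m. if m \<in> X then fun_value M m f else 0)"
definition e1 :: "'f \<Rightarrow> 'p \<Rightarrow> real" where "e1 f = e0 (Q f)"

lemma e_outside: "m \<notin> X \<Longrightarrow> e0 f m = 0" "m \<notin> X \<Longrightarrow> e1 f m = 0"
  by (simp_all add: e0_def e1_def)

text \<open>As \<open>e0\<close> and \<open>e1\<close> refer to no chart, the coefficient of
  \<theta> is the same in all these charts: the local odd coordinates fit together.\<close>

lemma e_loc:
  assumes "is_chart U V \<phi> \<Phi>" "f \<in> carrier A" "m \<in> U"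
  shows "e0 f m = loc U \<Phi> f (\<phi> m) {}" "e1 f m = loc U \<Phi> f (\<phi> m) {0}"
proof -
  have m: "m \<in> X" using U_X[OF assms(1)] assms(3) by auto
  show "e0 f m = loc U \<Phi> f (\<phi> m) {}"
    using m fun_value_loc[OF assms] by (simp add: e0_def)
  have "loc U \<Phi> (Q f) (\<phi> m) {} = loc U \<Phi> f (\<phi> m) {0}"
    using assms(1,2) by (simp add: Q_chart_def loc_def[OF assms(1)])
  then show "e1 f m = loc U \<Phi> f (\<phi> m) {0}"
    using m fun_value_loc[OF assms(1) Q_closed[OF assms(2)] assms(3)] by (simp add: e0_def e1_def)
qed

text \<open>In each chart a section is determined by its two coefficients. Together with the
  converse \<open>e_eqI\<close> this lets coefficients replace sections in gluing arguments.\<close>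

lemma res_eqI:
  assumes W: "openin T W" and f: "f \<in> carrier A" "f' \<in> carrier A"
    and eq: "\<And>m. m \<in> W \<Longrightarrow> e0 f m = e0 f' m" "\<And>m. m \<in> W \<Longrightarrow> e1 f m = e1 f' m"
  shows "res W f = res W f'"
proof (rule sections_eqI[OF W])
  show "res W f \<in> carrier (S W)" "res W f' \<in> carrier (S W)"
    using superalg_homD(1)[OF res_hom[OF W]] f by blast+
  fix m assume m: "m \<in> W"
  then have "m \<in> X" using openin_subset[OF W] by blast
  then obtain U V \<phi> \<Phi> where mU: "m \<in> U" and chart: "is_chart U V \<phi> \<Phi>"
    using Q_chart_ex by blast
  let ?W = "W \<inter> U"
  have W': "openin T ?W" "?W \<subseteq> U" "?W \<subseteq> W" using W U_open[OF chart] by auto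
  have "loc U \<Phi> f x I = loc U \<Phi> f' x I" if x: "x \<in> \<phi> ` ?W" for x I
  proof -
    obtain m' where m': "m' \<in> W" "m' \<in> U" "x = \<phi> m'" using x by blast
    have "loc U \<Phi> f x {} = loc U \<Phi> f' x {}" "loc U \<Phi> f x {0} = loc U \<Phi> f' x {0}"
      using eq[OF m'(1)] e_loc[OF chart f(1) m'(2)] e_loc[OF chart f(2) m'(2)] m'(3) by simp_all
    moreover have "loc U \<Phi> f x I = 0 \<and> loc U \<Phi> f' x I = 0" if "I \<noteq> {}" "I \<noteq> {0}"
      using that sd_carrier_outside[OF locD(1)[OF chart f(1)], of x I] sd_carrier_outside[OF locD(1)[OF chart f(2)], of x I] by simp
    ultimately show ?thesis by (cases "I = {} \<or> I = {0}") auto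
  qed
  then have "\<Phi> ?W (res ?W f) = \<Phi> ?W (res ?W f')"
    unfolding \<Phi>_res[OF chart W'(1,2) f(1)] \<Phi>_res[OF chart W'(1,2) f(2)]
    by (auto simp: sf_restrict_def fun_eq_iff)
  moreover have "res ?W f \<in> carrier (S ?W)" "res ?W f' \<in> carrier (S ?W)"
    using superalg_homD(1)[OF res_hom[OF W'(1)]] f by blast+
  ultimately have "res ?W f = res ?W f'"
    using \<Phi>_bij[OF chart W'(1,2)] by (metis bij_betw_imp_inj_on inj_onD)
  then show "\<exists>U. openin T U \<and> m \<in> U \<and> U \<subseteq> W \<and> restr M W U (res W f) = restr M W U (res W f')"
    using W' m mU restr_res[OF W W'(1,3)] f by (intro exI[of _ ?W]) auto
qed

lemma e_eqI:
  assumes "openin T W" "m \<in> W" "f \<in> carrier A" "f' \<in> carrier A" "res W f = res W f'"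
  shows "e0 f m = e0 f' m \<and> e1 f m = e1 f' m"
proof -
  have "m \<in> X" using openin_subset[OF assms(1)] assms(2) by blast
  then obtain U V \<phi> \<Phi> where mU: "m \<in> U" and chart: "is_chart U V \<phi> \<Phi>"
    using Q_chart_ex by blast
  let ?W = "W \<inter> U"
  have W': "openin T ?W" "?W \<subseteq> U" "?W \<subseteq> W" using assms(1) U_open[OF chart] by auto
  have "res ?W f = res ?W f'"
    using restr_res[OF assms(1) W'(1,3)] assms(3-5) by metis
  then have "sf_restrict (\<phi> ` ?W) (loc U \<Phi> f) = sf_restrict (\<phi> ` ?W) (loc U \<Phi> f')"
    using \<Phi>_res[OF chart W'(1,2)] assms(3,4) by metis
  then have "sf_restrict (\<phi> ` ?W) (loc U \<Phi> f) (\<phi> m) I = sf_restrict (\<phi> ` ?W) (loc U \<Phi> f') (\<phi> m) I" for I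
    by metis
  then have "loc U \<Phi> f (\<phi> m) I = loc U \<Phi> f' (\<phi> m) I" for I
    using assms(2) mU by (auto simp: sf_restrict_def split: if_splits)
  then show ?thesis using e_loc[OF chart _ mU] assms(3,4) by metis
qed

lemma A_eqI:
  assumes "f \<in> carrier A" "f' \<in> carrier A" "e0 f = e0 f'" "e1 f = e1 f'"
  shows "f = f'"
  using res_eqI[of X f f'] assms res_X by simp

text \<open>The local pieces are global functions with the prescribed coefficients on W; their
  restrictions agree on overlaps because their coefficients do.\<close>

lemma A_glue:
  assumes out: "\<And>m. m \<notin> X \<Longrightarrow> f0 m = 0 \<and> f1 m = 0"
    and "\<And>m. m \<in> X \<Longrightarrow> \<exists>W. openin T W \<and> m \<in> W \<and> (\<exists>a\<in>carrier A. \<forall>m'\<in>W. e0 a m' = f0 m' \<and> e1 a m' = f1 m')"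
  shows "\<exists>a\<in>carrier A. e0 a = f0 \<and> e1 a = f1"
proof -
  define \<U> where "\<U> = {W. openin T W \<and> (\<exists>a\<in>carrier A. \<forall>m'\<in>W. e0 a m' = f0 m' \<and> e1 a m' = f1 m')}"
  have "\<forall>W\<in>\<U>. \<exists>a. a \<in> carrier A \<and> (\<forall>m'\<in>W. e0 a m' = f0 m' \<and> e1 a m' = f1 m')"
    by (auto simp: \<U>_def)
  from bchoice[OF this] obtain a where a: "\<And>W. W \<in> \<U> \<Longrightarrow> a W \<in> carrier A"
    "\<And>W m. W \<in> \<U> \<Longrightarrow> m \<in> W \<Longrightarrow> e0 (a W) m = f0 m \<and> e1 (a W) m = f1 m"
    by blast
  have op: "openin T W" if "W \<in> \<U>" for W using that by (simp add: \<U>_def)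
  have un: "\<Union>\<U> = X"
  proof
    show "\<Union>\<U> \<subseteq> X" using op openin_subset by blast
    show "X \<subseteq> \<Union>\<U>" using assms(2) by (force simp: \<U>_def)
  qed
  have "\<exists>!h. h \<in> carrier (S (\<Union>\<U>)) \<and> (\<forall>W\<in>\<U>. restr M (\<Union>\<U>) W h = res W (a W))"
  proof (rule gluing)
    fix W assume W: "W \<in> \<U>"
    show "openin T W" by (rule op[OF W])
    show "res W (a W) \<in> carrier (S W)"
      by (rule superalg_homD(1)[OF res_hom[OF op[OF W]] a(1)[OF W]])
  next
    fix W W' assume W: "W \<in> \<U>" "W' \<in> \<U>"
    have o: "openin T (W \<inter> W')" using op W by auto
    have "res (W \<inter> W') (a W) = res (W \<inter> W') (a W')"
      by (rule res_eqI[OF o]) (use W a in auto)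
    then show "restr M W (W \<inter> W') (res W (a W)) = restr M W' (W \<inter> W') (res W' (a W'))"
      using restr_res[OF op[OF W(1)] o Int_lower1 a(1)[OF W(1)]] restr_res[OF op[OF W(2)] o Int_lower2 a(1)[OF W(2)]]
      by simp
  qed
  then obtain h where h: "h \<in> carrier A" "\<And>W. W \<in> \<U> \<Longrightarrow> res W h = res W (a W)"
    unfolding un Cinf_def by blast
  have "e0 h m = f0 m \<and> e1 h m = f1 m" for m
  proof (cases "m \<in> X")
    case True
    then obtain W where "m \<in> W" "W \<in> \<U>" using un by blast
    then show ?thesis using e_eqI[OF op _ h(1) a(1) h(2), of W m] a(2)[of W m] by simp
  next
    case False
    then show ?thesis using out e_outside by simp
  qed
  then show ?thesis using h(1) by (intro bexI[of _ h]) auto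
qed

lemma e_zero: "e0 \<zero>\<^bsub>A\<^esub> m = 0" "e1 \<zero>\<^bsub>A\<^esub> m = 0"
proof -
  interpret ring A by (rule ring_A)
  have "e0 \<zero>\<^bsub>A\<^esub> m = 0 \<and> e1 \<zero>\<^bsub>A\<^esub> m = 0"
  proof (cases "m \<in> X")
    case True
    then obtain U V \<phi> \<Phi> where mU: "m \<in> U" and chart: "is_chart U V \<phi> \<Phi>"
      using Q_chart_ex by blast
    then show ?thesis using e_loc[OF chart _ mU] loc_zero[OF chart] by simp
  qed (simp add: e_outside)
  then show "e0 \<zero>\<^bsub>A\<^esub> m = 0" "e1 \<zero>\<^bsub>A\<^esub> m = 0" by auto
qed

text \<open>The section over U with coefficients u0, u1 is glued to zero over the complement of the
  preimage of K, which is open because that preimage is closed.\<close>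

lemma extend_by_zero:
  assumes chart: "is_chart U V \<phi> \<Phi>"
    and u: "smooth_on V u0" "smooth_on V u1"
    and K: "compact K" "K \<subseteq> V" "\<And>x. x \<notin> K \<Longrightarrow> u0 x = 0 \<and> u1 x = 0"
  shows "\<exists>a\<in>carrier A. e0 a = (\<lambda>m. if m \<in> U then u0 (\<phi> m) else 0) \<and> e1 a = (\<lambda>m. if m \<in> U then u1 (\<phi> m) else 0)"
proof -
  let ?C = "{m\<in>U. \<phi> m \<in> K}"
  let ?W = "X - ?C"
  have W: "openin T ?W"
    using \<phi>_preimage_compact[OF chart K(1,2)] by blast
  have UW: "U \<union> ?W = X" using U_X[OF chart] by auto
  note U = U_open[OF chart]
  let ?h = "sf_pair V u0 u1"
  have h: "?h \<in> carrier (superdomain 1 V)"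
    by (rule sf_pair_carrier[OF V_open[OF chart] u])
  moreover have "\<Phi> U ` carrier (S U) = carrier (superdomain 1 V)"
    using bij_betw_imp_surj_on[OF \<Phi>_bij[OF chart U order_refl]] by (simp only: \<phi>_U[OF chart])
  ultimately have "?h \<in> \<Phi> U ` carrier (S U)" by simp
  then obtain b where b: "b \<in> carrier (S U)" "\<Phi> U b = ?h"
    by (elim imageE) simp
  \<comment> \<open>Should U and ?W coincide, b takes precedence; this is harmless, since b
    restricts to zero on their intersection.\<close>
  define s where "s W' = (if W' = U then b else \<zero>\<^bsub>S W'\<^esub>)" for W'
  have zero_hom: "restr M W1 W2 \<zero>\<^bsub>S W1\<^esub> = \<zero>\<^bsub>S W2\<^esub>" if "openin T W1" "openin T W2" "W2 \<subseteq> W1" for W1 W2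
  proof (rule ring_hom_zero)
    show "restr M W1 W2 \<in> ring_hom (S W1) (S W2)"
      using restr_hom[OF that] by (simp add: superalg_hom_def)
  qed (rule superalgebraD(1)[OF superalgebra_S], rule that)+
  have bW: "restr M U (U \<inter> ?W) b = \<zero>\<^bsub>S (U \<inter> ?W)\<^esub>"
  proof -
    have o: "openin T (U \<inter> ?W)" using U W by auto
    interpret ring "S (U \<inter> ?W)" by (rule superalgebraD(1)[OF superalgebra_S[OF o]])
    have "\<Phi> (U \<inter> ?W) (restr M U (U \<inter> ?W) b) = sf_restrict (\<phi> ` (U \<inter> ?W)) ?h"
      using \<Phi>_restr[OF chart U o Int_lower1 order_refl b(1)] b(2) by simp
    also have "\<dots> = (\<lambda>x I. 0)"
      using K(3) by (auto simp: sf_restrict_def sf_pair_def fun_eq_iff)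
    also have "\<dots> = \<Phi> (U \<inter> ?W) \<zero>\<^bsub>S (U \<inter> ?W)\<^esub>"
    proof -
      note hh = superalg_homD(3)[OF \<Phi>_hom[OF chart o Int_lower1], of "\<zero>\<^bsub>S (U \<inter> ?W)\<^esub>" "\<zero>\<^bsub>S (U \<inter> ?W)\<^esub>"]
      show ?thesis
      proof (intro ext)
        fix x I
        have "\<Phi> (U \<inter> ?W) \<zero>\<^bsub>S (U \<inter> ?W)\<^esub> x I = \<Phi> (U \<inter> ?W) \<zero>\<^bsub>S (U \<inter> ?W)\<^esub> x I + \<Phi> (U \<inter> ?W) \<zero>\<^bsub>S (U \<inter> ?W)\<^esub> x I"
          using arg_cong[OF hh, of "\<lambda>h. h x I"] by (simp add: sd_simps(3))
        then show "0 = \<Phi> (U \<inter> ?W) \<zero>\<^bsub>S (U \<inter> ?W)\<^esub> x I" by simp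
      qed
    qed
    finally show ?thesis
      by (rule inj_onD[OF bij_betw_imp_inj_on[OF \<Phi>_bij[OF chart o Int_lower1]]])
        (simp_all add: superalg_homD(1)[OF restr_hom[OF U o Int_lower1] b(1)])
  qed
  have "\<exists>!h. h \<in> carrier (S (\<Union>{U, ?W})) \<and> (\<forall>W'\<in>{U, ?W}. restr M (\<Union>{U, ?W}) W' h = s W')"
  proof (rule gluing)
    fix W' assume W': "W' \<in> {U, ?W}"
    show o: "openin T W'" using W' U W by auto
    interpret ring "S W'" by (rule superalgebraD(1)[OF superalgebra_S[OF o]])
    show "s W' \<in> carrier (S W')" using b by (auto simp: s_def)
    fix W'' assume W'': "W'' \<in> {U, ?W}"
    have r1: "restr M U (U \<inter> ?W) (s U) = \<zero>\<^bsub>S (U \<inter> ?W)\<^esub>" by (simp add: s_def bW)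
    have r2: "restr M ?W (?W \<inter> U) (s ?W) = \<zero>\<^bsub>S (U \<inter> ?W)\<^esub>"
    proof (cases "?W = U")
      case True then show ?thesis using r1 by simp
    next
      case False then show ?thesis using zero_hom[OF W openin_Int[OF U W] Int_lower2] by (simp add: s_def Int_commute)
    qed
    show "restr M W' (W' \<inter> W'') (s W') = restr M W'' (W' \<inter> W'') (s W'')"
    proof (cases "W' = W''")
      case False
      then have "W' = U \<and> W'' = ?W \<or> W' = ?W \<and> W'' = U" using W' W'' by blast
      then show ?thesis using r1 r2 by (elim disjE conjE) (simp_all only: Int_commute[of ?W U])
    qed simp
  qed
  then obtain a where a: "a \<in> carrier A" "res U a = s U" "res ?W a = s ?W"
    using UW unfolding Cinf_def by auto
  have "e0 a m = (if m \<in> U then u0 (\<phi> m) else 0) \<and> e1 a m = (if m \<in> U then u1 (\<phi> m) else 0)" for m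
  proof (cases "m \<in> U")
    case True
    then have "\<phi> m \<in> V" using \<phi>_U[OF chart] by auto
    then show ?thesis
      using True e_loc[OF chart a(1) True] a(2) b(2) by (simp add: loc_def[OF chart] s_def sf_pair_simps)
  next
    case False
    show ?thesis
    proof (cases "m \<in> X")
      case True
      then have m: "m \<in> ?W" "?W \<noteq> U" using False by auto
      interpret ring A by (rule ring_A)
      have "res ?W a = res ?W \<zero>\<^bsub>A\<^esub>"
        using a(3) m zero_hom[of X ?W] W by (simp add: s_def Cinf_def)
      then have "e0 a m = e0 \<zero>\<^bsub>A\<^esub> m \<and> e1 a m = e1 \<zero>\<^bsub>A\<^esub> m"
        using e_eqI[OF W m(1) a(1)] by simp
      then show ?thesis using False e_zero by simp
    qed (use False e_outside in auto)
  qed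
  then show ?thesis using a(1) by (intro bexI[of _ a]) auto
qed

end

section \<open>Cubes, and global functions with prescribed local coefficients\<close>

definition nbox :: "real ^ 'n::finite \<Rightarrow> real \<Rightarrow> (real ^ 'n) set"
  where "nbox p r = cbox (p - (\<chi> a. r)) (p + (\<chi> a. r))"

definition obox :: "real ^ 'n::finite \<Rightarrow> real \<Rightarrow> (real ^ 'n) set"
  where "obox p r = box (p - (\<chi> a. r)) (p + (\<chi> a. r))"

lemma mem_nbox: "x \<in> nbox p r \<longleftrightarrow> (\<forall>a. \<bar>x $ a - p $ a\<bar> \<le> r)"
  by (auto simp: nbox_def mem_box_cart abs_le_iff algebra_simps)

lemma mem_obox: "x \<in> obox p r \<longleftrightarrow> (\<forall>a. \<bar>x $ a - p $ a\<bar> < r)"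
  by (auto simp: obox_def mem_box_cart abs_less_iff algebra_simps)

lemma compact_nbox: "compact (nbox p r)" and open_obox: "open (obox p r)"
  by (simp_all add: nbox_def obox_def open_box)

lemma nbox_exists:
  fixes p :: "real ^ 'n::finite"
  assumes "open B" "p \<in> B"
  obtains r where "r > 0" "nbox p (2 * r) \<subseteq> B"
proof -
  obtain e where e: "e > 0" "ball p e \<subseteq> B" using assms by (auto simp: open_contains_ball)
  \<comment> \<open>The norm is at most the sum of the coordinates in absolute value, so the cube of
    radius 2r has points at distance at most e/2 from p. The doubled radius leaves room for the
    support of \<open>plateau\<close>.\<close>
  let ?r = "e / (4 * real CARD('n))"
  have c: "real CARD('n) > 0" by simp
  have "nbox p (2 * ?r) \<subseteq> ball p e"
  proof
    fix x assume x: "x \<in> nbox p (2 * ?r)"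
    have "norm (x - p) \<le> (\<Sum>a\<in>UNIV. \<bar>(x - p) $ a\<bar>)" by (rule norm_le_l1_cart)
    also have "\<dots> \<le> (\<Sum>a\<in>(UNIV :: 'n set). 2 * ?r)" using x by (intro sum_mono) (simp add: mem_nbox)
    also have "\<dots> = e / 2" using c by simp
    also have "\<dots> < e" using e by simp
    finally show "x \<in> ball p e" by (simp add: dist_norm norm_minus_commute)
  qed
  then show ?thesis using that[of ?r] e c by auto
qed

context odd_line_manifold begin

text \<open>The coefficients are smooth only on B. After multiplication by the plateau they are
  smooth on all of V, being zero off a compact cube inside B, and then extend by zero to
  |M|.\<close>

lemma bump_extension:
  assumes chart: "is_chart U V \<phi> \<Phi>"
    and r: "r > 0" "nbox p (2 * r) \<subseteq> B" and B: "open B" "B \<subseteq> V"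
    and u: "smooth_on B u0" "smooth_on B u1"
  shows "\<exists>a\<in>carrier A. e0 a = (\<lambda>m. if m \<in> U then plateau p r (\<phi> m) * u0 (\<phi> m) else 0) \<and>
    e1 a = (\<lambda>m. if m \<in> U then plateau p r (\<phi> m) * u1 (\<phi> m) else 0)"
proof (rule extend_by_zero[OF chart])
  have out: "plateau p r x = 0" if "x \<notin> nbox p (2 * r)" for x
    using that plateau_nonzeroD[OF r(1), of p x] by (force simp: mem_nbox less_imp_le)
  have "smooth_on V (\<lambda>x. plateau p r x * w x)" if w: "smooth_on B w" for w
  proof (rule smooth_on_local[OF V_open[OF chart]])
    fix x
    show "\<exists>W. open W \<and> x \<in> W \<and> smooth_on W (\<lambda>x. plateau p r x * w x)"
    proof (cases "x \<in> B")
      case True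
      have "smooth_on B (\<lambda>x. plateau p r x * w x)"
        by (intro smooth_on_mult B w smooth_on_subset[OF smooth_on_plateau]) simp
      then show ?thesis using True B by blast
    next
      case False
      have o: "open (- nbox p (2 * r))"
        by (rule open_Compl[OF compact_imp_closed[OF compact_nbox]])
      have "smooth_on (- nbox p (2 * r)) (\<lambda>x. plateau p r x * w x)"
        by (subst smooth_on_cong[OF o, where g = "\<lambda>x. 0"]) (use out smooth_on_const[OF o] in auto)
      then show ?thesis using o False r(2) by blast
    qed
  qed
  then show "smooth_on V (\<lambda>x. plateau p r x * u0 x)" "smooth_on V (\<lambda>x. plateau p r x * u1 x)"
    using u by blast+
  show "compact (nbox p (2 * r))" by (rule compact_nbox)
  show "nbox p (2 * r) \<subseteq> V" using r(2) B(2) by blast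
  show "plateau p r x * u0 x = 0 \<and> plateau p r x * u1 x = 0" if "x \<notin> nbox p (2 * r)" for x
    using out[OF that] by simp
qed

definition smooth_pair_at :: "('p \<Rightarrow> real) \<Rightarrow> ('p \<Rightarrow> real) \<Rightarrow> 'p \<Rightarrow> bool"
  where "smooth_pair_at f0 f1 m \<longleftrightarrow> (\<exists>U V \<phi> \<Phi> B u0 u1. is_chart U V \<phi> \<Phi> \<and> m \<in> U \<and>
    open B \<and> \<phi> m \<in> B \<and> B \<subseteq> V \<and> smooth_on B u0 \<and> smooth_on B u1 \<and>
    (\<forall>m'\<in>U. \<phi> m' \<in> B \<longrightarrow> f0 m' = u0 (\<phi> m') \<and> f1 m' = u1 (\<phi> m')))"

text \<open>A plateau turns the local coefficients at m into those of a global function, correct on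
  the open cube of radius r, where the plateau is 1.\<close>

lemma A_glue_smooth:
  assumes "\<And>m. m \<notin> X \<Longrightarrow> f0 m = 0 \<and> f1 m = 0" and "\<And>m. m \<in> X \<Longrightarrow> smooth_pair_at f0 f1 m"
  shows "\<exists>a\<in>carrier A. e0 a = f0 \<and> e1 a = f1"
proof (rule A_glue[OF assms(1)])
  fix m assume "m \<in> X"
  from assms(2)[OF this] obtain U V \<phi> \<Phi> B u0 u1 where chart: "is_chart U V \<phi> \<Phi>"
    and m: "m \<in> U" and B: "open B" "\<phi> m \<in> B" "B \<subseteq> V" and u: "smooth_on B u0" "smooth_on B u1"
    and eq: "\<And>m'. m' \<in> U \<Longrightarrow> \<phi> m' \<in> B \<Longrightarrow> f0 m' = u0 (\<phi> m') \<and> f1 m' = u1 (\<phi> m')"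
    unfolding smooth_pair_at_def by blast
  obtain r where r: "r > 0" "nbox (\<phi> m) (2 * r) \<subseteq> B" using nbox_exists[OF B(1,2)] .
  obtain a where a: "a \<in> carrier A" "e0 a = (\<lambda>m'. if m' \<in> U then plateau (\<phi> m) r (\<phi> m') * u0 (\<phi> m') else 0)"
    "e1 a = (\<lambda>m'. if m' \<in> U then plateau (\<phi> m) r (\<phi> m') * u1 (\<phi> m') else 0)"
    using bump_extension[OF chart r B(1,3) u] by blast
  let ?W = "{m'\<in>U. \<phi> m' \<in> obox (\<phi> m) r}"
  have "e0 a m' = f0 m' \<and> e1 a m' = f1 m'" if "m' \<in> ?W" for m'
  proof -
    have lt: "\<And>b. \<bar>\<phi> m' $ b - \<phi> m $ b\<bar> < r" using that by (simp add: mem_obox)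
    then have "plateau (\<phi> m) r (\<phi> m') = 1"
      by (intro plateau_eq_1 r less_imp_le)
    moreover have "\<bar>\<phi> m' $ b - \<phi> m $ b\<bar> \<le> 2 * r" for b using lt[of b] r(1) by linarith
    then have "\<phi> m' \<in> B"
      using r(2) by (auto simp: mem_nbox)
    ultimately show ?thesis using that eq[of m'] by (simp add: a)
  qed
  moreover have "openin T ?W" by (rule \<phi>_preimage_open[OF chart open_obox])
  moreover have "m \<in> ?W" using m r(1) by (simp add: mem_obox)
  ultimately show "\<exists>W. openin T W \<and> m \<in> W \<and> (\<exists>a\<in>carrier A. \<forall>m'\<in>W. e0 a m' = f0 m' \<and> e1 a m' = f1 m')"
    using a(1) by blast
qed

text \<open>Inside X everything is read off in one chart around m, where passing to coordinates is a
  homomorphism; off X all coefficients are 0.\<close>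

lemma e_algebra_at:
  "(f \<in> carrier A \<and> k \<in> carrier A \<longrightarrow>
      e0 (f \<oplus>\<^bsub>A\<^esub> k) m = e0 f m + e0 k m \<and> e1 (f \<oplus>\<^bsub>A\<^esub> k) m = e1 f m + e1 k m \<and>
      e0 (f \<otimes>\<^bsub>A\<^esub> k) m = e0 f m * e0 k m \<and> e1 (f \<otimes>\<^bsub>A\<^esub> k) m = e0 f m * e1 k m + e1 f m * e0 k m) \<and>
    (f \<in> carrier A \<longrightarrow> e0 (r \<odot>\<^bsub>A\<^esub> f) m = r * e0 f m \<and> e1 (r \<odot>\<^bsub>A\<^esub> f) m = r * e1 f m) \<and>
    e0 \<one>\<^bsub>A\<^esub> m = (if m \<in> X then 1 else 0) \<and> e1 \<one>\<^bsub>A\<^esub> m = 0 \<and>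
    (f \<in> homog A 1 \<longrightarrow> e0 f m = 0) \<and> (f \<in> homog A 0 \<longrightarrow> e1 f m = 0)"
proof (cases "m \<in> X")
  case True
  then obtain U V \<phi> \<Phi> where m: "m \<in> U" and chart: "is_chart U V \<phi> \<Phi>"
    using Q_chart_ex by blast
  interpret ring A by (rule ring_A)
  note E = e_loc[OF chart _ m]
  have \<phi>m: "\<phi> m \<in> V" using \<phi>_U[OF chart] m by blast
  show ?thesis
  proof (intro conjI impI)
    assume fk: "f \<in> carrier A \<and> k \<in> carrier A"
    then have "f \<oplus>\<^bsub>A\<^esub> k \<in> carrier A" "f \<otimes>\<^bsub>A\<^esub> k \<in> carrier A" "f \<in> carrier A" "k \<in> carrier A" by auto
    note E4 = this[THEN E(1)] this[THEN E(2)]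
    show "e0 (f \<oplus>\<^bsub>A\<^esub> k) m = e0 f m + e0 k m" "e1 (f \<oplus>\<^bsub>A\<^esub> k) m = e1 f m + e1 k m"
      "e0 (f \<otimes>\<^bsub>A\<^esub> k) m = e0 f m * e0 k m" "e1 (f \<otimes>\<^bsub>A\<^esub> k) m = e0 f m * e1 k m + e1 f m * e0 k m"
      using fk by (simp_all add: E4 locD(2,3)[OF chart] sd_simps)
  next
    assume f: "f \<in> carrier A"
    note rf = superalgebra_smult_closed[OF superalgebra_A f, of r]
    show "e0 (r \<odot>\<^bsub>A\<^esub> f) m = r * e0 f m" "e1 (r \<odot>\<^bsub>A\<^esub> f) m = r * e1 f m"
      using f by (simp_all add: E[OF f] E[OF rf] locD(5)[OF chart] sd_simps)
  next
    show "e0 \<one>\<^bsub>A\<^esub> m = (if m \<in> X then 1 else 0)" "e1 \<one>\<^bsub>A\<^esub> m = 0"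
      using True \<phi>m by (simp_all add: E locD(4)[OF chart] sd_simps)
  next
    assume f: "f \<in> homog A 1"
    then have "f \<in> carrier A" using homog_subset_carrier[OF superalgebra_A] by blast
    then show "e0 f m = 0" using sd_homog_1[OF locD(6)[OF chart f]] by (simp add: E)
  next
    assume f: "f \<in> homog A 0"
    then have "f \<in> carrier A" using homog_subset_carrier[OF superalgebra_A] by blast
    then show "e1 f m = 0" using sd_homog_0[OF locD(6)[OF chart f]] by (simp add: E)
  qed
qed (simp add: e_outside)

lemma e_algebra:
  shows "f \<in> carrier A \<Longrightarrow> k \<in> carrier A \<Longrightarrow> e0 (f \<oplus>\<^bsub>A\<^esub> k) = (\<lambda>m. e0 f m + e0 k m)"
    and "f \<in> carrier A \<Longrightarrow> k \<in> carrier A \<Longrightarrow> e1 (f \<oplus>\<^bsub>A\<^esub> k) = (\<lambda>m. e1 f m + e1 k m)"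
    and "f \<in> carrier A \<Longrightarrow> k \<in> carrier A \<Longrightarrow> e0 (f \<otimes>\<^bsub>A\<^esub> k) = (\<lambda>m. e0 f m * e0 k m)"
    and "f \<in> carrier A \<Longrightarrow> k \<in> carrier A \<Longrightarrow> e1 (f \<otimes>\<^bsub>A\<^esub> k) = (\<lambda>m. e0 f m * e1 k m + e1 f m * e0 k m)"
    and "f \<in> carrier A \<Longrightarrow> e0 (r \<odot>\<^bsub>A\<^esub> f) = (\<lambda>m. r * e0 f m)"
    and "f \<in> carrier A \<Longrightarrow> e1 (r \<odot>\<^bsub>A\<^esub> f) = (\<lambda>m. r * e1 f m)"
    and "e0 \<one>\<^bsub>A\<^esub> = (\<lambda>m. if m \<in> X then 1 else 0)"
    and "e1 \<one>\<^bsub>A\<^esub> = (\<lambda>m. 0)"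
    and "f \<in> homog A 1 \<Longrightarrow> e0 f = (\<lambda>m. 0)"
    and "f \<in> homog A 0 \<Longrightarrow> e1 f = (\<lambda>m. 0)"
  using e_algebra_at by (simp_all add: fun_eq_iff)

section \<open>The algebra of even functions\<close>

definition F where "F = e0 ` carrier A"

lemma e_F: "f \<in> carrier A \<Longrightarrow> e0 f \<in> F" "f \<in> carrier A \<Longrightarrow> e1 f \<in> F"
  using Q_closed by (auto simp: F_def e1_def)

lemma F_chart:
  assumes "f \<in> F" and chart: "is_chart U V \<phi> \<Phi>"
  shows "\<exists>u. smooth_on V u \<and> (\<forall>m\<in>U. f m = u (\<phi> m))"
proof -
  obtain a where a: "a \<in> carrier A" "f = e0 a" using assms(1) by (auto simp: F_def)
  then show ?thesis
    using e_loc(1)[OF chart a(1)] sd_carrier_smooth[OF locD(1)[OF chart a(1)], of "{}"]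
    by (intro exI[of _ "\<lambda>x. loc U \<Phi> a x {}"]) simp
qed

lemma F_out: "f \<in> F \<Longrightarrow> m \<notin> X \<Longrightarrow> f m = 0"
  by (auto simp: F_def e_outside)

text \<open>For the pair (0, 1) this yields the global odd function \<tau>, and for (f, 0) the even
  function with body f.\<close>

lemma A_surj:
  assumes "f \<in> F" "h \<in> F"
  shows "\<exists>a\<in>carrier A. e0 a = f \<and> e1 a = h"
proof (rule A_glue_smooth)
  fix m assume "m \<in> X"
  then obtain U V \<phi> \<Phi> where m: "m \<in> U" and chart: "is_chart U V \<phi> \<Phi>"
    using Q_chart_ex by blast
  moreover obtain u0 u1 where "smooth_on V u0" "smooth_on V u1" "\<forall>m\<in>U. f m = u0 (\<phi> m)" "\<forall>m\<in>U. h m = u1 (\<phi> m)"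
    using F_chart[OF assms(1) chart] F_chart[OF assms(2) chart] by blast
  moreover have "\<phi> m \<in> V" using \<phi>_U[OF chart] m by blast
  ultimately show "smooth_pair_at f h m"
    unfolding smooth_pair_at_def
    using V_open[OF chart]
    by (intro exI[of _ U] exI[of _ V] exI[of _ \<phi>] exI[of _ \<Phi>] exI[of _ V] exI[of _ u0] exI[of _ u1]) auto
qed (use assms F_out in auto)

sublocale function_algebra X F
proof
  interpret A: ring A by (rule ring_A)
  fix f h :: "'p \<Rightarrow> real" assume "f \<in> F" "h \<in> F"
  then obtain a b where ab: "a \<in> carrier A" "f = e0 a" "b \<in> carrier A" "h = e0 b" by (auto simp: F_def)
  show "(\<lambda>m. f m + h m) \<in> F"
    using ab e_algebra(1)[of a b] by (auto simp: F_def intro!: image_eqI[of _ _ "a \<oplus>\<^bsub>A\<^esub> b"])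
  show "(\<lambda>m. f m * h m) \<in> F"
    using ab e_algebra(3)[of a b] by (auto simp: F_def intro!: image_eqI[of _ _ "a \<otimes>\<^bsub>A\<^esub> b"])
next
  fix f :: "'p \<Rightarrow> real" and r assume "f \<in> F"
  then obtain a where a: "a \<in> carrier A" "f = e0 a" by (auto simp: F_def)
  then show "(\<lambda>m. r * f m) \<in> F"
    using e_algebra(5)[of a r] superalgebra_smult_closed[OF superalgebra_A a(1), of r]
    by (auto simp: F_def intro!: image_eqI[of _ _ "r \<odot>\<^bsub>A\<^esub> a"])
next
  interpret A: ring A by (rule ring_A)
  show "(\<lambda>m. if m \<in> X then 1 else 0) \<in> F"
    using e_algebra(7) by (auto simp: F_def intro!: image_eqI[of _ _ "\<one>\<^bsub>A\<^esub>"])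
next
  fix f :: "'p \<Rightarrow> real"
  assume f: "\<And>m. m \<notin> X \<Longrightarrow> f m = 0" "\<And>m. m \<in> X \<Longrightarrow> \<exists>\<rho>\<in>F. \<rho> m \<noteq> 0 \<and> (\<lambda>m. \<rho> m * f m) \<in> F"
  have "\<exists>a\<in>carrier A. e0 a = f \<and> e1 a = (\<lambda>m. 0)"
  proof (rule A_glue_smooth)
    fix m assume mX: "m \<in> X"
    then obtain U V \<phi> \<Phi> where m: "m \<in> U" and chart: "is_chart U V \<phi> \<Phi>"
      using Q_chart_ex by blast
    obtain \<rho> where \<rho>: "\<rho> \<in> F" "\<rho> m \<noteq> 0" "(\<lambda>m. \<rho> m * f m) \<in> F" using f(2)[OF mX] by blast
    obtain u where u: "smooth_on V u" "\<And>m. m \<in> U \<Longrightarrow> \<rho> m = u (\<phi> m)"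
      using F_chart[OF \<rho>(1) chart] by blast
    obtain w where w: "smooth_on V w" "\<And>m. m \<in> U \<Longrightarrow> \<rho> m * f m = w (\<phi> m)"
      using F_chart[OF \<rho>(3) chart] by blast
    \<comment> \<open>Where \<rho> does not vanish, f is the quotient w/u of smooth functions in the
      chart.\<close>
    let ?B = "V \<inter> u -` (- {0})"
    have B: "open ?B"
      by (intro continuous_open_preimage smooth_on_continuous[OF u(1)] V_open[OF chart]) auto
    have "smooth_on ?B (\<lambda>x. w x * inverse (u x))"
      by (intro smooth_on_mult smooth_on_inverse B smooth_on_subset[OF w(1)] smooth_on_subset[OF u(1)]) auto
    moreover have "\<phi> m \<in> ?B" using u(2)[OF m] \<rho>(2) m \<phi>_U[OF chart] by auto
    moreover have "f m' = w (\<phi> m') * inverse (u (\<phi> m'))" if "m' \<in> U" "\<phi> m' \<in> ?B" for m'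
      using u(2)[OF that(1)] w(2)[OF that(1)] that(2) by (auto simp: field_simps)
    ultimately show "smooth_pair_at f (\<lambda>m. 0) m"
      unfolding smooth_pair_at_def using chart m B smooth_on_const[OF B, of 0]
      by (intro exI[of _ U] exI[of _ V] exI[of _ \<phi>] exI[of _ \<Phi>] exI[of _ ?B] exI[of _ "\<lambda>x. w x * inverse (u x)"]
          exI[of _ "\<lambda>_. 0"]) auto
  qed (simp add: f(1))
  then show "f \<in> F" by (auto simp: F_def)
qed (rule F_out)

end

section \<open>Point derivations and coordinate frames\<close>

definition (in function_algebra) point_derivation :: "'p \<Rightarrow> (('p \<Rightarrow> real) \<Rightarrow> real) \<Rightarrow> bool"
  where "point_derivation m v \<longleftrightarrow> (\<forall>f\<in>F. \<forall>h\<in>F. v (\<lambda>m. f m + h m) = v f + v h) \<and>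
    (\<forall>r. \<forall>f\<in>F. v (\<lambda>m. r * f m) = r * v f) \<and>
    (\<forall>f\<in>F. \<forall>h\<in>F. v (\<lambda>m. f m * h m) = v f * h m + f m * v h)"

lemma (in function_algebra) point_derivation_simps:
  assumes "point_derivation m v"
  shows "f \<in> F \<Longrightarrow> h \<in> F \<Longrightarrow> v (\<lambda>m. f m + h m) = v f + v h"
    and "f \<in> F \<Longrightarrow> v (\<lambda>m. r * f m) = r * v f"
    and "f \<in> F \<Longrightarrow> h \<in> F \<Longrightarrow> v (\<lambda>m. f m * h m) = v f * h m + f m * v h"
  using assms by (simp_all add: point_derivation_def)

lemma (in function_algebra) point_derivation_cst:
  assumes v: "point_derivation m v" and m: "m \<in> X"
  shows "v (cst r) = 0"
proof -
  have sq: "(\<lambda>m. cst 1 m * cst 1 m) = cst 1" "(\<lambda>m. r * cst 1 m) = cst r" by (auto simp: cst_def)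
  have "v (cst 1) = v (cst 1) * cst 1 m + cst 1 m * v (cst 1)"
    using point_derivation_simps(3)[OF v, of "cst 1" "cst 1"] unfolding sq by simp
  then have "v (cst 1) = 0" using m by (simp add: cst_def)
  then show ?thesis using point_derivation_simps(2)[OF v F_cst[of 1], of r] unfolding sq by simp
qed

lemma (in function_algebra) point_derivation_diff:
  assumes "point_derivation m v" "f \<in> F" "h \<in> F"
  shows "v (\<lambda>m. f m - h m) = v f - v h"
  using point_derivation_simps(1)[OF assms(1,2) F_scale[OF assms(3), of "- 1"]]
    point_derivation_simps(2)[OF assms(1,3), of "- 1"] by simp

lemma (in function_algebra) point_derivation_zero: "point_derivation m v \<Longrightarrow> v (\<lambda>m. 0) = 0"
  using point_derivation_simps(2)[of m v "\<lambda>m. 0" 0] by simp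

lemma (in function_algebra) point_derivation_sum:
  assumes "point_derivation m v" "finite I" "\<And>a. a \<in> I \<Longrightarrow> f a \<in> F"
  shows "v (\<lambda>m. \<Sum>a\<in>I. f a m) = (\<Sum>a\<in>I. v (f a))"
  using assms(2,3)
  by (induction I rule: finite_induct)
    (simp_all add: point_derivation_zero[OF assms(1)] point_derivation_simps(1)[OF assms(1)] F_sum)

lemma (in function_algebra) der_point_derivation: "Z \<in> D \<Longrightarrow> point_derivation m (\<lambda>f. Z f m)"
  by (simp add: point_derivation_def der_sum_fun der_scale_fun der_mult_fun)

context odd_line_manifold begin

lemma bump_F:
  assumes chart: "is_chart U V \<phi> \<Phi>"
    and r: "r > 0" "nbox p (2 * r) \<subseteq> B" and B: "open B" "B \<subseteq> V" and u: "smooth_on B u"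
  shows "(\<lambda>m. if m \<in> U then plateau p r (\<phi> m) * u (\<phi> m) else 0) \<in> F"
proof -
  obtain a where "a \<in> carrier A" "e0 a = (\<lambda>m. if m \<in> U then plateau p r (\<phi> m) * u (\<phi> m) else 0)"
    using bump_extension[OF chart r B u u] by blast
  then show ?thesis using e_F(1)[of a] by simp
qed

text \<open>Let b be a cutoff with b(m) = 1 supported where f vanishes. Then f b = 0, and the
  Leibniz rule at m leaves only v f.\<close>

lemma point_derivation_local:
  assumes chart: "is_chart U V \<phi> \<Phi>" and m: "m \<in> U"
    and v: "point_derivation m v" and B: "open B" "\<phi> m \<in> B"
    and f: "f \<in> F" "\<And>m'. m' \<in> U \<Longrightarrow> \<phi> m' \<in> B \<Longrightarrow> f m' = 0"
  shows "v f = 0"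
proof -
  have "open (B \<inter> V)" "\<phi> m \<in> B \<inter> V" using B V_open[OF chart] \<phi>_U[OF chart] m by auto
  then obtain r where r: "r > 0" "nbox (\<phi> m) (2 * r) \<subseteq> B \<inter> V" using nbox_exists by blast
  define b where "b = (\<lambda>m'. if m' \<in> U then plateau (\<phi> m) r (\<phi> m') * 1 else 0)"
  have b: "b \<in> F" unfolding b_def
    by (rule bump_F[OF chart r]) (use B V_open[OF chart] in \<open>auto intro: smooth_on_const\<close>)
  have "(\<lambda>m'. f m' * b m') = (\<lambda>m'. 0)"
  proof
    fix m'
    show "f m' * b m' = 0"
    proof (cases "b m' = 0")
      case False
      then have "m' \<in> U" "plateau (\<phi> m) r (\<phi> m') \<noteq> 0" by (auto simp: b_def split: if_splits)
      then have "\<phi> m' \<in> nbox (\<phi> m) (2 * r)"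
        using plateau_nonzeroD[OF r(1)] unfolding mem_nbox by (blast intro: less_imp_le)
      then show ?thesis using f(2)[OF \<open>m' \<in> U\<close>] r(2) by auto
    qed simp
  qed
  then have "v f * b m + f m * v b = 0"
    using point_derivation_simps(3)[OF v f(1) b] point_derivation_zero[OF v] by simp
  moreover have "b m = 1" using m plateau_eq_1[OF r(1), of "\<phi> m" "\<phi> m"] r(1) by (simp add: b_def)
  moreover have "f m = 0" using f(2) m B by blast
  ultimately show ?thesis by simp
qed

text \<open>By Hadamard, f - f(m) is a sum of products of x a - x a (m) with smooth factors near m.
  The Leibniz rule differentiates only the first factor of each product, as that factor vanishes at
  m. The functions x are global and need to be coordinates only near m.\<close>

lemma point_derivation_chart:
  assumes chart: "is_chart U V \<phi> \<Phi>" and m: "m \<in> U"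
    and v: "point_derivation m v" and B: "open B" "\<phi> m \<in> B"
    and x: "\<And>a. x a \<in> F" "\<And>a m'. m' \<in> U \<Longrightarrow> \<phi> m' \<in> B \<Longrightarrow> x a m' = \<phi> m' $ a"
    and f: "f \<in> F" and u: "smooth_on V u" "\<And>m'. m' \<in> U \<Longrightarrow> f m' = u (\<phi> m')"
  shows "v f = (\<Sum>a\<in>UNIV. v (x a) * partial a u (\<phi> m))"
proof -
  let ?q = "\<phi> m"
  have mX: "m \<in> X" using U_X[OF chart] m by blast
  have "open (B \<inter> V)" "?q \<in> B \<inter> V" using B V_open[OF chart] \<phi>_U[OF chart] m by auto
  then obtain s where s: "s > 0" "ball ?q s \<subseteq> B \<inter> V"
    unfolding open_contains_ball by blast
  obtain h where h: "\<And>a. smooth_on (ball ?q s) (h a)" "\<And>a. h a ?q = partial a u ?q"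
    "\<And>y. y \<in> ball ?q s \<Longrightarrow> u y = u ?q + (\<Sum>a\<in>UNIV. (y $ a - ?q $ a) * h a y)"
    using Hadamard[OF smooth_on_subset[OF u(1)] s(1)] s(2) by blast
  obtain r where r: "r > 0" "nbox ?q (2 * r) \<subseteq> ball ?q s"
    using nbox_exists[OF open_ball, of ?q ?q s] s(1) by auto
  define H where "H a = (\<lambda>m'. if m' \<in> U then plateau ?q r (\<phi> m') * h a (\<phi> m') else 0)" for a
  have H: "H a \<in> F" for a unfolding H_def
    by (rule bump_F[OF chart r open_ball _ h(1)]) (use s(2) in auto)
  have Hm: "H a m = partial a u ?q" for a
    using m h(2) plateau_eq_1[OF r(1), of ?q ?q] r(1) by (simp add: H_def)
  \<comment> \<open>The error in the globalised Hadamard expansion; it vanishes on a cube around m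
    and is therefore annihilated by v.\<close>
  define k where "k = (\<lambda>m'. (f m' - cst (f m) m') - (\<Sum>a\<in>UNIV. (x a m' - cst (?q $ a) m') * H a m'))"
  have t: "(\<lambda>m'. (x a m' - cst (?q $ a) m') * H a m') \<in> F" for a
    by (intro F_mult F_diff x H F_cst)
  have k: "k \<in> F" unfolding k_def
    by (intro F_diff F_sum f F_cst t) simp
  have "v k = 0"
  proof (rule point_derivation_local[OF chart m v open_obox _ k])
    show "?q \<in> obox ?q r" using r(1) by (simp add: mem_obox)
    fix m' assume m': "m' \<in> U" "\<phi> m' \<in> obox ?q r"
    then have lt: "\<And>b. \<bar>\<phi> m' $ b - ?q $ b\<bar> < r" by (simp add: mem_obox)
    then have "plateau ?q r (\<phi> m') = 1" by (intro plateau_eq_1 r less_imp_le)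
    then have "H a m' = h a (\<phi> m')" for a using m' by (simp add: H_def)
    moreover have "\<bar>\<phi> m' $ b - ?q $ b\<bar> \<le> 2 * r" for b using lt[of b] r(1) by linarith
    then have "\<phi> m' \<in> nbox ?q (2 * r)" by (simp only: mem_nbox simp_thms)
    then have b: "\<phi> m' \<in> ball ?q s" using r(2) by blast
    moreover have "m' \<in> X" using U_X[OF chart] m' by blast
    moreover have "x a m' = \<phi> m' $ a" for a using x(2)[OF m'(1)] b s(2) by blast
    ultimately show "k m' = 0" using h(3)[OF b] u(2)[OF m'(1)] u(2)[OF m] by (simp add: k_def cst_def)
  qed
  moreover have "v k = v f - (\<Sum>a\<in>UNIV. v (x a) * H a m)"
  proof -
    have "v (\<lambda>m'. (x a m' - cst (?q $ a) m') * H a m') = v (x a) * H a m" for a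
      using x(2)[OF m B(2), of a] mX
      by (simp add: point_derivation_simps(3)[OF v F_diff[OF x(1) F_cst] H] point_derivation_diff[OF v x(1) F_cst]
          point_derivation_cst[OF v mX], simp add: cst_def)
    then have "v (\<lambda>m'. \<Sum>a\<in>UNIV. (x a m' - cst (?q $ a) m') * H a m') = (\<Sum>a\<in>UNIV. v (x a) * H a m)"
      using point_derivation_sum[OF v finite, of UNIV "\<lambda>a m'. (x a m' - cst (?q $ a) m') * H a m'"] t by simp
    moreover have "v (\<lambda>m'. f m' - cst (f m) m') = v f"
      by (simp add: point_derivation_diff[OF v f F_cst] point_derivation_cst[OF v mX])
    moreover have "(\<lambda>m'. \<Sum>a\<in>UNIV. (x a m' - cst (?q $ a) m') * H a m') \<in> F"
      by (intro F_sum t) simp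
    ultimately show ?thesis
      unfolding k_def using point_derivation_diff[OF v F_diff[OF f F_cst[of "f m"]]] by simp
  qed
  ultimately show ?thesis by (simp add: Hm)
qed

text \<open>The expansion is stated for arbitrary point derivations, so that it serves both for
  derivations of F and for realising tangent vectors by vector fields.\<close>

lemma coordinate_frame:
  assumes mX: "m \<in> X"
  obtains \<beta> and x :: "'n \<Rightarrow> 'p \<Rightarrow> real" and E where "\<beta> \<in> F" "\<beta> m \<noteq> 0" "\<And>a. x a \<in> F" "\<And>a. E a \<in> D"
    "\<And>a b. E a (x b) m = (if a = b then 1 else 0)"
    "\<And>m' v f. \<beta> m' \<noteq> 0 \<Longrightarrow> point_derivation m' v \<Longrightarrow> f \<in> F \<Longrightarrow> v f = (\<Sum>a\<in>UNIV. v (x a) * E a f m')"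
proof -
  obtain U V \<phi> \<Phi> where m: "m \<in> U" and chart: "is_chart U V \<phi> \<Phi>"
    using Q_chart_ex mX by blast
  note V = V_open[OF chart]
  let ?p = "\<phi> m"
  have "?p \<in> V" using \<phi>_U[OF chart] m by auto
  then obtain r where r: "r > 0" "nbox ?p (2 * r) \<subseteq> V" using nbox_exists[OF V] by blast
  have r2: "r / 2 > 0" "nbox ?p (2 * (r / 2)) \<subseteq> V"
    using r by (auto simp: mem_nbox subset_iff) (smt (verit))
  \<comment> \<open>The radius is halved because \<open>plateau\<close> has support in a cube of
    twice its radius: wherever \<beta> is nonzero, the plateau of radius r is 1, so x b is a true
    coordinate and E a a true coordinate field there.\<close>
  define \<beta> where "\<beta> = (\<lambda>m'. if m' \<in> U then plateau ?p (r / 2) (\<phi> m') * 1 else 0)"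
  define x where "x b = (\<lambda>m'. if m' \<in> U then plateau ?p r (\<phi> m') * (\<phi> m' $ b) else 0)" for b
  define hat where "hat f y = f (inv_into U \<phi> y)" for f :: "'p \<Rightarrow> real" and y
  define E where "E a f = (\<lambda>m'. if f \<in> F \<and> m' \<in> U then plateau ?p r (\<phi> m') * partial a (hat f) (\<phi> m') else 0)" for a f
  have hat_eq: "hat f (\<phi> m') = f m'" if "m' \<in> U" for f m'
    using inv_into_f_f[OF \<phi>_inj[OF chart] that] by (simp add: hat_def)
  have hat: "smooth_on V (hat f)" if f: "f \<in> F" for f
  proof -
    obtain u where u: "smooth_on V u" "\<And>m. m \<in> U \<Longrightarrow> f m = u (\<phi> m)" using F_chart[OF f chart] by blast
    have "hat f y = u y" if "y \<in> V" for y
    proof -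
      have "y \<in> \<phi> ` U" using that \<phi>_U[OF chart] by simp
      then show ?thesis using u(2) hat_eq by auto
    qed
    then show ?thesis using u(1) smooth_on_cong[OF V] by blast
  qed
  have diff: "hat f differentiable at (\<phi> m')" if "f \<in> F" "m' \<in> U" for f m'
    using smooth_on_differentiable[OF V hat[OF that(1)]] \<phi>_U[OF chart] that(2) by auto
  show thesis
  proof (rule that[of \<beta> x E])
    show "\<beta> \<in> F" unfolding \<beta>_def
      by (rule bump_F[OF chart r2 V order_refl smooth_on_const[OF V]])
    show "\<beta> m \<noteq> 0" using m r2(1) plateau_eq_1[of "r / 2" ?p ?p] by (simp add: \<beta>_def)
    show x: "x b \<in> F" for b unfolding x_def
      by (rule bump_F[OF chart r V order_refl smooth_on_coord[OF V]])
    show "E a \<in> D" for a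
    proof (rule D_I)
      fix f assume f: "f \<in> F"
      show "E a f \<in> F"
        using bump_F[OF chart r V order_refl smooth_on_partial[OF hat[OF f], of a]] f by (simp add: E_def)
    next
      fix f h :: "'p \<Rightarrow> real" and m' assume fh: "f \<in> F" "h \<in> F"
      have "hat (\<lambda>m. f m + h m) = (\<lambda>y. hat f y + hat h y)" "hat (\<lambda>m. f m * h m) = (\<lambda>y. hat f y * hat h y)"
        by (simp_all add: hat_def[abs_def])
      then show "E a (\<lambda>m. f m + h m) m' = E a f m' + E a h m'"
        "E a (\<lambda>m. f m * h m) m' = E a f m' * h m' + f m' * E a h m'"
        using fh diff[of _ m']
        by (auto simp: E_def partial_add partial_mult hat_eq algebra_simps)
    next
      fix f :: "'p \<Rightarrow> real" and t :: real and m' assume f: "f \<in> F"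
      have "hat (\<lambda>m. t * f m) = (\<lambda>y. t * hat f y)" by (simp add: hat_def[abs_def])
      then show "E a (\<lambda>m. t * f m) m' = t * E a f m'"
        using f diff[of f m'] by (auto simp: E_def partial_mult partial_const)
    qed (simp add: E_def)
    show "E a (x b) m = (if a = b then 1 else 0)" for a b
    proof -
      have o: "open (obox ?p r \<inter> V)" "?p \<in> obox ?p r \<inter> V"
        using V \<open>?p \<in> V\<close> r(1) open_obox by (auto simp: mem_obox)
      have "hat (x b) y = y $ b" if y: "y \<in> obox ?p r \<inter> V" for y
      proof -
        have "y \<in> \<phi> ` U" using y \<phi>_U[OF chart] by simp
        then obtain m' where m': "m' \<in> U" "y = \<phi> m'" by blast
        have "plateau ?p r y = 1" using y by (intro plateau_eq_1 r) (simp add: mem_obox less_imp_le)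
        then show ?thesis using m' by (simp add: hat_eq x_def)
      qed
      then have "partial a (hat (x b)) ?p = partial a (\<lambda>y. y $ b) ?p"
        by (rule partial_cong[OF o])
      then show ?thesis
        using x m plateau_eq_1[OF r(1), of ?p ?p] r(1) by (simp add: E_def partial_coord)
    qed
    fix m' v f assume \<beta>m: "\<beta> m' \<noteq> 0" and v: "point_derivation m' v" and f: "f \<in> F"
    have m': "m' \<in> U" "plateau ?p (r / 2) (\<phi> m') \<noteq> 0" using \<beta>m by (auto simp: \<beta>_def split: if_splits)
    have lt: "\<bar>\<phi> m' $ b - ?p $ b\<bar> < r" for b using plateau_nonzeroD[OF r2(1) m'(2), of b] by simp
    have "v f = (\<Sum>a\<in>UNIV. v (x a) * partial a (hat f) (\<phi> m'))"
    proof (rule point_derivation_chart[OF chart m'(1) v open_obox, where x = x])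
      show "\<phi> m' \<in> obox ?p r" using lt by (simp add: mem_obox)
      show "x a m'' = \<phi> m'' $ a" if "m'' \<in> U" "\<phi> m'' \<in> obox ?p r" for a m''
        using that plateau_eq_1[OF r(1), of "\<phi> m''" ?p] by (simp add: x_def mem_obox less_imp_le)
    qed (use x f hat hat_eq in auto)
    moreover have "plateau ?p r (\<phi> m') = 1" using lt by (intro plateau_eq_1 r less_imp_le)
    ultimately show "v f = (\<Sum>a\<in>UNIV. v (x a) * E a f m')"
      using f m' by (simp add: E_def)
  qed
qed

lemma local_frame_F:
  assumes "m \<in> X"
  shows "\<exists>\<beta>\<in>F. \<exists>x :: 'n \<Rightarrow> 'p \<Rightarrow> real. \<exists>E. \<beta> m \<noteq> 0 \<and>
      (\<forall>a. x a \<in> F) \<and> (\<forall>a. E a \<in> D) \<and> (\<forall>a b. E a (x b) m = (if a = b then 1 else 0)) \<and>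
      (\<forall>Z\<in>D. \<forall>f\<in>F. \<forall>m'. \<beta> m' * Z f m' = (\<Sum>a\<in>UNIV. (\<beta> m' * Z (x a) m') * E a f m'))"
proof -
  obtain \<beta> and x :: "'n \<Rightarrow> 'p \<Rightarrow> real" and E where c: "\<beta> \<in> F" "\<beta> m \<noteq> 0" "\<And>a. x a \<in> F" "\<And>a. E a \<in> D"
    "\<And>a b. E a (x b) m = (if a = b then 1 else 0)"
    and v: "\<And>m' v f. \<beta> m' \<noteq> 0 \<Longrightarrow> point_derivation m' v \<Longrightarrow> f \<in> F \<Longrightarrow> v f = (\<Sum>a\<in>UNIV. v (x a) * E a f m')"
    using coordinate_frame[OF assms] by blast
  have "\<beta> m' * Z f m' = (\<Sum>a\<in>UNIV. (\<beta> m' * Z (x a) m') * E a f m')" if "Z \<in> D" "f \<in> F" for Z f m'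
  proof (cases "\<beta> m' = 0")
    case False
    then show ?thesis
      using v[OF False der_point_derivation[OF that(1)] that(2)] by (simp add: sum_distrib_left mult.assoc)
  qed simp
  then show ?thesis using c by (intro bexI[of _ \<beta>] exI[of _ x] exI[of _ E]) auto
qed

end

section \<open>Vector fields\<close>

lemma bit_cases: "(i :: bit) = 0 \<or> i = 1"
  by (cases i) auto

lemma koszul_simps [simp]: "koszul 0 j = 1" "koszul i 0 = 1" "koszul 1 1 = - 1"
  by (simp_all add: koszul_def)

context odd_line_manifold begin

abbreviation zF :: "'p \<Rightarrow> real" where "zF \<equiv> (\<lambda>_. 0)"
abbreviation zD :: "('p \<Rightarrow> real) \<Rightarrow> 'p \<Rightarrow> real" where "zD \<equiv> (\<lambda>_ _. 0)"

lemma F_times_cst: "f \<in> F \<Longrightarrow> f m * cst r m = r * f m" "f \<in> F \<Longrightarrow> cst r m * f m = r * f m"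
  by (auto simp: cst_def F_outside)

definition mk :: "('p \<Rightarrow> real) \<Rightarrow> ('p \<Rightarrow> real) \<Rightarrow> 'f"
  where "mk f h = (THE a. a \<in> carrier A \<and> e0 a = f \<and> e1 a = h)"

lemma mk:
  assumes "f \<in> F" "h \<in> F"
  shows "mk f h \<in> carrier A" "e0 (mk f h) = f" "e1 (mk f h) = h"
proof -
  have "\<exists>!a. a \<in> carrier A \<and> e0 a = f \<and> e1 a = h"
    using A_surj[OF assms] by (auto intro: A_eqI)
  from theI'[OF this] show "mk f h \<in> carrier A" "e0 (mk f h) = f" "e1 (mk f h) = h"
    by (simp_all add: mk_def)
qed

lemma A_closed [simp]:
  "\<zero>\<^bsub>A\<^esub> \<in> carrier A" "\<one>\<^bsub>A\<^esub> \<in> carrier A"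
  "f \<in> carrier A \<Longrightarrow> k \<in> carrier A \<Longrightarrow> f \<oplus>\<^bsub>A\<^esub> k \<in> carrier A"
  "f \<in> carrier A \<Longrightarrow> k \<in> carrier A \<Longrightarrow> f \<otimes>\<^bsub>A\<^esub> k \<in> carrier A"
  "f \<in> carrier A \<Longrightarrow> r \<odot>\<^bsub>A\<^esub> f \<in> carrier A"
  using superalgebra_smult_closed[OF superalgebra_A] ring.ring_simprules[OF ring_A] by simp_all

lemma homog_A: "f \<in> homog A i \<Longrightarrow> f \<in> carrier A"
  using homog_subset_carrier[OF superalgebra_A] by blast

lemma A_eqI':
  "f \<in> carrier A \<Longrightarrow> f' \<in> carrier A \<Longrightarrow> (\<And>m. e0 f m = e0 f' m) \<Longrightarrow> (\<And>m. e1 f m = e1 f' m) \<Longrightarrow> f = f'"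
  by (rule A_eqI) (simp_all add: fun_eq_iff)

text \<open>For the converse directions, split f by parity: the component of the wrong parity has
  both coefficients zero, hence vanishes.\<close>

lemma homog_iff:
  "f \<in> homog A 0 \<longleftrightarrow> f \<in> carrier A \<and> e1 f = zF"
  "f \<in> homog A 1 \<longleftrightarrow> f \<in> carrier A \<and> e0 f = zF"
proof -
  interpret ring A by (rule ring_A)
  have split: "\<exists>f0\<in>homog A 0. \<exists>f1\<in>homog A 1. f = f0 \<oplus>\<^bsub>A\<^esub> f1" if "f \<in> carrier A"
    by (rule superalgebraD(4)[OF superalgebra_A that])
  show "f \<in> homog A 0 \<longleftrightarrow> f \<in> carrier A \<and> e1 f = zF"
  proof
    assume f: "f \<in> carrier A \<and> e1 f = zF"
    then obtain f0 f1 where ff: "f0 \<in> homog A 0" "f1 \<in> homog A 1" "f = f0 \<oplus>\<^bsub>A\<^esub> f1" using split by blast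
    have "f1 = \<zero>\<^bsub>A\<^esub>"
      by (rule A_eqI') (use f ff homog_A e_algebra(2)[of f0 f1] e_algebra(9)[of f1] e_algebra(10)[of f0] in \<open>auto simp: e_zero fun_eq_iff\<close>)
    then show "f \<in> homog A 0" using ff homog_A[OF ff(1)] by simp
  qed (use homog_A e_algebra(10) in blast)
  show "f \<in> homog A 1 \<longleftrightarrow> f \<in> carrier A \<and> e0 f = zF"
  proof
    assume f: "f \<in> carrier A \<and> e0 f = zF"
    then obtain f0 f1 where ff: "f0 \<in> homog A 0" "f1 \<in> homog A 1" "f = f0 \<oplus>\<^bsub>A\<^esub> f1" using split by blast
    have "f0 = \<zero>\<^bsub>A\<^esub>"
      by (rule A_eqI') (use f ff homog_A e_algebra(1)[of f0 f1] e_algebra(9)[of f1] e_algebra(10)[of f0] in \<open>auto simp: e_zero fun_eq_iff\<close>)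
    then show "f \<in> homog A 1" using ff homog_A[OF ff(2)] by simp
  qed (use homog_A e_algebra(9) in blast)
qed

text \<open>
  \<open>VF a b c d\<close> is the vector field $X$ with $Xf = a f + (b f)\tau$ for even $f$ and $X\tau = c + d\tau$;
  its even part is \<open>(a, d)\<close> and its odd part \<open>(b, c)\<close>.
\<close>

definition VF :: "(('p \<Rightarrow> real) \<Rightarrow> 'p \<Rightarrow> real) \<Rightarrow> (('p \<Rightarrow> real) \<Rightarrow> 'p \<Rightarrow> real) \<Rightarrow> ('p \<Rightarrow> real) \<Rightarrow> ('p \<Rightarrow> real) \<Rightarrow> 'f \<Rightarrow> 'f"
  where "VF a b c d = (\<lambda>x\<in>carrier A. mk (\<lambda>m. a (e0 x) m + e1 x m * c m) (\<lambda>m. a (e1 x) m + b (e0 x) m + e1 x m * d m))"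

lemma VF_apply:
  assumes "a \<in> D" "b \<in> D" "c \<in> F" "d \<in> F" "x \<in> carrier A"
  shows "VF a b c d x \<in> carrier A"
    and "e0 (VF a b c d x) m = a (e0 x) m + e1 x m * c m"
    and "e1 (VF a b c d x) m = a (e1 x) m + b (e0 x) m + e1 x m * d m"
proof -
  have "(\<lambda>m. a (e0 x) m + e1 x m * c m) \<in> F" "(\<lambda>m. a (e1 x) m + b (e0 x) m + e1 x m * d m) \<in> F"
    using assms e_F[OF assms(5)] der_F[of a] der_F[of b] by simp_all
  note mk[OF this]
  then show "VF a b c d x \<in> carrier A" "e0 (VF a b c d x) m = a (e0 x) m + e1 x m * c m"
    "e1 (VF a b c d x) m = a (e1 x) m + b (e0 x) m + e1 x m * d m"
    using assms(5) by (simp_all add: VF_def)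
qed

lemma VF_ext: "VF a b c d \<in> extensional (carrier A)"
  by (simp add: VF_def)

lemma VF_eqI:
  assumes "a \<in> D" "b \<in> D" "c \<in> F" "d \<in> F" "Z \<in> extensional (carrier A)"
    and "\<And>x. x \<in> carrier A \<Longrightarrow> Z x \<in> carrier A"
    and "\<And>x m. x \<in> carrier A \<Longrightarrow> e0 (Z x) m = a (e0 x) m + e1 x m * c m"
    and "\<And>x m. x \<in> carrier A \<Longrightarrow> e1 (Z x) m = a (e1 x) m + b (e0 x) m + e1 x m * d m"
  shows "Z = VF a b c d"
proof (rule extensionalityI[OF assms(5) VF_ext])
  fix x assume x: "x \<in> carrier A"
  show "Z x = VF a b c d x"
    by (rule A_eqI') (use assms x in \<open>simp_all add: VF_apply\<close>)
qed

lemma VF_linear: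
  assumes "a \<in> D" "b \<in> D" "c \<in> F" "d \<in> F"
  shows "x \<in> carrier A \<Longrightarrow> y \<in> carrier A \<Longrightarrow> VF a b c d (x \<oplus>\<^bsub>A\<^esub> y) = VF a b c d x \<oplus>\<^bsub>A\<^esub> VF a b c d y"
    and "x \<in> carrier A \<Longrightarrow> VF a b c d (r \<odot>\<^bsub>A\<^esub> x) = r \<odot>\<^bsub>A\<^esub> VF a b c d x"
proof -
  note V = VF_apply[OF assms]
  show "VF a b c d (x \<oplus>\<^bsub>A\<^esub> y) = VF a b c d x \<oplus>\<^bsub>A\<^esub> VF a b c d y" if "x \<in> carrier A" "y \<in> carrier A"
    by (rule A_eqI') (use that assms in \<open>simp_all add: V e_algebra e_F der_sum_fun[OF assms(1)] der_sum_fun[OF assms(2)] algebra_simps\<close>)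
  show "VF a b c d (r \<odot>\<^bsub>A\<^esub> x) = r \<odot>\<^bsub>A\<^esub> VF a b c d x" if "x \<in> carrier A"
    by (rule A_eqI') (use that assms in \<open>simp_all add: V e_algebra e_F der_scale_fun[OF assms(1)] der_scale_fun[OF assms(2)] algebra_simps\<close>)
qed

lemma VF_even:
  assumes a: "a \<in> D" and d: "d \<in> F"
  shows "VF a zD zF d \<in> Vect_homog M 0"
proof -
  note V = VF_apply[OF a D_zero F_zero d]
  have "VF a zD zF d f \<in> homog A (0 + j)" if "f \<in> homog A j" for f j
  proof -
    note V' = V[OF homog_A[OF that]]
    show ?thesis
    proof (cases "j = 0")
      case True
      then have "e1 f = zF" using that homog_iff(1) by simp
      then show ?thesis using True V'(1) by (simp add: homog_iff, intro ext) (simp add: V' der_zero[OF a])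
    next
      case False
      then have j: "j = 1" using bit_cases by blast
      then have "e0 f = zF" using that homog_iff(2) by simp
      then show ?thesis using j V'(1) by (simp add: homog_iff, intro ext) (simp add: V' der_zero[OF a])
    qed
  qed
  moreover have "VF a zD zF d (f \<otimes>\<^bsub>A\<^esub> h) = (VF a zD zF d f \<otimes>\<^bsub>A\<^esub> h) \<oplus>\<^bsub>A\<^esub> (koszul 0 j \<odot>\<^bsub>A\<^esub> (f \<otimes>\<^bsub>A\<^esub> VF a zD zF d h))"
    if "f \<in> homog A j" "h \<in> carrier A" for f h j
    by (rule A_eqI')
      (use homog_A[OF that(1)] that(2) a d in \<open>simp_all add: V e_algebra e_F der_sum_fun[OF a] der_mult_fun[OF a] algebra_simps\<close>)
  ultimately show ?thesis
    using VF_linear[OF a D_zero F_zero d] V(1) VF_ext unfolding Vect_homog_def by (auto simp: PiE_def)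
qed

lemma VF_odd:
  assumes b: "b \<in> D" and c: "c \<in> F"
  shows "VF zD b c zF \<in> Vect_homog M 1"
proof -
  note V = VF_apply[OF D_zero b c F_zero]
  have "VF zD b c zF f \<in> homog A (1 + j)" if "f \<in> homog A j" for f j
  proof -
    note V' = V[OF homog_A[OF that]]
    show ?thesis
    proof (cases "j = 0")
      case True
      then have "e1 f = zF" using that homog_iff(1) by simp
      then show ?thesis using True V'(1) by (simp add: homog_iff, intro ext) (simp add: V' der_zero[OF b])
    next
      case False
      then have j: "j = 1" using bit_cases by blast
      then have "e0 f = zF" using that homog_iff(2) by simp
      then show ?thesis using j V'(1) by (simp add: homog_iff, intro ext) (simp add: V' der_zero[OF b])
    qed
  qed
  moreover have "VF zD b c zF (f \<otimes>\<^bsub>A\<^esub> h) = (VF zD b c zF f \<otimes>\<^bsub>A\<^esub> h) \<oplus>\<^bsub>A\<^esub> (koszul 1 j \<odot>\<^bsub>A\<^esub> (f \<otimes>\<^bsub>A\<^esub> VF zD b c zF h))"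
    if fj: "f \<in> homog A j" and h: "h \<in> carrier A" for f h j
  proof (cases "j = 0")
    case True
    have f: "f \<in> carrier A" "e1 f = zF" using fj homog_iff(1) True by auto
    show ?thesis unfolding True
      by (rule A_eqI') (use f h b c in \<open>simp_all add: V e_algebra e_F der_sum_fun[OF b] der_mult_fun[OF b] algebra_simps\<close>)
  next
    case False
    then have j: "j = 1" using bit_cases by blast
    \<comment> \<open>For odd f the product rule needs the sign: with f = f1\<tau> and h = h0 +
      h1\<tau> the two terms in f1 h1 c \<tau> cancel.\<close>
    have f: "f \<in> carrier A" "e0 f = zF" using fj homog_iff(2) j by auto
    show ?thesis unfolding j
      by (rule A_eqI') (use f h b c in \<open>simp_all add: V e_algebra e_F der_zero[OF b] algebra_simps\<close>)
  qed
  ultimately show ?thesis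
    using VF_linear[OF D_zero b c F_zero] V(1) VF_ext unfolding Vect_homog_def by (auto simp: PiE_def)
qed

lemma vf_add_VF:
  assumes "a \<in> D" "b \<in> D" "c \<in> F" "d \<in> F" "a' \<in> D" "b' \<in> D" "c' \<in> F" "d' \<in> F"
  shows "vf_add M (VF a b c d) (VF a' b' c' d') = VF (der_add a a') (der_add b b') (\<lambda>m. c m + c' m) (\<lambda>m. d m + d' m)"
  by (rule VF_eqI)
    (use assms in \<open>simp_all add: vf_add_def VF_apply e_algebra der_add_apply algebra_simps\<close>)

lemma vf_mult_VF:
  assumes "a \<in> D" "b \<in> D" "c \<in> F" "d \<in> F" "f \<in> carrier A"
  shows "vf_mult M f (VF a b c d) = VF (der_mult (e0 f) a) (der_add (der_mult (e0 f) b) (der_mult (e1 f) a))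
      (\<lambda>m. e0 f m * c m) (\<lambda>m. e0 f m * d m + e1 f m * c m)"
  by (rule VF_eqI)
    (use assms e_F[OF assms(5)] in \<open>simp_all add: vf_mult_def VF_apply e_algebra der_add_apply der_mult_apply algebra_simps\<close>)

lemma vf_scale_VF:
  assumes "a \<in> D" "b \<in> D" "c \<in> F" "d \<in> F"
  shows "vf_scale M r (VF a b c d) = VF (der_mult (cst r) a) (der_mult (cst r) b) (\<lambda>m. r * c m) (\<lambda>m. r * d m)"
  by (rule VF_eqI)
    (use assms in \<open>simp_all add: vf_scale_def VF_apply e_algebra der_mult_apply F_times_cst der_F[OF assms(1)] der_F[OF assms(2)] algebra_simps\<close>)

text \<open>Every function is x0 + x1\<tau> with even x0, x1, and the Leibniz rule for an even left
  factor has no sign. So the values of Z on even functions and on \<tau> determine it; the two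
  coefficients of its values on even functions are derivations of F.\<close>

lemma Vect_homog_VF:
  assumes Z: "Z \<in> Vect_homog M i"
  shows "\<exists>a\<in>D. \<exists>b\<in>D. \<exists>c\<in>F. \<exists>d\<in>F. Z = VF a b c d \<and> (i = 0 \<longrightarrow> b = zD \<and> c = zF) \<and> (i = 1 \<longrightarrow> a = zD \<and> d = zF)"
proof -
  have Zc: "Z x \<in> carrier A" if "x \<in> carrier A" for x using Z that by (auto simp: Vect_homog_def)
  have Zext: "Z \<in> extensional (carrier A)" using Z by (auto simp: Vect_homog_def PiE_def)
  have Zadd: "Z (f \<oplus>\<^bsub>A\<^esub> h) = Z f \<oplus>\<^bsub>A\<^esub> Z h" if "f \<in> carrier A" "h \<in> carrier A" for f h
    using Z that by (auto simp: Vect_homog_def)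
  have Zscale: "Z (r \<odot>\<^bsub>A\<^esub> f) = r \<odot>\<^bsub>A\<^esub> Z f" if "f \<in> carrier A" for r f
    using Z that by (auto simp: Vect_homog_def)
  have Zpar: "Z f \<in> homog A (i + j)" if "f \<in> homog A j" for f j
    using Z that by (auto simp: Vect_homog_def)
  have Zmult: "Z (f \<otimes>\<^bsub>A\<^esub> h) = (Z f \<otimes>\<^bsub>A\<^esub> h) \<oplus>\<^bsub>A\<^esub> (koszul i j \<odot>\<^bsub>A\<^esub> (f \<otimes>\<^bsub>A\<^esub> Z h))"
    if "f \<in> homog A j" "h \<in> carrier A" for f h j
    using Z that unfolding Vect_homog_def by blast
  define l where "l f = mk f zF" for f
  define \<tau> where "\<tau> = mk zF (cst 1)"
  have l: "l f \<in> carrier A" "e0 (l f) = f" "e1 (l f) = zF" "l f \<in> homog A 0" if "f \<in> F" for f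
    using mk[OF that F_zero] by (simp_all add: l_def homog_iff)
  have \<tau>: "\<tau> \<in> carrier A" "e0 \<tau> = zF" "e1 \<tau> = cst 1" "\<tau> \<in> homog A 1"
    using mk[OF F_zero F_cst[of 1]] by (simp_all add: \<tau>_def homog_iff)
  define a where "a f = (if f \<in> F then e0 (Z (l f)) else zF)" for f
  define b where "b f = (if f \<in> F then e1 (Z (l f)) else zF)" for f
  define c where "c = e0 (Z \<tau>)"
  define d where "d = e1 (Z \<tau>)"
  have cd: "c \<in> F" "d \<in> F" using e_F[OF Zc[OF \<tau>(1)]] by (simp_all add: c_def d_def)
  have Zl: "Z (l f) \<in> carrier A" if "f \<in> F" for f using Zc l that by blast
  have add: "Z (l (\<lambda>m. f m + h m)) = Z (l f) \<oplus>\<^bsub>A\<^esub> Z (l h)" if "f \<in> F" "h \<in> F" for f h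
  proof -
    have "l (\<lambda>m. f m + h m) = l f \<oplus>\<^bsub>A\<^esub> l h"
      by (rule A_eqI') (use that in \<open>simp_all add: l e_algebra\<close>)
    then show ?thesis using Zadd l that by simp
  qed
  have scale: "Z (l (\<lambda>m. r * f m)) = r \<odot>\<^bsub>A\<^esub> Z (l f)" if "f \<in> F" for f r
  proof -
    have "l (\<lambda>m. r * f m) = r \<odot>\<^bsub>A\<^esub> l f"
      by (rule A_eqI') (use that in \<open>simp_all add: l e_algebra\<close>)
    then show ?thesis using Zscale l that by simp
  qed
  have mult: "Z (l (\<lambda>m. f m * h m)) = (Z (l f) \<otimes>\<^bsub>A\<^esub> l h) \<oplus>\<^bsub>A\<^esub> (1 \<odot>\<^bsub>A\<^esub> (l f \<otimes>\<^bsub>A\<^esub> Z (l h)))" if "f \<in> F" "h \<in> F" for f h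
  proof -
    have "l (\<lambda>m. f m * h m) = l f \<otimes>\<^bsub>A\<^esub> l h"
      by (rule A_eqI') (use that in \<open>simp_all add: l e_algebra\<close>)
    then show ?thesis using Zmult[OF l(4)[OF that(1)] l(1)[OF that(2)]] by simp
  qed
  have aD: "a \<in> D"
    by (rule D_I) (simp_all add: a_def e_F Zl add scale mult e_algebra l)
  have bD: "b \<in> D"
    by (rule D_I) (simp_all add: b_def e_F Zl add scale mult e_algebra l)
  have eq: "Z = VF a b c d"
  proof (rule VF_eqI[OF aD bD cd Zext Zc])
    fix x m assume x: "x \<in> carrier A"
    note xF = e_F[OF x]
    \<comment> \<open>Here l embeds F as the even functions.\<close>
    have "x = l (e0 x) \<oplus>\<^bsub>A\<^esub> (l (e1 x) \<otimes>\<^bsub>A\<^esub> \<tau>)"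
      by (rule A_eqI') (use x xF in \<open>simp_all add: l \<tau> e_algebra F_times_cst\<close>)
    then have "Z x = Z (l (e0 x)) \<oplus>\<^bsub>A\<^esub> Z (l (e1 x) \<otimes>\<^bsub>A\<^esub> \<tau>)"
      using Zadd[of "l (e0 x)" "l (e1 x) \<otimes>\<^bsub>A\<^esub> \<tau>"] l xF \<tau> by simp
    also have "Z (l (e1 x) \<otimes>\<^bsub>A\<^esub> \<tau>) = (Z (l (e1 x)) \<otimes>\<^bsub>A\<^esub> \<tau>) \<oplus>\<^bsub>A\<^esub> (1 \<odot>\<^bsub>A\<^esub> (l (e1 x) \<otimes>\<^bsub>A\<^esub> Z \<tau>))"
      using Zmult[OF l(4)[OF xF(2)] \<tau>(1)] by simp
    finally have Zx: "Z x = Z (l (e0 x)) \<oplus>\<^bsub>A\<^esub> ((Z (l (e1 x)) \<otimes>\<^bsub>A\<^esub> \<tau>) \<oplus>\<^bsub>A\<^esub> (1 \<odot>\<^bsub>A\<^esub> (l (e1 x) \<otimes>\<^bsub>A\<^esub> Z \<tau>)))" .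
    show "e0 (Z x) m = a (e0 x) m + e1 x m * c m" "e1 (Z x) m = a (e1 x) m + b (e0 x) m + e1 x m * d m"
      unfolding Zx using xF Zl[OF xF(1)] Zl[OF xF(2)] Zc[OF \<tau>(1)] e_F[OF Zl[OF xF(2)]]
      by (simp_all add: e_algebra l \<tau> a_def b_def c_def d_def F_times_cst)
  qed
  have "b = zD \<and> c = zF" if "i = 0"
  proof -
    have "e1 (Z (l f)) = zF" if "f \<in> F" for f using Zpar[OF l(4)[OF that]] \<open>i = 0\<close> homog_iff by simp
    moreover have "e0 (Z \<tau>) = zF" using Zpar[OF \<tau>(4)] \<open>i = 0\<close> homog_iff by simp
    ultimately show ?thesis by (auto simp: b_def c_def fun_eq_iff)
  qed
  moreover have "a = zD \<and> d = zF" if "i = 1"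
  proof -
    have "e0 (Z (l f)) = zF" if "f \<in> F" for f using Zpar[OF l(4)[OF that]] \<open>i = 1\<close> homog_iff by simp
    moreover have "e1 (Z \<tau>) = zF" using Zpar[OF \<tau>(4)] \<open>i = 1\<close> homog_iff by simp
    ultimately show ?thesis by (auto simp: a_def d_def fun_eq_iff)
  qed
  ultimately show ?thesis using aD bD cd eq by blast
qed

lemma Vect_iff: "Z \<in> Vect M \<longleftrightarrow> (\<exists>a\<in>D. \<exists>b\<in>D. \<exists>c\<in>F. \<exists>d\<in>F. Z = VF a b c d)"
proof
  assume "Z \<in> Vect M"
  then obtain Z0 Z1 where Z: "Z = vf_add M Z0 Z1" "Z0 \<in> Vect_homog M 0" "Z1 \<in> Vect_homog M 1"
    by (auto simp: Vect_def)
  obtain a b c d where 0: "a \<in> D" "b \<in> D" "c \<in> F" "d \<in> F" "Z0 = VF a b c d"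
    using Vect_homog_VF[OF Z(2)] by blast
  obtain a' b' c' d' where 1: "a' \<in> D" "b' \<in> D" "c' \<in> F" "d' \<in> F" "Z1 = VF a' b' c' d'"
    using Vect_homog_VF[OF Z(3)] by blast
  have "Z = VF (der_add a a') (der_add b b') (\<lambda>m. c m + c' m) (\<lambda>m. d m + d' m)"
    unfolding Z(1) 0(5) 1(5) using 0 1 by (intro vf_add_VF)
  then show "\<exists>a\<in>D. \<exists>b\<in>D. \<exists>c\<in>F. \<exists>d\<in>F. Z = VF a b c d"
    using 0 1 D_add F_add by blast
next
  assume "\<exists>a\<in>D. \<exists>b\<in>D. \<exists>c\<in>F. \<exists>d\<in>F. Z = VF a b c d"
  then obtain a b c d where Z: "a \<in> D" "b \<in> D" "c \<in> F" "d \<in> F" "Z = VF a b c d" by blast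
  have "Z = vf_add M (VF a zD zF d) (VF zD b c zF)"
    using Z vf_add_VF[of a zD zF d zD b c zF] by (simp add: der_add_def)
  then show "Z \<in> Vect M" using VF_even[OF Z(1,4)] VF_odd[OF Z(2,3)] unfolding Vect_def by blast
qed

text \<open>The four components of a vector field are recovered from its values on even functions
  and on \<tau> = \<open>mk zF (cst 1)\<close>.\<close>

definition vA where "vA Z = (\<lambda>f. if f \<in> F then e0 (Z (mk f zF)) else zF)"
definition vB where "vB Z = (\<lambda>f. if f \<in> F then e1 (Z (mk f zF)) else zF)"
definition vC where "vC Z = e0 (Z (mk zF (cst 1)))"
definition vD where "vD Z = e1 (Z (mk zF (cst 1)))"

lemma v_VF:
  assumes "a \<in> D" "b \<in> D" "c \<in> F" "d \<in> F"
  shows "vA (VF a b c d) = a" "vB (VF a b c d) = b" "vC (VF a b c d) = c" "vD (VF a b c d) = d"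
proof -
  note V = VF_apply[OF assms]
  show "vA (VF a b c d) = a"
    using assms by (intro ext) (simp add: vA_def V mk der_notin)
  show "vB (VF a b c d) = b"
    using assms by (intro ext) (simp add: vB_def V mk der_notin der_zero[OF assms(1)])
  show "vC (VF a b c d) = c"
    using assms by (intro ext) (simp add: vC_def V mk der_zero[OF assms(1)] F_times_cst)
  show "vD (VF a b c d) = d"
    using assms by (intro ext) (simp add: vD_def V mk der_zero[OF assms(2)] der_cst[OF assms(1)] F_times_cst)
qed

lemma Vect_VF:
  assumes "Z \<in> Vect M"
  shows "vA Z \<in> D" "vB Z \<in> D" "vC Z \<in> F" "vD Z \<in> F" "Z = VF (vA Z) (vB Z) (vC Z) (vD Z)"
proof -
  obtain a b c d where Z: "a \<in> D" "b \<in> D" "c \<in> F" "d \<in> F" "Z = VF a b c d"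
    using assms unfolding Vect_iff by blast
  note v = v_VF[OF Z(1-4), folded Z(5)]
  show "vA Z \<in> D" "vB Z \<in> D" "vC Z \<in> F" "vD Z \<in> F" "Z = VF (vA Z) (vB Z) (vC Z) (vD Z)"
    unfolding v by (rule Z)+
qed

lemma Vect_homog_Vect: "Z \<in> Vect_homog M i \<Longrightarrow> Z \<in> Vect M"
  using Vect_homog_VF[of Z i] unfolding Vect_iff by blast

lemma v_even:
  assumes "Z \<in> Vect_homog M 0"
  shows "vB Z = zD" "vC Z = zF"
proof -
  obtain a b c d where Z: "a \<in> D" "b \<in> D" "c \<in> F" "d \<in> F" "Z = VF a b c d" "b = zD" "c = zF"
    using Vect_homog_VF[OF assms] by blast
  show "vB Z = zD" "vC Z = zF"
    using v_VF[OF Z(1-4), folded Z(5)] Z(6,7) by simp_all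
qed

lemma v_odd:
  assumes "Z \<in> Vect_homog M 1"
  shows "vA Z = zD" "vD Z = zF"
proof -
  obtain a b c d where Z: "a \<in> D" "b \<in> D" "c \<in> F" "d \<in> F" "Z = VF a b c d" "a = zD" "d = zF"
    using Vect_homog_VF[OF assms] by blast
  show "vA Z = zD" "vD Z = zF"
    using v_VF[OF Z(1-4), folded Z(5)] Z(6,7) by simp_all
qed

lemma Q_Vect: "Q \<in> Vect M"
  by (rule Vect_homog_Vect[OF Q])

text \<open>The value of Q\<tau> is 1 by the definition of \<open>e1\<close> as the value of Qf; the
  \<tau>-coefficient of Q\<tau> vanishes by parity.\<close>

lemma v_Q: "vA Q = zD" "vC Q = cst 1" "vD Q = zF" "vB Q \<in> D"
proof -
  show "vA Q = zD" "vD Q = zF" "vB Q \<in> D" using v_odd[OF Q] Vect_VF[OF Q_Vect] by simp_all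
  show "vC Q = cst 1" using mk[OF F_zero F_cst[of 1]] by (simp add: vC_def e1_def[symmetric])
qed

end

section \<open>The connection of a super-null Riemannian manifold\<close>

text \<open>Tensoriality: after multiplication by a cutoff Z is a combination of frame fields, whose
  coefficients vanish at m.\<close>

lemma (in odd_line_manifold) F_linear_vanish:
  assumes l: "F_linear l" and Z: "Z \<in> D" and m: "m \<in> X" and zero: "\<And>f. f \<in> F \<Longrightarrow> Z f m = 0"
  shows "l Z m = 0"
proof -
  obtain \<beta> and x :: "'n \<Rightarrow> 'p \<Rightarrow> real" and E where \<beta>: "\<beta> \<in> F" "\<beta> m \<noteq> 0" and x: "\<And>a. x a \<in> F" and E: "\<And>a. E a \<in> D"
    and frame: "\<And>f m'. f \<in> F \<Longrightarrow> \<beta> m' * Z f m' = (\<Sum>a\<in>UNIV. (\<beta> m' * Z (x a) m') * E a f m')"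
    using local_frame_F[OF m] Z by blast
  have h: "(\<lambda>m'. \<beta> m' * Z (x a) m') \<in> F" for a by (intro F_mult \<beta> der_F[OF Z])
  have "der_mult \<beta> Z = (\<lambda>f m'. \<Sum>a\<in>UNIV. (\<beta> m' * Z (x a) m') * E a f m')"
  proof (rule der_eqI)
    show "(\<lambda>f m'. \<Sum>a\<in>UNIV. (\<beta> m' * Z (x a) m') * E a f m') \<in> D"
      by (rule D_sum) (use h E in simp_all)
  qed (use \<beta> Z frame in \<open>simp_all add: der_mult_apply\<close>)
  then have "l (der_mult \<beta> Z) m = (\<Sum>a\<in>UNIV. (\<beta> m * Z (x a) m) * l (E a) m)"
    using F_linear_sum[OF l finite, of UNIV "\<lambda>a m'. \<beta> m' * Z (x a) m'" E m] h E by simp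
  then have "\<beta> m * l Z m = 0"
    using l \<beta> Z zero[OF x] by (simp add: F_linear_def)
  then show ?thesis using \<beta> by simp
qed

lemma der_zero_simps [simp]:
  "der_mult (\<lambda>_. 0) u = (\<lambda>_ _. 0)" "der_mult f (\<lambda>_ _. 0) = (\<lambda>_ _. 0)"
  "der_add (\<lambda>_ _. 0) u = u" "der_add u (\<lambda>_ _. 0) = u"
  by (simp_all add: der_add_def der_mult_def)

lemma (in function_algebra) der_mult_cst_1: "u \<in> D \<Longrightarrow> der_mult (cst 1) u = u"
  by (rule der_eqI) (simp_all add: der_mult_apply, simp add: cst_def)

section \<open>The metric of a super-null Riemannian manifold\<close>

locale super_null =
  fixes N :: "'n::finite itself" and M :: "('p, 'f) superspace" and g Q P
  assumes super_null: "super_null_riemannian N M g Q P"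

sublocale super_null \<subseteq> odd_line_manifold N M Q
proof
  note c = super_null[unfolded super_null_riemannian_def]
  show "supermanifold N 1 M" "Q \<in> Vect_homog M 1" using c by simp_all
  fix m assume "m \<in> topspace (body M)"
  moreover have "\<forall>m\<in>topspace (body M). \<exists>U (V :: (real ^ 'n) set) \<phi> \<Phi> a.
        m \<in> U \<and> super_chart M 1 U V \<phi> \<Phi> \<and>
        vf_in_chart M U \<Phi> Q (\<lambda>h x I. d_odd 0 h x I + theta_mult 0 (d_even V a h) x I) \<and>
        vf_in_chart M U \<Phi> P (d_even V a)"
    using c by (elim conjE)
  ultimately obtain U and V :: "(real ^ 'n) set" and \<phi> \<Phi> a where
    "m \<in> U" "super_chart M 1 U V \<phi> \<Phi>" "vf_in_chart M U \<Phi> Q (\<lambda>h x I. d_odd 0 h x I + theta_mult 0 (d_even V a h) x I)"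
    by blast
  \<comment> \<open>At the empty index multiplication by \<theta> contributes nothing, and the odd
    derivative picks the coefficient of \<theta> with sign 1.\<close>
  then have "m \<in> U \<and> Q_chart M Q U V \<phi> \<Phi>"
    by (simp add: Q_chart_def vf_in_chart_def d_odd_def theta_mult_def)
  then show "\<exists>U (V :: (real ^ 'n) set) \<phi> \<Phi>. m \<in> U \<and> Q_chart M Q U V \<phi> \<Phi>" by blast
qed

context super_null begin

lemma metric: "metric M g"
  and metric_ker: "metric_ker M g = {vf_mult M f Q | f. f \<in> carrier A}"
  and metric_ker_at: "m \<in> X \<Longrightarrow> \<exists>w\<in>tangent_homog M m 1. w \<noteq> tv_zero M \<and> metric_ker_at M g m = {tv_scale M r w | r. True}"
proof -
  note c = super_null[unfolded super_null_riemannian_def]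
  show "metric M g" "metric_ker M g = {vf_mult M f Q | f. f \<in> carrier A}" using c by simp_all
  have "\<forall>m\<in>topspace (body M). \<exists>w\<in>tangent_homog M m 1.
        w \<noteq> tv_zero M \<and> metric_ker_at M g m = {tv_scale M r w | r. True}"
    using c by (elim conjE)
  then show "m \<in> X \<Longrightarrow> \<exists>w\<in>tangent_homog M m 1. w \<noteq> tv_zero M \<and> metric_ker_at M g m = {tv_scale M r w | r. True}"
    by blast
qed

lemma g_closed [simp]: "Y \<in> Vect M \<Longrightarrow> Z \<in> Vect M \<Longrightarrow> g Y Z \<in> carrier A"
  and g_parity: "Y \<in> Vect_homog M i \<Longrightarrow> Z \<in> Vect_homog M j \<Longrightarrow> g Y Z \<in> homog A (i + j)"
  and g_sym: "Y \<in> Vect_homog M i \<Longrightarrow> Z \<in> Vect_homog M j \<Longrightarrow> g Y Z = koszul i j \<odot>\<^bsub>A\<^esub> g Z Y"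
  and g_linear: "f \<in> carrier A \<Longrightarrow> Y \<in> Vect M \<Longrightarrow> Z \<in> Vect M \<Longrightarrow> W \<in> Vect M \<Longrightarrow>
    g (vf_add M (vf_mult M f Y) Z) W = (f \<otimes>\<^bsub>A\<^esub> g Y W) \<oplus>\<^bsub>A\<^esub> g Z W"
  and g_add_right: "Y \<in> Vect M \<Longrightarrow> Z \<in> Vect M \<Longrightarrow> W \<in> Vect M \<Longrightarrow> g Y (vf_add M Z W) = g Y Z \<oplus>\<^bsub>A\<^esub> g Y W"
  using metric unfolding metric_def by blast+

lemma VF_Vect: "a \<in> D \<Longrightarrow> b \<in> D \<Longrightarrow> c \<in> F \<Longrightarrow> d \<in> F \<Longrightarrow> VF a b c d \<in> Vect M"
  unfolding Vect_iff by blast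

lemma vf_mult_one: "Z \<in> Vect M \<Longrightarrow> vf_mult M \<one>\<^bsub>A\<^esub> Z = Z"
proof -
  assume "Z \<in> Vect M"
  then obtain a b c d where Z: "a \<in> D" "b \<in> D" "c \<in> F" "d \<in> F" "Z = VF a b c d"
    unfolding Vect_iff by blast
  interpret ring A by (rule ring_A)
  show ?thesis
    by (rule extensionalityI[of _ "carrier A"]) (use Z VF_ext VF_apply(1)[OF Z(1-4)] in \<open>auto simp: vf_mult_def\<close>)
qed

lemma g_add_left: "Y \<in> Vect M \<Longrightarrow> Z \<in> Vect M \<Longrightarrow> W \<in> Vect M \<Longrightarrow> g (vf_add M Y Z) W = g Y W \<oplus>\<^bsub>A\<^esub> g Z W"
proof -
  assume Z: "Y \<in> Vect M" "Z \<in> Vect M" "W \<in> Vect M"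
  interpret ring A by (rule ring_A)
  show ?thesis using g_linear[of "\<one>\<^bsub>A\<^esub>", OF _ Z] Z by (simp add: vf_mult_one)
qed

abbreviation "vf0 \<equiv> VF zD zD zF zF"

lemma vf0: "vf0 \<in> Vect M" by (simp add: VF_Vect)

lemma g_zero_left: "Z \<in> Vect M \<Longrightarrow> e0 (g vf0 Z) = zF" "Z \<in> Vect M \<Longrightarrow> e1 (g vf0 Z) = zF"
proof -
  assume Z: "Z \<in> Vect M"
  have "vf_add M vf0 vf0 = vf0" by (simp add: vf_add_VF)
  then have "g vf0 Z = g vf0 Z \<oplus>\<^bsub>A\<^esub> g vf0 Z" using g_add_left[OF vf0 vf0 Z] by simp
  then have "e0 (g vf0 Z) = (\<lambda>m. e0 (g vf0 Z) m + e0 (g vf0 Z) m)" "e1 (g vf0 Z) = (\<lambda>m. e1 (g vf0 Z) m + e1 (g vf0 Z) m)"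
    using e_algebra(1,2)[of "g vf0 Z" "g vf0 Z"] vf0 Z by simp_all
  then show "e0 (g vf0 Z) = zF" "e1 (g vf0 Z) = zF" by (simp_all add: fun_eq_iff)
qed

lemma VF_add_zero: "a \<in> D \<Longrightarrow> b \<in> D \<Longrightarrow> c \<in> F \<Longrightarrow> d \<in> F \<Longrightarrow> vf_add M (VF a b c d) vf0 = VF a b c d"
  by (simp add: vf_add_VF)

lemma vf_mult_Vect: "f \<in> carrier A \<Longrightarrow> Z \<in> Vect M \<Longrightarrow> vf_mult M f Z \<in> Vect M"
proof -
  assume f: "f \<in> carrier A" and "Z \<in> Vect M"
  then obtain a b c d where Z: "a \<in> D" "b \<in> D" "c \<in> F" "d \<in> F" "Z = VF a b c d"
    unfolding Vect_iff by blast
  show ?thesis unfolding Z(5) vf_mult_VF[OF Z(1-4) f] using Z e_F[OF f] by (intro VF_Vect) simp_all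
qed

lemma g_mult_left:
  assumes f: "f \<in> carrier A" and Y: "Y \<in> Vect M" and Z: "Z \<in> Vect M"
  shows "e0 (g (vf_mult M f Y) Z) m = e0 f m * e0 (g Y Z) m"
    and "e1 (g (vf_mult M f Y) Z) m = e0 f m * e1 (g Y Z) m + e1 f m * e0 (g Y Z) m"
proof -
  obtain a b c d where fY: "a \<in> D" "b \<in> D" "c \<in> F" "d \<in> F" "vf_mult M f Y = VF a b c d"
    using vf_mult_Vect[OF f Y] unfolding Vect_iff by blast
  have "g (vf_mult M f Y) Z = (f \<otimes>\<^bsub>A\<^esub> g Y Z) \<oplus>\<^bsub>A\<^esub> g vf0 Z"
    using g_linear[OF f Y vf0 Z] VF_add_zero[OF fY(1-4)] fY(5) by simp
  then show "e0 (g (vf_mult M f Y) Z) m = e0 f m * e0 (g Y Z) m"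
    "e1 (g (vf_mult M f Y) Z) m = e0 f m * e1 (g Y Z) m + e1 f m * e0 (g Y Z) m"
    using f Y Z vf0 by (simp_all add: e_algebra g_zero_left)
qed

lemma g_Q: "Z \<in> Vect M \<Longrightarrow> g Q Z = \<zero>\<^bsub>A\<^esub>"
proof -
  have "Q \<in> metric_ker M g"
    unfolding metric_ker using vf_mult_one[OF Q_Vect] A_closed(2) by (auto intro!: exI[of _ "\<one>\<^bsub>A\<^esub>"])
  then show "Z \<in> Vect M \<Longrightarrow> g Q Z = \<zero>\<^bsub>A\<^esub>" by (simp add: metric_ker_def)
qed

section \<open>Components adapted to the kernel\<close>

text \<open>For even f one has Qf = (P0 f)\<tau>, so Q applied twice acts on F as P0. Since [Q,Q] =
  2P, this is the action of P on F, in Shander coordinates \<partial>/\<partial>t.\<close>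

definition P0 where "P0 = vB Q"

lemma P0_D [simp]: "P0 \<in> D" by (simp add: P0_def v_Q)

lemma Q_VF: "Q = VF zD P0 (cst 1) zF"
  using Vect_VF(5)[OF Q_Vect] by (simp add: v_Q P0_def)

text \<open>
  \<open>WF a b c d\<close> is $a + \tau b + (c + d\tau)Q$, where derivations of $F$ act as vector fields killing $\tau$;
  in these coordinates the kernel of the metric is \<open>a = b = 0\<close>.
\<close>

definition WF where "WF a b c d = VF a (der_add b (der_mult c P0)) c d"
text \<open>Recovers the \<open>b\<close> of \<open>WF\<close> by removing from \<open>vB\<close>
  what the multiple of Q contributes to it.\<close>

definition vQ where "vQ Z = der_add (vB Z) (der_mult (\<lambda>m. - vC Z m) P0)"

lemma WF_Vect [simp]: "a \<in> D \<Longrightarrow> b \<in> D \<Longrightarrow> c \<in> F \<Longrightarrow> d \<in> F \<Longrightarrow> WF a b c d \<in> Vect M"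
  by (simp add: WF_def VF_Vect)

lemma v_WF:
  assumes "a \<in> D" "b \<in> D" "c \<in> F" "d \<in> F"
  shows "vA (WF a b c d) = a" "vQ (WF a b c d) = b" "vB (WF a b c d) = der_add b (der_mult c P0)" "vC (WF a b c d) = c" "vD (WF a b c d) = d"
  using assms by (simp_all add: WF_def vQ_def v_VF) (simp add: der_add_def der_mult_def)

lemma Vect_WF:
  assumes "Z \<in> Vect M"
  obtains a b c d where "a \<in> D" "b \<in> D" "c \<in> F" "d \<in> F" "Z = WF a b c d"
proof -
  note v = Vect_VF[OF assms]
  have "der_add (vQ Z) (der_mult (vC Z) P0) = vB Z"
    by (simp add: vQ_def der_add_def der_mult_def)
  then have "Z = WF (vA Z) (vQ Z) (vC Z) (vD Z)" using v(5) by (simp add: WF_def)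
  moreover have "vQ Z \<in> D" using v by (simp add: vQ_def)
  ultimately show thesis using that v by blast
qed

lemma WF_cong: "a = a' \<Longrightarrow> b = b' \<Longrightarrow> c = c' \<Longrightarrow> d = d' \<Longrightarrow> WF a b c d = WF a' b' c' d'"
  by simp

lemma vf_add_WF:
  assumes "a \<in> D" "b \<in> D" "c \<in> F" "d \<in> F" "a' \<in> D" "b' \<in> D" "c' \<in> F" "d' \<in> F"
  shows "vf_add M (WF a b c d) (WF a' b' c' d') = WF (der_add a a') (der_add b b') (\<lambda>m. c m + c' m) (\<lambda>m. d m + d' m)"
  using assms by (simp add: WF_def vf_add_VF) (simp add: der_add_def der_mult_def algebra_simps)

lemma vf_mult_WF:
  assumes "a \<in> D" "b \<in> D" "c \<in> F" "d \<in> F" "f \<in> carrier A"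
  shows "vf_mult M f (WF a b c d) = WF (der_mult (e0 f) a) (der_add (der_mult (e0 f) b) (der_mult (e1 f) a))
      (\<lambda>m. e0 f m * c m) (\<lambda>m. e0 f m * d m + e1 f m * c m)"
  using assms by (simp add: WF_def vf_mult_VF) (simp add: der_add_def der_mult_def algebra_simps)

lemma vf_scale_WF:
  assumes "a \<in> D" "b \<in> D" "c \<in> F" "d \<in> F"
  shows "vf_scale M r (WF a b c d) = WF (der_mult (cst r) a) (der_mult (cst r) b) (\<lambda>m. r * c m) (\<lambda>m. r * d m)"
proof -
  have "der_mult (cst r) (der_add b (der_mult c P0)) = der_add (der_mult (cst r) b) (der_mult (\<lambda>m. r * c m) P0)"
  proof (intro ext)
    fix f m
    show "der_mult (cst r) (der_add b (der_mult c P0)) f m = der_add (der_mult (cst r) b) (der_mult (\<lambda>m. r * c m) P0) f m"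
      using F_outside[OF assms(3)]
      by (cases "m \<in> X") (simp_all add: der_add_apply der_mult_apply cst_def algebra_simps)
  qed
  then show ?thesis using assms by (simp add: WF_def vf_scale_VF)
qed

lemma Vect_even_WF:
  assumes "Z \<in> Vect_homog M 0"
  obtains a d where "a \<in> D" "d \<in> F" "Z = WF a zD zF d"
proof -
  note v = Vect_VF[OF Vect_homog_Vect[OF assms]]
  have "Z = WF (vA Z) zD zF (vD Z)" using v(5) v_even[OF assms] by (simp add: WF_def der_add_def der_mult_def)
  then show thesis using that v by blast
qed

lemma Vect_odd_WF:
  assumes "Z \<in> Vect_homog M 1"
  obtains b c where "b \<in> D" "c \<in> F" "Z = WF zD b c zF"
proof -
  obtain a b c d where Z: "a \<in> D" "b \<in> D" "c \<in> F" "d \<in> F" "Z = WF a b c d"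
    using Vect_WF[OF Vect_homog_Vect[OF assms]] .
  have "a = zD" "d = zF" using v_odd[OF assms] v_WF[OF Z(1-4)] Z(5) by simp_all
  then show thesis using that Z by blast
qed

lemma WF_even: "a \<in> D \<Longrightarrow> d \<in> F \<Longrightarrow> WF a zD zF d \<in> Vect_homog M 0"
  using VF_even[of a d] by (simp add: WF_def der_add_def der_mult_def)

lemma WF_odd: "b \<in> D \<Longrightarrow> c \<in> F \<Longrightarrow> WF zD b c zF \<in> Vect_homog M 1"
  using VF_odd[of "der_add b (der_mult c P0)" c] by (simp add: WF_def)

abbreviation lift where "lift u \<equiv> WF u zD zF zF"

text \<open>The lifts annihilate \<tau> and preserve F, so this is the metric on the even part of
  the complement of the kernel cut out by d\<tau>. The pairing of two lifts is even and therefore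
  lost nothing by taking \<open>e0\<close>.\<close>

definition \<gamma> where "\<gamma> u v = e0 (g (lift u) (lift v))"

lemma lift_even: "u \<in> D \<Longrightarrow> lift u \<in> Vect_homog M 0"
  by (rule WF_even) simp_all

lemma e1_g_lift: "u \<in> D \<Longrightarrow> v \<in> D \<Longrightarrow> e1 (g (lift u) (lift v)) = zF"
  using g_parity[OF lift_even lift_even, of u v] by (simp add: homog_iff)

text \<open>Lifts are even, so graded symmetry has no sign against either homogeneous part of
  Z.\<close>

lemma g_lift_sym:
  assumes u: "u \<in> D" and Z: "Z \<in> Vect M"
  shows "g (lift u) Z = g Z (lift u)"
proof -
  obtain Z0 Z1 where ZZ: "Z = vf_add M Z0 Z1" "Z0 \<in> Vect_homog M 0" "Z1 \<in> Vect_homog M 1"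
    using Z by (auto simp: Vect_def)
  note V = ZZ(2,3)[THEN Vect_homog_Vect]
  have one: "1 \<odot>\<^bsub>A\<^esub> x = x" if "x \<in> carrier A" for x
    by (rule A_eqI') (use that in \<open>simp_all add: e_algebra\<close>)
  have "g (lift u) Z0 = g Z0 (lift u)" "g (lift u) Z1 = g Z1 (lift u)"
    using g_sym[OF lift_even[OF u] ZZ(2)] g_sym[OF lift_even[OF u] ZZ(3)] one V u by simp_all
  then show ?thesis
    unfolding ZZ(1) using g_add_left[OF V] g_add_right[OF _ V] u by simp
qed

text \<open>The left argument is lift a + \<tau> lift b + (c + d\<tau>)Q. The last summand lies in
  the kernel, and the factor \<tau> moves the degree 0 part of the pairing with lift b into the
  coefficient of \<tau>.\<close>

lemma g_expand_left:
  assumes "a \<in> D" "b \<in> D" "c \<in> F" "d \<in> F" and W: "W \<in> Vect M"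
  shows "e0 (g (WF a b c d) W) m = e0 (g (lift a) W) m"
    and "e1 (g (WF a b c d) W) m = e1 (g (lift a) W) m + e0 (g (lift b) W) m"
proof -
  let ?\<tau> = "mk zF (cst 1)" and ?k = "mk c d"
  note \<tau> = mk[OF F_zero F_cst[of 1]]
  note k = mk[OF assms(3,4)]
  have 1: "vf_mult M ?\<tau> (lift b) = WF zD b zF zF"
    using assms \<tau> by (simp add: vf_mult_WF der_mult_cst_1)
  have 2: "vf_mult M ?k Q = WF zD zD c d"
    using assms k by (subst Q_VF) (simp add: vf_mult_VF WF_def F_times_cst)
  have "WF a b c d = vf_add M (lift a) (vf_add M (vf_mult M ?\<tau> (lift b)) (vf_mult M ?k Q))"
    unfolding 1 2 using assms by (simp add: vf_add_WF)
  moreover have V: "vf_mult M ?\<tau> (lift b) \<in> Vect M" "vf_mult M ?k Q \<in> Vect M"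
    using \<tau> k assms Q_Vect by (simp_all add: vf_mult_Vect)
  moreover have "vf_add M (vf_mult M ?\<tau> (lift b)) (vf_mult M ?k Q) \<in> Vect M"
    unfolding 1 2 using assms by (simp add: vf_add_WF)
  ultimately have "g (WF a b c d) W = g (lift a) W \<oplus>\<^bsub>A\<^esub> (g (vf_mult M ?\<tau> (lift b)) W \<oplus>\<^bsub>A\<^esub> g (vf_mult M ?k Q) W)"
    using assms by (simp add: g_add_left)
  then show "e0 (g (WF a b c d) W) m = e0 (g (lift a) W) m"
    "e1 (g (WF a b c d) W) m = e1 (g (lift a) W) m + e0 (g (lift b) W) m"
    using V W assms \<tau> k e_F(1)[of "g (lift b) W"]
    by (simp_all add: e_algebra g_mult_left Q_Vect g_Q e_zero F_times_cst)
qed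

lemma \<gamma>_D_F: "u \<in> D \<Longrightarrow> v \<in> D \<Longrightarrow> \<gamma> u v \<in> F"
  by (simp add: \<gamma>_def e_F)

lemma \<gamma>_commute: "u \<in> D \<Longrightarrow> v \<in> D \<Longrightarrow> \<gamma> u v = \<gamma> v u"
  unfolding \<gamma>_def by (subst g_lift_sym) simp_all

lemma \<gamma>_sum: "u \<in> D \<Longrightarrow> v \<in> D \<Longrightarrow> w \<in> D \<Longrightarrow> \<gamma> (der_add u v) w = (\<lambda>m. \<gamma> u w m + \<gamma> v w m)"
proof -
  assume "u \<in> D" "v \<in> D" "w \<in> D"
  moreover from this have "lift (der_add u v) = vf_add M (lift u) (lift v)"
    by (simp add: vf_add_WF)
  ultimately show ?thesis by (simp add: \<gamma>_def g_add_left e_algebra)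
qed

lemma \<gamma>_scale: "h \<in> F \<Longrightarrow> u \<in> D \<Longrightarrow> v \<in> D \<Longrightarrow> \<gamma> (der_mult h u) v = (\<lambda>m. h m * \<gamma> u v m)"
proof -
  assume h: "h \<in> F" "u \<in> D" "v \<in> D"
  note k = mk[OF h(1) F_zero]
  have "lift (der_mult h u) = vf_mult M (mk h zF) (lift u)"
    using h k by (simp add: vf_mult_WF)
  then show ?thesis using h k by (intro ext) (simp add: \<gamma>_def g_mult_left)
qed

text \<open>The metric is \<gamma> extended bilinearly over \<tau>. No signs arise, since lifts are
  even and the term with both b and b' carries \<tau> squared.\<close>

lemma e_g_WF:
  assumes "a \<in> D" "b \<in> D" "c \<in> F" "d \<in> F" "a' \<in> D" "b' \<in> D" "c' \<in> F" "d' \<in> F"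
  shows "e0 (g (WF a b c d) (WF a' b' c' d')) m = \<gamma> a a' m"
    and "e1 (g (WF a b c d) (WF a' b' c' d')) m = \<gamma> a b' m + \<gamma> b a' m"
proof -
  have W: "WF a' b' c' d' \<in> Vect M" using assms by simp
  have "e0 (g (lift u) (WF a' b' c' d')) m = \<gamma> u a' m"
    "e1 (g (lift u) (WF a' b' c' d')) m = \<gamma> u b' m" if u: "u \<in> D" for u
    using g_expand_left[OF assms(5-8), of "lift u" m] assms u
    by (simp_all add: g_lift_sym[OF u W] e1_g_lift \<gamma>_def[symmetric] \<gamma>_commute[OF u])
  then show "e0 (g (WF a b c d) (WF a' b' c' d')) m = \<gamma> a a' m"
    "e1 (g (WF a b c d) (WF a' b' c' d')) m = \<gamma> a b' m + \<gamma> b a' m"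
    using g_expand_left[OF assms(1-4) W, of m] assms by simp_all
qed

end

section \<open>Nondegeneracy of the reduced metric\<close>

context super_null begin

lemma fun_value_e0: "m \<in> X \<Longrightarrow> fun_value M m f = e0 f m"
  by (simp add: e0_def)

lemma \<gamma>_linear: "w \<in> D \<Longrightarrow> F_linear (\<lambda>u. \<gamma> u w)"
  by (simp add: F_linear_def \<gamma>_D_F \<gamma>_sum \<gamma>_scale)

lemma \<gamma>_tensorial:
  assumes "m \<in> X" "u \<in> D" "u' \<in> D" "w \<in> D" "\<And>f. f \<in> F \<Longrightarrow> u f m = u' f m"
  shows "\<gamma> u w m = \<gamma> u' w m"
proof -
  have "\<gamma> (der_add u (der_mult (cst (- 1)) u')) w m = 0"
    by (rule F_linear_vanish[OF \<gamma>_linear[OF assms(4)] _ assms(1)])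
      (use assms in \<open>simp_all add: der_add_apply der_mult_apply, simp add: cst_def\<close>)
  then show ?thesis
    using assms by (simp add: \<gamma>_sum \<gamma>_scale) (simp add: cst_def)
qed

lemma value_lift:
  assumes "m \<in> X" "u \<in> D"
  shows "vf_value M m (lift u) = (\<lambda>x\<in>carrier A. u (e0 x) m)"
  using assms
  by (intro ext) (simp add: vf_value_def fun_value_e0 WF_def VF_apply restrict_def)

text \<open>The form at a point is defined through vector fields with given values, so every tangent
  vector must be such a value. It splits into a point derivation of F and its value on
  \<tau>.\<close>

lemma tangent_vector_realized:
  assumes m: "m \<in> X" and v: "v \<in> tangent_space M m"
  obtains Z where "Z \<in> Vect M" "vf_value M m Z = v"
proof -
  have v_ext: "v \<in> extensional (carrier A)"
    and v_add: "\<And>f h. f \<in> carrier A \<Longrightarrow> h \<in> carrier A \<Longrightarrow> v (f \<oplus>\<^bsub>A\<^esub> h) = v f + v h"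
    and v_scale: "\<And>r f. f \<in> carrier A \<Longrightarrow> v (r \<odot>\<^bsub>A\<^esub> f) = r * v f"
    and v_mult: "\<And>f h. f \<in> carrier A \<Longrightarrow> h \<in> carrier A \<Longrightarrow> v (f \<otimes>\<^bsub>A\<^esub> h) = v f * e0 h m + e0 f m * v h"
    using v by (simp_all add: tangent_space_def fun_value_e0[OF m])
  let ?\<tau> = "mk zF (cst 1)"
  note \<tau> = mk[OF F_zero F_cst[of 1]]
  note l = mk[OF _ F_zero]
  define w where "w f = v (mk f zF)" for f
  have w: "point_derivation m w"
    unfolding point_derivation_def
  proof (intro conjI ballI allI)
    fix f h :: "'p \<Rightarrow> real" assume fh: "f \<in> F" "h \<in> F"
    have "mk (\<lambda>m. f m + h m) zF = mk f zF \<oplus>\<^bsub>A\<^esub> mk h zF" "mk (\<lambda>m. f m * h m) zF = mk f zF \<otimes>\<^bsub>A\<^esub> mk h zF"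
      by (rule A_eqI'; use fh in \<open>simp add: l e_algebra\<close>)+
    then show "w (\<lambda>m. f m + h m) = w f + w h" "w (\<lambda>m. f m * h m) = w f * h m + f m * w h"
      using fh by (simp_all add: w_def v_add v_mult l)
  next
    fix r and f :: "'p \<Rightarrow> real" assume f: "f \<in> F"
    have "mk (\<lambda>m. r * f m) zF = r \<odot>\<^bsub>A\<^esub> mk f zF"
      by (rule A_eqI'; use f in \<open>simp add: l e_algebra\<close>)
    then show "w (\<lambda>m. r * f m) = r * w f" using f by (simp add: w_def v_scale l)
  qed
  have v_eq: "v x = w (e0 x) + e1 x m * v ?\<tau>" if x: "x \<in> carrier A" for x
  proof -
    note xF = e_F[OF x]
    have "x = mk (e0 x) zF \<oplus>\<^bsub>A\<^esub> (mk (e1 x) zF \<otimes>\<^bsub>A\<^esub> ?\<tau>)"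
      by (rule A_eqI') (use x xF in \<open>simp_all add: l \<tau> e_algebra F_times_cst\<close>)
    then have "v x = v (mk (e0 x) zF) + v (mk (e1 x) zF \<otimes>\<^bsub>A\<^esub> ?\<tau>)"
      using v_add[of "mk (e0 x) zF" "mk (e1 x) zF \<otimes>\<^bsub>A\<^esub> ?\<tau>"] l xF \<tau> by simp
    then show ?thesis using xF \<tau> by (simp add: w_def v_mult l)
  qed
  obtain \<beta> and x :: "'n \<Rightarrow> 'p \<Rightarrow> real" and E where "\<beta> \<in> F" and \<beta>: "\<beta> m \<noteq> 0" and "\<And>a. x a \<in> F"
    and E: "\<And>a. E a \<in> D" and "\<And>a b. E a (x b) m = (if a = b then 1 else 0)"
    and frame: "\<And>m' v f. \<beta> m' \<noteq> 0 \<Longrightarrow> point_derivation m' v \<Longrightarrow> f \<in> F \<Longrightarrow> v f = (\<Sum>a\<in>UNIV. v (x a) * E a f m')"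
    using coordinate_frame[OF m] by blast
  \<comment> \<open>Extends the point derivation with constant coefficients in the frame around
    m.\<close>
  define u where "u = (\<lambda>f m'. \<Sum>a\<in>UNIV. cst (w (x a)) m' * E a f m')"
  have u: "u \<in> D" unfolding u_def by (rule D_sum) (use E in simp_all)
  have um: "u f m = w f" if "f \<in> F" for f
    using frame[OF \<beta> w that] m by (simp add: u_def cst_def)
  let ?Z = "VF u zD (cst (v ?\<tau>)) zF"
  have "vf_value M m ?Z = v"
  proof (rule extensionalityI[OF _ v_ext])
    fix y assume y: "y \<in> carrier A"
    show "vf_value M m ?Z y = v y"
      using y m u e_F[OF y] F_times_cst(1)[OF e_F(2)[OF y]] by (simp add: vf_value_def fun_value_e0 VF_apply um v_eq)
  qed (simp add: vf_value_def)
  moreover have "?Z \<in> Vect M" using u by (simp add: VF_Vect)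
  ultimately show thesis using that by blast
qed

text \<open>The value of lift u at m lies in the kernel of the form at m, hence is a multiple of an
  odd tangent vector and annihilates even functions.\<close>

lemma \<gamma>_nondeg:
  assumes m: "m \<in> X" and u: "u \<in> D" and zero: "\<And>v. v \<in> D \<Longrightarrow> \<gamma> u v m = 0" and f: "f \<in> F"
  shows "u f m = 0"
proof -
  define t where "t = (\<lambda>x\<in>carrier A. u (e0 x) m)"
  have t: "t \<in> tangent_space M m"
    unfolding tangent_space_def
    by (simp add: t_def e_algebra e_F der_sum_fun[OF u] der_scale_fun[OF u] der_mult_fun[OF u] fun_value_e0[OF m] algebra_simps)
  have "metric_at M g m t v = 0" if v: "v \<in> tangent_space M m" for v
    unfolding metric_at_def
  proof (rule the_equality)
    obtain Z where Z: "Z \<in> Vect M" "vf_value M m Z = v" using tangent_vector_realized[OF m v] .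
    \<comment> \<open>The pairing vanishes for every vector field Y with value t, not just for lift
      u; this makes the description of the form at m by a unique number meaningful.\<close>
    have eval: "e0 (g Y Z') m = 0" if Y: "Y \<in> Vect M" "vf_value M m Y = t" and Z': "Z' \<in> Vect M" for Y Z'
    proof -
      obtain a b c d where a: "a \<in> D" "b \<in> D" "c \<in> F" "d \<in> F" "Y = WF a b c d" using Vect_WF[OF Y(1)] .
      obtain a' b' c' d' where a': "a' \<in> D" "b' \<in> D" "c' \<in> F" "d' \<in> F" "Z' = WF a' b' c' d'" using Vect_WF[OF Z'] .
      have "a h m = u h m" if h: "h \<in> F" for h
      proof -
        note k = mk[OF h F_zero]
        have "vf_value M m Y (mk h zF) = t (mk h zF)" using Y(2) by simp
        then show ?thesis
          using k a m by (simp add: vf_value_def fun_value_e0 t_def WF_def VF_apply)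
      qed
      then have "\<gamma> a a' m = \<gamma> u a' m" by (intro \<gamma>_tensorial m a u a')
      then show ?thesis using zero[OF a'(1)] e_g_WF(1)[OF a(1-4) a'(1-4)] a(5) a'(5) by simp
    qed
    have lu: "lift u \<in> Vect M" "vf_value M m (lift u) = t"
      using u value_lift[OF m u] by (simp_all add: t_def)
    show "\<exists>Y\<in>Vect M. \<exists>Z\<in>Vect M. vf_value M m Y = t \<and> vf_value M m Z = v \<and> 0 = fun_value M m (g Y Z)"
      using lu Z eval[OF lu Z(1)] fun_value_e0[OF m] by metis
    fix r assume "\<exists>Y\<in>Vect M. \<exists>Z\<in>Vect M. vf_value M m Y = t \<and> vf_value M m Z = v \<and> r = fun_value M m (g Y Z)"
    then show "r = 0" using eval fun_value_e0[OF m] by auto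
  qed
  then have "t \<in> metric_ker_at M g m" using t by (simp add: metric_ker_at_def)
  then obtain w r where w: "w \<in> tangent_homog M m 1" "t = tv_scale M r w"
    using metric_ker_at[OF m] by auto
  note k = mk[OF f F_zero]
  \<comment> \<open>Parities add in the two-element field, so 1 + 1 is the even parity; this is the
    shape in which oddness of w is stated.\<close>
  have "mk f zF \<in> homog A (1 + 1)" using k by (simp add: homog_iff)
  then have "w (mk f zF) = 0" using w(1) unfolding tangent_homog_def by blast
  then have "t (mk f zF) = 0" using w(2) k by (simp add: tv_scale_def)
  then show ?thesis using k by (simp add: t_def)
qed

sublocale metric_algebra X F N \<gamma>
proof
  show "\<exists>\<beta>\<in>F. \<exists>x :: 'n \<Rightarrow> 'p \<Rightarrow> real. \<exists>E. \<beta> m \<noteq> 0 \<and>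
      (\<forall>a. x a \<in> F) \<and> (\<forall>a. E a \<in> D) \<and> (\<forall>a b. E a (x b) m = (if a = b then 1 else 0)) \<and>
      (\<forall>Z\<in>D. \<forall>f\<in>F. \<forall>m'. \<beta> m' * Z f m' = (\<Sum>a\<in>UNIV. (\<beta> m' * Z (x a) m') * E a f m'))" if "m \<in> X" for m
    by (rule local_frame_F[OF that])
qed (fact \<gamma>_D_F \<gamma>_commute \<gamma>_sum \<gamma>_scale \<gamma>_nondeg)+

section \<open>The compatible connection\<close>

abbreviation LC where "LC \<equiv> levi_civita"

lemma LC_zero: "v \<in> D \<Longrightarrow> LC zD v = zD" "v \<in> D \<Longrightarrow> LC v zD = zD"
  using levi_civita_mult_left[of zF v v] levi_civita_mult_right[of zF v v] der_zero[of v]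
  by (simp_all add: der_add_def der_mult_def fun_eq_iff)

text \<open>
  Applying $Z = a + \tau b + \dots$ to $W = a' + \tau b' + (c' + d'\tau)Q$ by the Leibniz rule, with $\nabla_Z v =
  \nabla_a v + \tau\nabla_b v$ on derivations $v$ of $F$ (here \<open>a\<close> and \<open>b\<close> are the parts of $Z$ acting on $F$,
  i.e. \<open>vA Z\<close> and \<open>vB Z\<close>) and with $\nabla_Z Q = 0$.
\<close>

definition conn where
  "conn Z W = (let c'' = (\<lambda>m. vA Z (vC W) m + vD W m * vC Z m) in
    WF (der_add (LC (vA Z) (vA W)) (der_mult (vC Z) (vQ W)))
      (der_add (LC (vB Z) (vA W)) (der_add (LC (vA Z) (vQ W)) (der_mult (vD Z) (vQ W))))
      c'' (\<lambda>m. vA Z (vD W) m + vB Z (vC W) m + vD W m * vD Z m))"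

lemma conn_WF:
  assumes "a \<in> D" "b \<in> D" "c \<in> F" "d \<in> F" "a' \<in> D" "b' \<in> D" "c' \<in> F" "d' \<in> F"
  shows "conn (WF a b c d) (WF a' b' c' d') =
    WF (der_add (LC a a') (der_mult c b'))
      (der_add (LC (der_add b (der_mult c P0)) a') (der_add (LC a b') (der_mult d b')))
      (\<lambda>m. a c' m + d' m * c m) (\<lambda>m. a d' m + (b c' m + c m * P0 c' m) + d' m * d m)"
  using assms by (simp add: conn_def v_WF der_add_apply der_mult_apply)

lemma conn_components:
  assumes "a \<in> D" "b \<in> D" "c \<in> F" "d \<in> F" "a' \<in> D" "b' \<in> D" "c' \<in> F" "d' \<in> F"
  shows "der_add (LC a a') (der_mult c b') \<in> D"
    "der_add (LC (der_add b (der_mult c P0)) a') (der_add (LC a b') (der_mult d b')) \<in> D"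
    "(\<lambda>m. a c' m + d' m * c m) \<in> F"
    "(\<lambda>m. a d' m + (b c' m + c m * P0 c' m) + d' m * d m) \<in> F"
  using assms der_F[of a] der_F[of b] der_F[of P0] by simp_all

lemma conn_Vect:
  assumes "Z \<in> Vect M" "W \<in> Vect M"
  shows "conn Z W \<in> Vect M"
proof -
  obtain a b c d where Z: "a \<in> D" "b \<in> D" "c \<in> F" "d \<in> F" "Z = WF a b c d" using Vect_WF[OF assms(1)] .
  obtain a' b' c' d' where W: "a' \<in> D" "b' \<in> D" "c' \<in> F" "d' \<in> F" "W = WF a' b' c' d'" using Vect_WF[OF assms(2)] .
  show ?thesis unfolding Z(5) W(5) conn_WF[OF Z(1-4) W(1-4)]
    by (intro WF_Vect conn_components[OF Z(1-4) W(1-4)])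
qed

lemma conn_parity:
  assumes "Z \<in> Vect_homog M i" "W \<in> Vect_homog M j"
  shows "conn Z W \<in> Vect_homog M (i + j)"
proof (cases "i = 0"; cases "j = 0")
  assume ij: "i = 0" "j = 0"
  obtain a d a' d' where Z: "a \<in> D" "d \<in> F" "Z = WF a zD zF d" and W: "a' \<in> D" "d' \<in> F" "W = WF a' zD zF d'"
    using assms Vect_even_WF unfolding ij by metis
  have "a zF = zF" using der_zero[OF Z(1)] by (simp add: fun_eq_iff)
  then show ?thesis unfolding Z(3) W(3) using Z W ij der_F[OF Z(1)]
    by (simp add: conn_WF LC_zero) (intro WF_even, simp_all)
next
  assume ij: "i = 0" "j \<noteq> 0"
  then have j: "j = 1" using bit_cases by blast
  obtain a d where Z: "a \<in> D" "d \<in> F" "Z = WF a zD zF d" using assms(1) Vect_even_WF unfolding ij by metis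
  obtain b' c' where W: "b' \<in> D" "c' \<in> F" "W = WF zD b' c' zF" using assms(2) Vect_odd_WF unfolding j by metis
  have "a zF = zF" using der_zero[OF Z(1)] by (simp add: fun_eq_iff)
  then show ?thesis unfolding Z(3) W(3) using Z W ij j der_F[OF Z(1)]
    by (simp add: conn_WF LC_zero) (intro WF_odd, simp_all)
next
  assume ij: "i \<noteq> 0" "j = 0"
  then have i: "i = 1" using bit_cases by blast
  obtain b c where Z: "b \<in> D" "c \<in> F" "Z = WF zD b c zF" using assms(1) Vect_odd_WF unfolding i by metis
  obtain a' d' where W: "a' \<in> D" "d' \<in> F" "W = WF a' zD zF d'" using assms(2) Vect_even_WF unfolding ij by metis
  have "b zF = zF" "P0 zF = zF" using der_zero[OF Z(1)] der_zero[OF P0_D] by (simp_all add: fun_eq_iff)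
  then show ?thesis unfolding Z(3) W(3) using Z W ij i
    by (simp add: conn_WF LC_zero) (intro WF_odd, simp_all)
next
  assume "i \<noteq> 0" "j \<noteq> 0"
  then have ij: "i = 1" "j = 1" using bit_cases by blast+
  obtain b c b' c' where Z: "b \<in> D" "c \<in> F" "Z = WF zD b c zF" and W: "b' \<in> D" "c' \<in> F" "W = WF zD b' c' zF"
    using assms Vect_odd_WF unfolding ij by metis
  show ?thesis unfolding Z(3) W(3) using Z W ij der_F[OF Z(1)] der_F[OF P0_D]
    by (simp add: conn_WF LC_zero) (intro WF_even, simp_all)
qed

lemmas LC_simps = levi_civita_add_left levi_civita_add_right levi_civita_mult_left levi_civita_mult_right

lemma conn_add:
  assumes "Y \<in> Vect M" "Z \<in> Vect M" "W \<in> Vect M"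
  shows "conn (vf_add M Y Z) W = vf_add M (conn Y W) (conn Z W)"
    and "conn Y (vf_add M Z W) = vf_add M (conn Y Z) (conn Y W)"
proof -
  obtain a b c d where Y: "a \<in> D" "b \<in> D" "c \<in> F" "d \<in> F" "Y = WF a b c d" using Vect_WF[OF assms(1)] .
  obtain a' b' c' d' where Z: "a' \<in> D" "b' \<in> D" "c' \<in> F" "d' \<in> F" "Z = WF a' b' c' d'" using Vect_WF[OF assms(2)] .
  obtain a'' b'' c'' d'' where W: "a'' \<in> D" "b'' \<in> D" "c'' \<in> F" "d'' \<in> F" "W = WF a'' b'' c'' d''" using Vect_WF[OF assms(3)] .
  note P0F = der_F[OF P0_D]
  have "conn (vf_add M (WF a b c d) (WF a' b' c' d')) (WF a'' b'' c'' d'') =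
      vf_add M (conn (WF a b c d) (WF a'' b'' c'' d'')) (conn (WF a' b' c' d') (WF a'' b'' c'' d''))"
    using Y Z W der_F[OF Y(1)] der_F[OF Y(2)] der_F[OF Z(1)] der_F[OF Z(2)] P0F
    by (simp add: vf_add_WF conn_WF LC_simps, intro WF_cong ext)
      (simp_all add: der_add_apply der_mult_apply algebra_simps)
  then show "conn (vf_add M Y Z) W = vf_add M (conn Y W) (conn Z W)" using Y Z W by simp
  have "conn (WF a b c d) (vf_add M (WF a' b' c' d') (WF a'' b'' c'' d'')) =
      vf_add M (conn (WF a b c d) (WF a' b' c' d')) (conn (WF a b c d) (WF a'' b'' c'' d''))"
    using Y Z W der_F[OF Y(1)] der_F[OF Y(2)] P0F
    by (simp add: vf_add_WF conn_WF LC_simps, intro WF_cong ext)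
      (simp_all add: der_add_apply der_mult_apply der_sum_fun[OF Y(1)] der_sum_fun[OF Y(2)] der_sum_fun[OF P0_D] algebra_simps)
  then show "conn Y (vf_add M Z W) = vf_add M (conn Y Z) (conn Y W)" using Y Z W by simp
qed

lemma conn_mult_left:
  assumes f: "f \<in> carrier A" and "Y \<in> Vect M" "Z \<in> Vect M"
  shows "conn (vf_mult M f Y) Z = vf_mult M f (conn Y Z)"
proof -
  obtain a b c d where Y: "a \<in> D" "b \<in> D" "c \<in> F" "d \<in> F" "Y = WF a b c d" using Vect_WF[OF assms(2)] .
  obtain a' b' c' d' where Z: "a' \<in> D" "b' \<in> D" "c' \<in> F" "d' \<in> F" "Z = WF a' b' c' d'" using Vect_WF[OF assms(3)] .
  have "conn (vf_mult M f (WF a b c d)) (WF a' b' c' d') = vf_mult M f (conn (WF a b c d) (WF a' b' c' d'))"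
    using f Y Z der_F[OF Y(1)] der_F[OF Y(2)] der_F[OF P0_D] e_F[OF f]
    by (simp add: vf_mult_WF conn_WF LC_simps, intro WF_cong ext)
      (simp_all add: der_add_apply der_mult_apply algebra_simps)
  then show ?thesis using Y Z by simp
qed

lemma Z_apply_WF:
  assumes "a \<in> D" "b \<in> D" "c \<in> F" "d \<in> F" "f \<in> carrier A"
  shows "WF a b c d f \<in> carrier A"
    "e0 (WF a b c d f) = (\<lambda>m. a (e0 f) m + e1 f m * c m)"
    "e1 (WF a b c d f) = (\<lambda>m. a (e1 f) m + (b (e0 f) m + c m * P0 (e0 f) m) + e1 f m * d m)"
  using assms by (auto simp: WF_def VF_apply fun_eq_iff der_add_apply der_mult_apply)

text \<open>Parities are separated because a sign appears only for odd Y and odd f. In each case the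
  four components reduce to the Leibniz rules of the Levi-Civita connection and of
  derivations.\<close>

lemma conn_leibniz:
  assumes Y: "Y \<in> Vect_homog M i" and f: "f \<in> homog A j" and Z: "Z \<in> Vect M"
  shows "conn Y (vf_mult M f Z) =
    vf_add M (vf_mult M (Y f) Z) (vf_scale M (koszul i j) (vf_mult M f (conn Y Z)))"
proof -
  have fA: "f \<in> carrier A" by (rule homog_A[OF f])
  note fF [simp] = e_F[OF fA]
  obtain a' b' c' d' where Z': "a' \<in> D" "b' \<in> D" "c' \<in> F" "d' \<in> F" "Z = WF a' b' c' d'" using Vect_WF[OF Z] .
  note P0F [simp] = der_F[OF P0_D]
  show ?thesis
  proof (cases "i = 0")
    case True
    obtain a d where Y': "a \<in> D" "d \<in> F" "Y = WF a zD zF d" using Y Vect_even_WF unfolding True by metis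
    note aF [simp] = der_F[OF Y'(1)]
    show ?thesis unfolding True Z'(5) Y'(3) using fA Y'(1,2) Z'(1-4)
      by (simp add: vf_mult_WF vf_scale_WF vf_add_WF conn_WF LC_simps LC_zero Z_apply_WF der_mult_cst_1, intro WF_cong ext)
        (simp_all add: der_add_apply der_mult_apply der_sum_fun[OF Y'(1)] der_mult_fun[OF Y'(1)] algebra_simps)
  next
    case False
    then have i: "i = 1" using bit_cases by blast
    obtain b c where Y': "b \<in> D" "c \<in> F" "Y = WF zD b c zF" using Y Vect_odd_WF unfolding i by metis
    note bF [simp] = der_F[OF Y'(1)]
    show ?thesis
    proof (cases "j = 0")
      case True
      then have f1: "e1 f = zF" using f homog_iff(1) by simp
      show ?thesis unfolding True i Z'(5) Y'(3) using fA f1 Y'(1,2) Z'(1-4)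
        by (simp add: vf_mult_WF vf_scale_WF vf_add_WF conn_WF LC_simps LC_zero Z_apply_WF der_mult_cst_1, intro WF_cong ext)
          (simp_all add: der_add_apply der_mult_apply der_mult_fun[OF Y'(1)] der_mult_fun[OF P0_D] algebra_simps)
    next
      case False
      then have j: "j = 1" using bit_cases by blast
      then have f0: "e0 f = zF" using f homog_iff(2) by simp
      \<comment> \<open>Outside X the constant is 0 rather than -1; there the identity holds because
        h vanishes.\<close>
      have "der_mult (cst (- 1)) (der_mult h u) = der_mult (\<lambda>m. - h m) u" if "h \<in> F" for h and u :: "('p \<Rightarrow> real) \<Rightarrow> 'p \<Rightarrow> real"
        by (intro ext) (simp add: der_mult_apply mult.assoc[symmetric] F_times_cst(2)[OF that])
      then show ?thesis unfolding j i Z'(5) Y'(3) using fA f0 Y'(1,2) Z'(1-4)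
        by (simp add: vf_mult_WF vf_scale_WF vf_add_WF conn_WF LC_simps LC_zero Z_apply_WF, intro WF_cong ext)
          (simp_all add: der_add_apply der_mult_apply der_zero[OF Y'(1)] der_zero[OF P0_D] algebra_simps)
    qed
  qed
qed

lemma affine_connection: "affine_connection M conn"
  unfolding affine_connection_def
  using conn_Vect conn_parity conn_add conn_mult_left conn_leibniz by blast

text \<open>Both coefficients of the pairing involve only \<gamma> of the a and b components.
  Derivatives of \<gamma> are handled by the Levi-Civita property, and the remaining terms come from
  Y\<tau>, the derivative of the factor \<tau>.\<close>

lemma conn_metric:
  assumes Y: "Y \<in> Vect_homog M i" and Z: "Z \<in> Vect_homog M j" and W: "W \<in> Vect_homog M k"
  shows "Y (g Z W) = g (conn Y Z) W \<oplus>\<^bsub>A\<^esub> (koszul i j \<odot>\<^bsub>A\<^esub> g Z (conn Y W))"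
proof -
  note V = Y[THEN Vect_homog_Vect] Z[THEN Vect_homog_Vect] W[THEN Vect_homog_Vect]
  have gA: "g Z W \<in> carrier A" "g (conn Y Z) W \<in> carrier A" "g Z (conn Y W) \<in> carrier A"
    using V by (simp_all add: conn_Vect)
  obtain a b c d where W': "a \<in> D" "b \<in> D" "c \<in> F" "d \<in> F" "W = WF a b c d" using Vect_WF[OF V(3)] .
  obtain a' b' c' d' where Z': "a' \<in> D" "b' \<in> D" "c' \<in> F" "d' \<in> F" "Z = WF a' b' c' d'" using Vect_WF[OF V(2)] .
  have e0g: "e0 (g Z W) = \<gamma> a' a" and e1g: "e1 (g Z W) = (\<lambda>m. \<gamma> a' b m + \<gamma> b' a m)"
    unfolding W'(5) Z'(5) by (intro ext e_g_WF W' Z')+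
  note P0F = der_F[OF P0_D]
  show ?thesis
  proof (cases "i = 0")
    case True
    obtain u s where Y': "u \<in> D" "s \<in> F" "Y = WF u zD zF s" using Y Vect_even_WF unfolding True by metis
    note Ya = Z_apply_WF[OF Y'(1) D_zero F_zero Y'(2) gA(1), folded Y'(3)]
    note C = conn_components[OF Y'(1) D_zero F_zero Y'(2) Z'(1-4)] conn_components[OF Y'(1) D_zero F_zero Y'(2) W'(1-4)]
    note cw = conn_WF[OF Y'(1) D_zero F_zero Y'(2) Z'(1-4)] conn_WF[OF Y'(1) D_zero F_zero Y'(2) W'(1-4)]
    show ?thesis
    proof (rule A_eqI')
      show "Y (g Z W) \<in> carrier A" by (rule Ya)
      show "g (conn Y Z) W \<oplus>\<^bsub>A\<^esub> (koszul i j \<odot>\<^bsub>A\<^esub> g Z (conn Y W)) \<in> carrier A" using gA by simp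
      fix m
      have 0: "e0 (g (conn Y Z) W) m = \<gamma> (LC u a') a m" "e0 (g Z (conn Y W)) m = \<gamma> a' (LC u a) m"
        and 1: "e1 (g (conn Y Z) W) m = \<gamma> (LC u a') b m + \<gamma> (der_add (LC u b') (der_mult s b')) a m"
          "e1 (g Z (conn Y W)) m = \<gamma> a' (der_add (LC u b) (der_mult s b)) m + \<gamma> b' (LC u a) m"
        unfolding Y'(3) W'(5) Z'(5) cw e_g_WF[OF C(1-4) W'(1-4)] e_g_WF[OF Z'(1-4) C(5-8)]
        using Y' Z' W' by (simp_all add: LC_zero)
      show "e0 (Y (g Z W)) m = e0 (g (conn Y Z) W \<oplus>\<^bsub>A\<^esub> (koszul i j \<odot>\<^bsub>A\<^esub> g Z (conn Y W))) m"
        using gA Y'(1,2) Z'(1-4) W'(1-4) by (simp add: True e_algebra 0 Ya e0g levi_civita_metric)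
      show "e1 (Y (g Z W)) m = e1 (g (conn Y Z) W \<oplus>\<^bsub>A\<^esub> (koszul i j \<odot>\<^bsub>A\<^esub> g Z (conn Y W))) m"
        using gA Y'(1,2) Z'(1-4) W'(1-4)
        by (simp add: True e_algebra 1 \<gamma>_simps Ya e0g e1g der_sum_fun[OF Y'(1)] levi_civita_metric algebra_simps)
    qed
  next
    case False
    then have i: "i = 1" using bit_cases by blast
    obtain v t where Y': "v \<in> D" "t \<in> F" "Y = WF zD v t zF" using Y Vect_odd_WF unfolding i by metis
    \<comment> \<open>The derivation by which Y acts on F, up to the factor \<tau>: besides v it
      contains the contribution of the Q-component of Y.\<close>
    let ?w = "der_add v (der_mult t P0)"
    have w: "?w \<in> D" using Y' by simp
    note Ya = Z_apply_WF[OF D_zero Y'(1,2) F_zero gA(1), folded Y'(3)]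
    note C = conn_components[OF D_zero Y'(1,2) F_zero Z'(1-4)] conn_components[OF D_zero Y'(1,2) F_zero W'(1-4)]
    note cw = conn_WF[OF D_zero Y'(1,2) F_zero Z'(1-4)] conn_WF[OF D_zero Y'(1,2) F_zero W'(1-4)]
    \<comment> \<open>The sign is -1 only for odd Z, and then a' = 0; for even Z it is 1 and b' = 0.
      So a term with the wrong sign is zero, and the two terms in \<gamma> b' b either vanish or
      cancel.\<close>
    have par: "koszul i j = 1 \<and> b' = zD \<or> koszul i j = - 1 \<and> a' = zD"
    proof (cases "j = 0")
      case True
      obtain p q where "p \<in> D" "q \<in> F" "Z = WF p zD zF q" using Z Vect_even_WF unfolding True by metis
      then have "b' = zD" using v_WF(2)[OF Z'(1-4)] v_WF(2)[of p zD zF q] Z'(5) by simp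
      then show ?thesis using True by simp
    next
      case False
      then have j: "j = 1" using bit_cases by blast
      have "a' = zD" using v_odd(1)[OF Z[unfolded j]] v_WF(1)[OF Z'(1-4)] Z'(5) by simp
      then show ?thesis using i j by simp
    qed
    have \<gamma>0: "\<gamma> zD x m = 0" "\<gamma> x zD m = 0" if "x \<in> D" for x m
      using that \<gamma>_scale[of zF x x] \<gamma>_mult_right[of zF x x] by (simp_all add: fun_eq_iff)
    show ?thesis
    proof (rule A_eqI')
      show "Y (g Z W) \<in> carrier A" by (rule Ya)
      show "g (conn Y Z) W \<oplus>\<^bsub>A\<^esub> (koszul i j \<odot>\<^bsub>A\<^esub> g Z (conn Y W)) \<in> carrier A" using gA by simp
      fix m
      have 0: "e0 (g (conn Y Z) W) m = t m * \<gamma> b' a m" "e0 (g Z (conn Y W)) m = t m * \<gamma> a' b m"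
        and 1: "e1 (g (conn Y Z) W) m = t m * \<gamma> b' b m + \<gamma> (LC ?w a') a m"
          "e1 (g Z (conn Y W)) m = \<gamma> a' (LC ?w a) m + t m * \<gamma> b' b m"
        unfolding Y'(3) W'(5) Z'(5) cw e_g_WF[OF C(1-4) W'(1-4)] e_g_WF[OF Z'(1-4) C(5-8)]
        using Y' Z' W' w by (simp_all add: LC_zero \<gamma>_simps)
      show "e0 (Y (g Z W)) m = e0 (g (conn Y Z) W \<oplus>\<^bsub>A\<^esub> (koszul i j \<odot>\<^bsub>A\<^esub> g Z (conn Y W))) m"
        using gA Y'(1,2) Z'(1-4) W'(1-4) par
        by (simp add: e_algebra 0 Ya e1g) (auto simp: \<gamma>0 algebra_simps)
      have "e1 (Y (g Z W)) m = ?w (\<gamma> a' a) m"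
        using gA Y'(1,2) by (simp add: Ya e0g der_add_apply der_mult_apply)
      also have "\<dots> = \<gamma> (LC ?w a') a m + \<gamma> a' (LC ?w a) m"
        using w Z' W' by (intro levi_civita_metric)
      finally show "e1 (Y (g Z W)) m = e1 (g (conn Y Z) W \<oplus>\<^bsub>A\<^esub> (koszul i j \<odot>\<^bsub>A\<^esub> g Z (conn Y W))) m"
        using gA Y'(1,2) Z'(1-4) W'(1-4) w par
        by (simp add: e_algebra 1) (auto simp: \<gamma>0 LC_zero levi_civita_D)
    qed
  qed
qed

end

theorem theorem2p2:
  fixes M :: "('p, 'f) superspace"
    and g :: "('f \<Rightarrow> 'f) \<Rightarrow> ('f \<Rightarrow> 'f) \<Rightarrow> 'f"
    and Q P :: "'f \<Rightarrow> 'f"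
  assumes "super_null_riemannian TYPE('n::finite) M g Q P"
  shows "\<exists>conn. affine_connection M conn \<and>
    (\<forall>i j k. \<forall>X\<in>Vect_homog M i. \<forall>Y\<in>Vect_homog M j. \<forall>Z\<in>Vect_homog M k.
        X (g Y Z) = g (conn X Y) Z \<oplus>\<^bsub>Cinf M\<^esub> (koszul i j \<odot>\<^bsub>Cinf M\<^esub> g Y (conn X Z)))"
proof -
  interpret super_null "TYPE('n)" M g Q P
    by (rule super_null.intro[OF assms])
  show ?thesis
    using affine_connection conn_metric by (intro exI[of _ conn]) simp
qed

end
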